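(* Let $0\le 2k<n$ and let $(M,g)$ be a compact Riemannian $n$-manifold with positive definite (or negative definite) Einstein-Lovelock tensor $T_{2k}$. Then there is no isometric $(2k)$-minimal immersion of $M$ in a Euclidean space. In particular, there are no compact $2$-minimal submanifolds (of positive dimension) in the Euclidean space with positive definite (or negative definite) Einstein tensor $T_2$. In other words, if $M$ is a compact submanifold of the Euclidean space with positive definite (or negative definite) Einstein tensor, then there exist variations of $M$ which increase the total scalar curvature and others which decrease it.
   Context: Double forms. On an $n$-dimensional Euclidean vector space $(V,g)$, a $(p,q)$-double form is an element of $\Lambda^pV^*\otimes\Lambda^qV^*$, viewed as a bilinear form $\Lambda^pV\times\Lambda^qV\to\mathbb R$. The exterior product is $(\theta_1\otimes\theta_2)(\theta_3\otimes\theta_4)=(\theta_1\wedge\theta_3)\otimes(\theta_2\wedge\theta_4)$, so that $B^k(x_1\wedge\dots\wedge x_k,y_1\wedge\dots\wedge y_k)=k!\det[B(x_i,y_j)]$ for a symmetric bilinear form $B$. The generalized Hodge star on $(p,q)$-double forms is $*\omega(\cdot,\cdot)=(-1)^{(p+q)(n-p-q)}\omega( *\cdot,*\cdot)$, with the usual Hodge star on the right; for an $(n,n)$-double form, $*\omega=\omega(e_1\wedge\dots\wedge e_n,e_1\wedge\dots\wedge e_n)$ with $(e_i)$ orthonormal. These operations are applied pointwise on tangent spaces. The Riemann tensor $R$ of an $n$-dimensional Riemannian manifold $(M,g)$ is viewed as a symmetric $(2,2)$-double form, with sign such that $R(x\wedge y,x\wedge y)$ is the sectional curvature for orthonormal $x,y$.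 The $(2k)$-th Einstein-Lovelock tensor is the symmetric bilinear form $T_{2k}=*\frac{1}{(n-2k-1)!}g^{n-2k-1}R^k$ for $2k<n$, and $T_n=0$ if $n=2k$; $T_0=g$ and the Einstein tensor is $T_2=\frac{\mathrm{scal}}{2}g-\mathrm{Ric}$. For an immersed submanifold of a Euclidean space with induced metric $g$, vector-valued second fundamental form $B$ and normal vector $N$, put $B_N(u,v)=\langle B(u,v),N\rangle$ and $h_{2k+1}(N)=*\left(\frac{g^{n-2k-1}}{(n-2k-1)!}R^kB_N\right)$ for $2k<n$ ($h_{2k+1}=0$ for $n=2k$). The immersion (or submanifold) is $(2k)$-minimal if $h_{2k+1}(N)=0$ for all normal vectors $N$ at all points. A variation of a compact submanifold $M\subset\mathbb R^{n+p}$ is a smooth map $F:M\times(-\epsilon,\epsilon)\to\mathbb R^{n+p}$ with $F(x,0)=x$ and each $\phi_t=F(\cdot,t)$ a diffeomorphism onto a submanifold. The total scalar curvature of $\phi_t(M)$ is the integral of the scalar curvature of its induced metric; the variation increases (decreases) it if for all small $t>0$ it is larger (smaller) than that of $M$. A compact manifold is without boundary. *)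

theory Defs
  imports "HOL-Analysis.Analysis"
begin

section \<open>Double forms on a Euclidean vector space\<close>

text \<open>
  The vector space is a type \<open>'v::euclidean_space\<close>, of which only the linear structure is used; its
  Euclidean structure is an arbitrary inner product \<open>g\<close>. A \<open>(p,q)\<close>-double form \<open>\<omega>\<close> is given by its
  values on decomposable multivectors: \<open>\<omega> [x\<^sub>1,\<dots>,x\<^sub>p] [y\<^sub>1,\<dots>,y\<^sub>q]\<close> stands for
  \<open>\<omega>(x\<^sub>1 \<and> \<dots> \<and> x\<^sub>p, y\<^sub>1 \<and> \<dots> \<and> y\<^sub>q)\<close>. Only lists of the lengths \<open>p\<close>, \<open>q\<close> are relevant.
\<close>

type_synonym 'v form = "'v list \<Rightarrow> real"
type_synonym 'v dform = "'v list \<Rightarrow> 'v list \<Rightarrow> real"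

definition inner_product :: "('v::euclidean_space \<Rightarrow> 'v \<Rightarrow> real) \<Rightarrow> bool" where
  "inner_product g \<longleftrightarrow> bilinear g \<and> (\<forall>u v. g u v = g v u) \<and> (\<forall>u. u \<noteq> 0 \<longrightarrow> 0 < g u u)"

definition positive_definite :: "('v::euclidean_space \<Rightarrow> 'v \<Rightarrow> real) \<Rightarrow> bool" where
  "positive_definite T \<longleftrightarrow> (\<forall>u. u \<noteq> 0 \<longrightarrow> 0 < T u u)"

definition negative_definite :: "('v::euclidean_space \<Rightarrow> 'v \<Rightarrow> real) \<Rightarrow> bool" where
  "negative_definite T \<longleftrightarrow> (\<forall>u. u \<noteq> 0 \<longrightarrow> T u u < 0)"

text \<open>Arguments \<open>a, \<dots>, a+p-1\<close> of a permuted list of vectors.\<close>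

definition pick :: "'v list \<Rightarrow> (nat \<Rightarrow> nat) \<Rightarrow> nat \<Rightarrow> nat \<Rightarrow> 'v list" where
  "pick xs \<sigma> a p = map (\<lambda>i. xs ! \<sigma> i) [a..<a + p]"

definition wedge :: "nat \<Rightarrow> nat \<Rightarrow> 'v form \<Rightarrow> 'v form \<Rightarrow> 'v form" where
  "wedge p r \<alpha> \<beta> xs =
     (\<Sum>\<sigma> | \<sigma> permutes {..<p + r}. of_int (sign \<sigma>) * \<alpha> (pick xs \<sigma> 0 p) * \<beta> (pick xs \<sigma> p r))
       / (fact p * fact r)"

text \<open>
  The bilinear extension of \<open>(\<theta>\<^sub>1 \<otimes> \<theta>\<^sub>2)(\<theta>\<^sub>3 \<otimes> \<theta>\<^sub>4) = (\<theta>\<^sub>1 \<and> \<theta>\<^sub>3) \<otimes> (\<theta>\<^sub>2 \<and> \<theta>\<^sub>4)\<close>, for factors of degrees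
  \<open>(p,q)\<close> and \<open>(r,s)\<close>.
\<close>

definition dprod :: "nat \<Rightarrow> nat \<Rightarrow> nat \<Rightarrow> nat \<Rightarrow> 'v dform \<Rightarrow> 'v dform \<Rightarrow> 'v dform" where
  "dprod p q r s \<omega> \<eta> xs ys =
     (\<Sum>\<sigma> | \<sigma> permutes {..<p + r}. \<Sum>\<tau> | \<tau> permutes {..<q + s}.
        of_int (sign \<sigma>) * of_int (sign \<tau>)
          * \<omega> (pick xs \<sigma> 0 p) (pick ys \<tau> 0 q) * \<eta> (pick xs \<sigma> p r) (pick ys \<tau> q s))
       / (fact p * fact r * (fact q * fact s))"

lemma dprod_tensor:
  "dprod p q r s (\<lambda>xs ys. \<theta>\<^sub>1 xs * \<theta>\<^sub>2 ys) (\<lambda>xs ys. \<theta>\<^sub>3 xs * \<theta>\<^sub>4 ys) xs ys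
     = wedge p r \<theta>\<^sub>1 \<theta>\<^sub>3 xs * wedge q s \<theta>\<^sub>2 \<theta>\<^sub>4 ys"
  unfolding dprod_def wedge_def
  by (simp add: sum_product mult_ac)

text \<open>\<open>dpow p q m \<omega>\<close> is \<open>\<omega>\<^sup>m\<close> for a \<open>(p,q)\<close>-double form \<open>\<omega>\<close>.\<close>

fun dpow :: "nat \<Rightarrow> nat \<Rightarrow> nat \<Rightarrow> 'v dform \<Rightarrow> 'v dform" where
  "dpow p q 0 \<omega> = (\<lambda>xs ys. 1)"
| "dpow p q (Suc m) \<omega> = dprod p q (m * p) (m * q) \<omega> (dpow p q m \<omega>)"

definition dform_of :: "('v \<Rightarrow> 'v \<Rightarrow> real) \<Rightarrow> 'v dform" where
  "dform_of b xs ys = b (xs ! 0) (ys ! 0)"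

definition onb :: "('v::euclidean_space \<Rightarrow> 'v \<Rightarrow> real) \<Rightarrow> 'v list" where
  "onb g = (SOME es. length es = DIM('v) \<and>
              (\<forall>i<DIM('v). \<forall>j<DIM('v). g (es ! i) (es ! j) = (if i = j then 1 else 0)))"

text \<open>The volume form of the orientation given by \<open>onb g\<close>.\<close>

definition gvol :: "('v::euclidean_space \<Rightarrow> 'v \<Rightarrow> real) \<Rightarrow> 'v form" where
  "gvol g xs = (\<Sum>\<sigma> | \<sigma> permutes {..<DIM('v)}.
                  of_int (sign \<sigma>) * (\<Prod>i<DIM('v). g (xs ! i) (onb g ! \<sigma> i)))"

text \<open>
  Let \<open>\<alpha> = x\<^sub>1 \<and> \<dots> \<and> x\<^sub>a\<close>. From \<open>\<alpha> \<and> *\<beta> = \<langle>\<alpha>,\<beta>\<rangle> vol\<close> one obtains \<open>*\<alpha> = (\<Sum>I. vol(\<alpha> \<and> e\<^sub>I) e\<^sub>I)\<close>, where \<open>I\<close>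
  ranges over the \<open>(n-a)\<close>-element sets of indices of the orthonormal basis and \<open>e\<^sub>I\<close> is the product
  of the basis vectors \<open>nths (onb g) I\<close> in increasing order. For a \<open>(p,q)\<close>-double form \<open>\<omega>\<close> this
  gives \<open>\<omega>(*\<cdot>, *\<cdot>)\<close> below. It does not depend on the basis nor on its orientation. The sign
  exponent \<open>(p+q)(n-p-q)\<close>, which may be negative, is replaced by \<open>(p+q)(n+p+q)\<close> of the same parity.
\<close>

definition hodge :: "('v::euclidean_space \<Rightarrow> 'v \<Rightarrow> real) \<Rightarrow> nat \<Rightarrow> nat \<Rightarrow> 'v dform \<Rightarrow> 'v dform" where
  "hodge g p q \<omega> xs ys =
     (- 1) ^ ((p + q) * (DIM('v) + p + q)) *
     (\<Sum>I | I \<subseteq> {..<DIM('v)} \<and> card I = p. \<Sum>J | J \<subseteq> {..<DIM('v)} \<and> card J = q.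
        gvol g (xs @ nths (onb g) I) * gvol g (ys @ nths (onb g) J)
          * \<omega> (nths (onb g) I) (nths (onb g) J))"

text \<open>
  In the next three definitions \<open>R\<close> is a \<open>(2,2)\<close>-double form and \<open>n = DIM('v)\<close>; \<open>gR k g R\<close> is
  \<open>g\<^bsup>n-2k-1\<^esup> R\<^sup>k / (n-2k-1)!\<close>, an \<open>(n-1,n-1)\<close>-double form. The convention \<open>T\<^bsub>2k\<^esub> = 0\<close>,
  \<open>h\<^bsub>2k+1\<^esub> = 0\<close> for \<open>n = 2k\<close> is extended to \<open>n < 2k\<close>; for \<open>n = 1\<close> this agrees with
  \<open>T\<^sub>2 = scal/2 g - Ric = 0\<close>.
\<close>

definition gR :: "nat \<Rightarrow> ('v::euclidean_space \<Rightarrow> 'v \<Rightarrow> real) \<Rightarrow> 'v dform \<Rightarrow> 'v dform" where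
  "gR k g R xs ys =
     (let m = DIM('v) - 2 * k - 1
      in dprod m m (2 * k) (2 * k) (dpow 1 1 m (dform_of g)) (dpow 2 2 k R) xs ys / fact m)"

definition lovelock_form ::
  "nat \<Rightarrow> ('v::euclidean_space \<Rightarrow> 'v \<Rightarrow> real) \<Rightarrow> 'v dform \<Rightarrow> 'v \<Rightarrow> 'v \<Rightarrow> real" where
  "lovelock_form k g R u v =
     (if 2 * k < DIM('v) then hodge g (DIM('v) - 1) (DIM('v) - 1) (gR k g R) [u] [v] else 0)"

definition h_form ::
  "nat \<Rightarrow> ('v::euclidean_space \<Rightarrow> 'v \<Rightarrow> real) \<Rightarrow> 'v dform \<Rightarrow> ('v \<Rightarrow> 'v \<Rightarrow> real) \<Rightarrow> real" where
  "h_form k g R b =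
     (if 2 * k < DIM('v)
      then hodge g (DIM('v)) (DIM('v))
             (dprod (DIM('v) - 1) (DIM('v) - 1) 1 1 (gR k g R) (dform_of b)) [] []
      else 0)"


section \<open>Smooth maps and curvature in coordinates\<close>

primrec Ck_on :: "nat \<Rightarrow> 'a::euclidean_space set \<Rightarrow> ('a \<Rightarrow> 'b::real_normed_vector) \<Rightarrow> bool" where
  "Ck_on 0 S f \<longleftrightarrow> continuous_on S f"
| "Ck_on (Suc k) S f \<longleftrightarrow>
     (\<forall>x\<in>S. f differentiable (at x)) \<and> (\<forall>v. Ck_on k S (\<lambda>x. frechet_derivative f (at x) v))"

text \<open>Used for open \<open>S\<close> only.\<close>

definition smooth_on :: "'a::euclidean_space set \<Rightarrow> ('a \<Rightarrow> 'b::real_normed_vector) \<Rightarrow> bool" where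
  "smooth_on S f \<longleftrightarrow> (\<forall>k. Ck_on k S f)"

text \<open>Directional derivative.\<close>

definition dd :: "('a::euclidean_space \<Rightarrow> 'b::real_normed_vector) \<Rightarrow> 'a \<Rightarrow> 'a \<Rightarrow> 'b" where
  "dd f x u = frechet_derivative f (at x) u"

text \<open>
  A metric on an open set of coordinates is a function \<open>g\<close> from points to inner products. Fixed
  vectors \<open>u, v, w\<close> are regarded as constant (hence commuting) vector fields;
  \<open>christoffel g x u v\<close> is the Levi-Civita derivative \<open>\<nabla>\<^sub>u v\<close>, given by the Koszul formula.
\<close>

definition christoffel ::
  "('v::euclidean_space \<Rightarrow> 'v \<Rightarrow> 'v \<Rightarrow> real) \<Rightarrow> 'v \<Rightarrow> 'v \<Rightarrow> 'v \<Rightarrow> 'v" where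
  "christoffel g x u v =
     (THE z. \<forall>w. g x z w =
        (dd (\<lambda>y. g y v w) x u + dd (\<lambda>y. g y u w) x v - dd (\<lambda>y. g y u v) x w) / 2)"

text \<open>\<open>R(u,v)w = \<nabla>\<^sub>u \<nabla>\<^sub>v w - \<nabla>\<^sub>v \<nabla>\<^sub>u w\<close>\<close>

definition curvature ::
  "('v::euclidean_space \<Rightarrow> 'v \<Rightarrow> 'v \<Rightarrow> real) \<Rightarrow> 'v \<Rightarrow> 'v \<Rightarrow> 'v \<Rightarrow> 'v \<Rightarrow> 'v" where
  "curvature g x u v w =
     dd (\<lambda>y. christoffel g y v w) x u - dd (\<lambda>y. christoffel g y u w) x v
     + christoffel g x u (christoffel g x v w) - christoffel g x v (christoffel g x u w)"

text \<open>\<open>R(u \<and> v, u \<and> v) = g(R(u,v)v, u)\<close> is the sectional curvature for orthonormal \<open>u, v\<close>.\<close>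

definition riemann :: "('v::euclidean_space \<Rightarrow> 'v \<Rightarrow> 'v \<Rightarrow> real) \<Rightarrow> 'v \<Rightarrow> 'v dform" where
  "riemann g x xs ys = g x (curvature g x (xs ! 0) (xs ! 1) (ys ! 1)) (ys ! 0)"

definition scal :: "('v::euclidean_space \<Rightarrow> 'v \<Rightarrow> 'v \<Rightarrow> real) \<Rightarrow> 'v \<Rightarrow> real" where
  "scal g x = (\<Sum>i<DIM('v). \<Sum>j<DIM('v). let e = onb (g x) in
                 riemann g x [e ! i, e ! j] [e ! i, e ! j])"

definition lovelock ::
  "nat \<Rightarrow> ('v::euclidean_space \<Rightarrow> 'v \<Rightarrow> 'v \<Rightarrow> real) \<Rightarrow> 'v \<Rightarrow> 'v \<Rightarrow> 'v \<Rightarrow> real" where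
  "lovelock k g x = lovelock_form k (g x) (riemann g x)"


section \<open>Manifolds and Riemannian metrics\<close>

text \<open>
  An \<open>n\<close>-dimensional manifold, \<open>n = CARD('n)\<close>, is a topological space with an atlas of local
  parametrizations: \<open>(V, \<psi>)\<close> consists of an open \<open>V \<subseteq> \<real>\<^sup>n\<close> and a homeomorphism \<open>\<psi>\<close> of \<open>V\<close> onto an
  open subset of the space. The atlas need not be maximal.
\<close>

type_synonym ('n, 'm) param = "(real ^ 'n) set \<times> (real ^ 'n \<Rightarrow> 'm)"

type_synonym ('n, 'm) metric =
  "('n, 'm) param \<Rightarrow> real ^ 'n \<Rightarrow> real ^ 'n \<Rightarrow> real ^ 'n \<Rightarrow> real"

definition transition ::
  "('n::finite, 'm) param \<Rightarrow> ('n, 'm) param \<Rightarrow> real ^ 'n \<Rightarrow> real ^ 'n" where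
  "transition c d x = inv_into (fst d) (snd d) (snd c x)"

definition smooth_manifold :: "'m topology \<Rightarrow> ('n::finite, 'm) param set \<Rightarrow> bool" where
  "smooth_manifold X A \<longleftrightarrow>
     topspace X \<noteq> {} \<and> Hausdorff_space X \<and> second_countable X \<and>
     (\<forall>(V, \<psi>)\<in>A. open V \<and> openin X (\<psi> ` V) \<and>
        homeomorphic_map (top_of_set V) (subtopology X (\<psi> ` V)) \<psi>) \<and>
     (\<Union>(V, \<psi>)\<in>A. \<psi> ` V) = topspace X \<and>
     (\<forall>c\<in>A. \<forall>d\<in>A. smooth_on {x \<in> fst c. snd c x \<in> snd d ` fst d} (transition c d))"

text \<open>
  A metric is given by its expression in every parametrization of the atlas; tangent vectors are
  represented by their coordinates, so that the expressions have to match under the derivatives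
  of the transition maps.
\<close>

definition riemannian_metric :: "('n::finite, 'm) param set \<Rightarrow> ('n, 'm) metric \<Rightarrow> bool" where
  "riemannian_metric A G \<longleftrightarrow>
     (\<forall>c\<in>A. (\<forall>x\<in>fst c. inner_product (G c x)) \<and>
             (\<forall>u v. smooth_on (fst c) (\<lambda>x. G c x u v))) \<and>
     (\<forall>c\<in>A. \<forall>d\<in>A. \<forall>x\<in>fst c. \<forall>y\<in>fst d. snd c x = snd d y \<longrightarrow>
        (\<forall>u v. G c x u v = G d y (dd (transition c d) x u) (dd (transition c d) x v)))"

definition riemannian_manifold ::
  "'m topology \<Rightarrow> ('n::finite, 'm) param set \<Rightarrow> ('n, 'm) metric \<Rightarrow> bool" where
  "riemannian_manifold X A G \<longleftrightarrow> smooth_manifold X A \<and> riemannian_metric A G"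

definition positive_lovelock ::
  "nat \<Rightarrow> ('n::finite, 'm) param set \<Rightarrow> ('n, 'm) metric \<Rightarrow> bool" where
  "positive_lovelock k A G \<longleftrightarrow>
     (\<forall>c\<in>A. \<forall>x\<in>fst c. positive_definite (lovelock k (G c) x))"

definition negative_lovelock ::
  "nat \<Rightarrow> ('n::finite, 'm) param set \<Rightarrow> ('n, 'm) metric \<Rightarrow> bool" where
  "negative_lovelock k A G \<longleftrightarrow>
     (\<forall>c\<in>A. \<forall>x\<in>fst c. negative_definite (lovelock k (G c) x))"

text \<open>The Borel measure with density \<open>sqrt (det (g\<^sub>i\<^sub>j))\<close> in every parametrization.\<close>

definition riemannian_volume ::
  "'m topology \<Rightarrow> ('n::finite, 'm) param set \<Rightarrow> ('n, 'm) metric \<Rightarrow> 'm measure" where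
  "riemannian_volume X A G =
     (THE \<mu>. space \<mu> = topspace X \<and> sets \<mu> = sigma_sets (topspace X) {U. openin X U} \<and>
        (\<forall>(V, \<psi>)\<in>A. \<forall>S\<in>sets \<mu>. S \<subseteq> \<psi> ` V \<longrightarrow>
           emeasure \<mu> S =
             (\<integral>\<^sup>+x. ennreal (sqrt (det (\<chi> i j. G (V, \<psi>) x (axis i 1) (axis j 1))))
                      * indicator {x \<in> V. \<psi> x \<in> S} x \<partial>lborel)))"

text \<open>The value at \<open>p\<close> does not depend on the parametrization chosen around \<open>p\<close>.\<close>

definition scalar_curvature ::
  "('n::finite, 'm) param set \<Rightarrow> ('n, 'm) metric \<Rightarrow> 'm \<Rightarrow> real" where
  "scalar_curvature A G p =
     (SOME s. \<exists>c\<in>A. \<exists>x\<in>fst c. snd c x = p \<and> s = scal (G c) x)"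

definition total_scalar_curvature ::
  "'m topology \<Rightarrow> ('n::finite, 'm) param set \<Rightarrow> ('n, 'm) metric \<Rightarrow> real" where
  "total_scalar_curvature X A G = (LINT p|riemannian_volume X A G. scalar_curvature A G p)"


section \<open>Immersions into Euclidean spaces\<close>

definition immersion ::
  "('n::finite, 'm) param set \<Rightarrow> ('m \<Rightarrow> 'e::euclidean_space) \<Rightarrow> bool" where
  "immersion A f \<longleftrightarrow>
     (\<forall>c\<in>A. smooth_on (fst c) (f \<circ> snd c) \<and> (\<forall>x\<in>fst c. inj (dd (f \<circ> snd c) x)))"

definition induced_metric :: "('m \<Rightarrow> 'e::euclidean_space) \<Rightarrow> ('n::finite, 'm) metric" where
  "induced_metric f c x u v = dd (f \<circ> snd c) x u \<bullet> dd (f \<circ> snd c) x v"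

definition isometric_immersion ::
  "('n::finite, 'm) param set \<Rightarrow> ('n, 'm) metric \<Rightarrow> ('m \<Rightarrow> 'e::euclidean_space) \<Rightarrow> bool" where
  "isometric_immersion A G f \<longleftrightarrow>
     immersion A f \<and> (\<forall>c\<in>A. \<forall>x\<in>fst c. \<forall>u v. induced_metric f c x u v = G c x u v)"

definition normal_space ::
  "('m \<Rightarrow> 'e::euclidean_space) \<Rightarrow> ('n::finite, 'm) param \<Rightarrow> real ^ 'n \<Rightarrow> 'e set" where
  "normal_space f c x = (range (dd (f \<circ> snd c) x))\<^sup>\<bottom>"

text \<open>The normal part of the second derivative of the immersion.\<close>

definition second_fundamental_form ::
  "('m \<Rightarrow> 'e::euclidean_space) \<Rightarrow> ('n::finite, 'm) param \<Rightarrow> real ^ 'n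
     \<Rightarrow> real ^ 'n \<Rightarrow> real ^ 'n \<Rightarrow> 'e" where
  "second_fundamental_form f c x u v =
     (THE b. b \<in> normal_space f c x \<and>
             dd (\<lambda>y. dd (f \<circ> snd c) y v) x u - b \<in> range (dd (f \<circ> snd c) x))"

text \<open>\<open>h\<^bsub>2k+1\<^esub>(N)\<close> at the point with coordinates \<open>x\<close>\<close>

definition h_odd ::
  "nat \<Rightarrow> ('m \<Rightarrow> 'e::euclidean_space) \<Rightarrow> ('n::finite, 'm) param \<Rightarrow> real ^ 'n \<Rightarrow> 'e \<Rightarrow> real" where
  "h_odd k f c x N =
     h_form k (induced_metric f c x) (riemann (induced_metric f c) x)
       (\<lambda>u v. second_fundamental_form f c x u v \<bullet> N)"

text \<open>\<open>minimal_immersion k\<close> is \<open>(2k)\<close>-minimality.\<close>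

definition minimal_immersion ::
  "nat \<Rightarrow> ('n::finite, 'm) param set \<Rightarrow> ('m \<Rightarrow> 'e::euclidean_space) \<Rightarrow> bool" where
  "minimal_immersion k A f \<longleftrightarrow>
     immersion A f \<and> (\<forall>c\<in>A. \<forall>x\<in>fst c. \<forall>N\<in>normal_space f c x. h_odd k f c x N = 0)"


section \<open>Submanifolds of Euclidean spaces and their variations\<close>

definition sub_params :: "'e::euclidean_space set \<Rightarrow> ('n::finite, 'e) param set" where
  "sub_params M =
     {(V, \<psi>). open V \<and> smooth_on V \<psi> \<and> (\<forall>x\<in>V. inj (dd \<psi> x)) \<and>
        openin (top_of_set M) (\<psi> ` V) \<and>
        homeomorphic_map (top_of_set V) (top_of_set (\<psi> ` V)) \<psi>}"

text \<open>The type argument \<open>TYPE('n)\<close> specifies the dimension \<open>CARD('n)\<close>, which is positive.\<close>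

definition submanifold :: "'n::finite itself \<Rightarrow> 'e::euclidean_space set \<Rightarrow> bool" where
  "submanifold (_ :: 'n itself) M \<longleftrightarrow>
     M \<noteq> {} \<and> (\<Union>(V, \<psi>)\<in>(sub_params M :: ('n, 'e) param set). \<psi> ` V) = M"

definition sub_total_scalar_curvature ::
  "'n::finite itself \<Rightarrow> 'e::euclidean_space set \<Rightarrow> real" where
  "sub_total_scalar_curvature (_ :: 'n itself) M =
     total_scalar_curvature (top_of_set M) (sub_params M :: ('n, 'e) param set)
       (induced_metric (\<lambda>p. p))"

text \<open>Smoothness of a map into a submanifold is smoothness as a map into the ambient space.\<close>

definition sub_diffeomorphism ::
  "'n::finite itself \<Rightarrow> 'e::euclidean_space set \<Rightarrow> 'e set \<Rightarrow> ('e \<Rightarrow> 'e) \<Rightarrow> bool" where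
  "sub_diffeomorphism (_ :: 'n itself) M M' \<phi> \<longleftrightarrow>
     bij_betw \<phi> M M' \<and>
     (\<forall>(V, \<psi>)\<in>(sub_params M :: ('n, 'e) param set). smooth_on V (\<phi> \<circ> \<psi>)) \<and>
     (\<forall>(V, \<psi>)\<in>(sub_params M' :: ('n, 'e) param set). smooth_on V (inv_into M \<phi> \<circ> \<psi>))"

definition variation ::
  "'n::finite itself \<Rightarrow> 'e::euclidean_space set \<Rightarrow> real \<Rightarrow> ('e \<times> real \<Rightarrow> 'e) \<Rightarrow> bool" where
  "variation (_ :: 'n itself) M \<epsilon> F \<longleftrightarrow>
     0 < \<epsilon> \<and>
     (\<forall>(V, \<psi>)\<in>(sub_params M :: ('n, 'e) param set).
        smooth_on (V \<times> {-\<epsilon><..<\<epsilon>}) (\<lambda>(x, t). F (\<psi> x, t))) \<and>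
     (\<forall>p\<in>M. F (p, 0) = p) \<and>
     (\<forall>t\<in>{-\<epsilon><..<\<epsilon>}.
        submanifold TYPE('n) ((\<lambda>p. F (p, t)) ` M) \<and>
        sub_diffeomorphism TYPE('n) M ((\<lambda>p. F (p, t)) ` M) (\<lambda>p. F (p, t)))"

definition increases_total_scal ::
  "'n::finite itself \<Rightarrow> 'e::euclidean_space set \<Rightarrow> ('e \<times> real \<Rightarrow> 'e) \<Rightarrow> bool" where
  "increases_total_scal d M F \<longleftrightarrow>
     (\<forall>\<^sub>F t in at_right 0. sub_total_scalar_curvature d ((\<lambda>p. F (p, t)) ` M)
                           > sub_total_scalar_curvature d M)"

definition decreases_total_scal ::
  "'n::finite itself \<Rightarrow> 'e::euclidean_space set \<Rightarrow> ('e \<times> real \<Rightarrow> 'e) \<Rightarrow> bool" where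
  "decreases_total_scal d M F \<longleftrightarrow>
     (\<forall>\<^sub>F t in at_right 0. sub_total_scalar_curvature d ((\<lambda>p. F (p, t)) ` M)
                           < sub_total_scalar_curvature d M)"

end

theory Submission
  imports Defs
begin

text \<open>
  Non-existence of minimal immersions needs no integral formula. At a point of \<open>M\<close> farthest from the
  origin the position vector \<open>N = f p\<close> is normal and \<open>B\<^sub>N \<le> - g\<close>, while \<open>h\<^bsub>2k+1\<^esub>(N)\<close> is the trace of
  \<open>T\<^bsub>2k\<^esub>\<close> against \<open>B\<^sub>N\<close>; this trace cannot vanish if \<open>T\<^bsub>2k\<^esub>\<close> is definite and \<open>B\<^sub>N\<close> negative definite.

  The variations are the homotheties \<open>p \<mapsto> (1 \<plusminus> t) p\<close>. The trace of \<open>T\<^sub>2\<close> is \<open>(n - 2)/2\<close> times the scalar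
  curvature, so a definite \<open>T\<^sub>2\<close> forces \<open>n \<ge> 3\<close> and a scalar curvature of one sign. Hence the total
  scalar curvature is not zero, and it is multiplied by \<open>(1 \<plusminus> t)\<^bsup>n-2\<^esup>\<close>.
\<close>

section \<open>Antisymmetrization over permutations\<close>

text \<open>The definitions are pointwise and chart by chart: \<open>onb\<close>,
  \<open>scalar_curvature\<close> and \<open>riemannian_volume\<close> are choices or definite
  descriptions, and nothing says at the outset that they vary continuously or agree between charts.
  The Gauss equation supplies this for the curvature. It expresses the Riemann tensor by the second
  fundamental form, which is the derivative of the projection onto the tangent space; this
  projection belongs to the image and not to the chart, so the scalar curvature becomes
  chart-independent without a transformation law for Christoffel symbols. The same formula gives
  continuity, hence integrability on a compact \<open>M\<close>. The volume has to be constructed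
  from finitely many charts before its behaviour under a homothety can be read off from uniqueness.

  The algebra rests on one point: products of double forms are double sums over permutations with
  nested antisymmetrizations, and an inner one is absorbed by the outer one at the cost of a
  factorial. These factorials cancel against the denominators of \<open>dprod\<close>.\<close>

lemma sum_sign_compose:
  assumes "\<rho> permutes S" "finite S"
  shows "(\<Sum>\<sigma> | \<sigma> permutes S. of_int (sign \<sigma>) * F (\<sigma> \<circ> \<rho>) :: real)
       = of_int (sign \<rho>) * (\<Sum>\<sigma> | \<sigma> permutes S. of_int (sign \<sigma>) * F \<sigma>)"
proof -
  have perm: "permutation \<rho>" using assms permutes_imp_permutation by blast
  have "(\<Sum>\<sigma> | \<sigma> permutes S. of_int (sign \<sigma>) * F \<sigma>)
      = (\<Sum>\<sigma> | \<sigma> permutes S. of_int (sign (\<sigma> \<circ> \<rho>)) * F (\<sigma> \<circ> \<rho>))"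
    by (rule sum_permutations_compose_right[OF assms(1)])
  also have "\<dots> = (\<Sum>\<sigma> | \<sigma> permutes S. of_int (sign \<rho>) * (of_int (sign \<sigma>) * F (\<sigma> \<circ> \<rho>)))"
    using assms perm by (intro sum.cong) (auto simp: sign_compose permutes_imp_permutation)
  finally have "(\<Sum>\<sigma> | \<sigma> permutes S. of_int (sign \<sigma>) * F \<sigma>)
      = of_int (sign \<rho>) * (\<Sum>\<sigma> | \<sigma> permutes S. of_int (sign \<sigma>) * F (\<sigma> \<circ> \<rho>))"
    by (simp add: sum_distrib_left)
  then show ?thesis by (simp flip: mult.assoc of_int_mult)
qed

text \<open>The inner permutations form a subgroup of order \<open>fact (card S')\<close>. Right
  translation by each of its members permutes the outer sum and produces its sign once more, so
  every \<open>\<rho>\<close> contributes the same amount.\<close>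

lemma sum_sign_collapse:
  assumes "S' \<subseteq> S" "finite S"
  shows "(\<Sum>\<sigma> | \<sigma> permutes S. of_int (sign \<sigma>) *
            (\<Sum>\<rho> | \<rho> permutes S'. of_int (sign \<rho>) * F (\<sigma> \<circ> \<rho>)) :: real)
       = fact (card S') * (\<Sum>\<sigma> | \<sigma> permutes S. of_int (sign \<sigma>) * F \<sigma>)"
proof -
  have fin: "finite S'" using assms finite_subset by blast
  have "(\<Sum>\<sigma> | \<sigma> permutes S. of_int (sign \<sigma>) *
            (\<Sum>\<rho> | \<rho> permutes S'. of_int (sign \<rho>) * F (\<sigma> \<circ> \<rho>)) :: real)
     = (\<Sum>\<rho> | \<rho> permutes S'. of_int (sign \<rho>) *
          (\<Sum>\<sigma> | \<sigma> permutes S. of_int (sign \<sigma>) * F (\<sigma> \<circ> \<rho>)))"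
    unfolding sum_distrib_left by (subst sum.swap) (simp add: mult_ac)
  also have "\<dots> = (\<Sum>\<rho> | \<rho> permutes S'. (\<Sum>\<sigma> | \<sigma> permutes S. of_int (sign \<sigma>) * F \<sigma>))"
  proof (rule sum.cong[OF refl], goal_cases)
    case (1 \<rho>)
    then have "\<rho> permutes S" using assms permutes_subset by blast
    then show ?case using assms by (simp add: sum_sign_compose flip: mult.assoc of_int_mult)
  qed
  finally show ?thesis using fin by (simp add: card_permutations)
qed

text \<open>\<open>F\<close> may couple the two permutations, so the collapse is made in the first
  argument with the whole sum over \<open>\<tau>\<close> as summand, and then in the second.\<close>

lemma sum_sign_collapse2:
  assumes "S' \<subseteq> S" "finite S"
  shows "(\<Sum>\<sigma> | \<sigma> permutes S. \<Sum>\<tau> | \<tau> permutes S. of_int (sign \<sigma>) * of_int (sign \<tau>) *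
            (\<Sum>\<rho> | \<rho> permutes S'. \<Sum>\<rho>' | \<rho>' permutes S'.
               of_int (sign \<rho>) * of_int (sign \<rho>') * F (\<sigma> \<circ> \<rho>) (\<tau> \<circ> \<rho>')) :: real)
       = fact (card S') ^ 2 * (\<Sum>\<sigma> | \<sigma> permutes S. \<Sum>\<tau> | \<tau> permutes S.
            of_int (sign \<sigma>) * of_int (sign \<tau>) * F \<sigma> \<tau>)"
  (is "?l = ?r")
proof -
  have "?l = (\<Sum>\<sigma> | \<sigma> permutes S. of_int (sign \<sigma>) * (\<Sum>\<rho> | \<rho> permutes S'. of_int (sign \<rho>) *
      (\<Sum>\<tau> | \<tau> permutes S. of_int (sign \<tau>) *
            (\<Sum>\<rho>' | \<rho>' permutes S'. of_int (sign \<rho>') * F (\<sigma> \<circ> \<rho>) (\<tau> \<circ> \<rho>')))))"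
    unfolding sum_distrib_left
    by (rule sum.cong[OF refl], subst sum.swap) (simp add: mult_ac)
  also have "\<dots> = fact (card S') * (\<Sum>\<sigma> | \<sigma> permutes S. of_int (sign \<sigma>) *
      (\<Sum>\<tau> | \<tau> permutes S. of_int (sign \<tau>) *
            (\<Sum>\<rho>' | \<rho>' permutes S'. of_int (sign \<rho>') * F \<sigma> (\<tau> \<circ> \<rho>'))))"
    using sum_sign_collapse[OF assms, of "\<lambda>\<sigma>. (\<Sum>\<tau> | \<tau> permutes S. of_int (sign \<tau>) *
            (\<Sum>\<rho>' | \<rho>' permutes S'. of_int (sign \<rho>') * F \<sigma> (\<tau> \<circ> \<rho>')))"] .
  also have "\<dots> = ?r"
    unfolding sum_sign_collapse[OF assms]
    by (simp add: sum_distrib_left power2_eq_square mult_ac)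
  finally show ?thesis .
qed

text \<open>When one vector is split off in front, the remaining ones are still permuted among
  themselves; shifting their indices by one turns such a permutation into one of the whole list with
  the same sign.\<close>

lemma permutes_Suc_conjugate:
  assumes "\<rho> permutes {..<m}"
  obtains \<rho>' where "\<rho>' permutes {..<Suc m}" "sign \<rho>' = sign \<rho>" "\<rho>' 0 = 0"
    "\<And>i. i < m \<Longrightarrow> \<rho>' (Suc i) = Suc (\<rho> i)"
proof
  let ?\<rho>' = "map_permutation {..<m} Suc \<rho>"
  have b: "bij_betw Suc {..<m} {1..<Suc m}"
    by (auto simp: bij_betw_def image_Suc_lessThan)
  have p: "?\<rho>' permutes {1..<Suc m}" by (rule map_permutation_permutes[OF b assms])
  then show "?\<rho>' permutes {..<Suc m}" by (rule permutes_subset) auto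
  show "?\<rho>' 0 = 0" using p by (simp add: permutes_not_in)
  show "sign ?\<rho>' = sign \<rho>" using assms by (intro sign_map_permutation) auto
  show "?\<rho>' (Suc i) = Suc (\<rho> i)" if "i < m" for i
    using that by (simp add: map_permutation_apply)
qed

section \<open>Permuted argument lists and products of double forms\<close>

lemma length_pick [simp]: "length (pick xs \<sigma> a p) = p"
  by (simp add: pick_def)

lemma nth_pick [simp]: "i < p \<Longrightarrow> pick xs \<sigma> a p ! i = xs ! \<sigma> (a + i)"
  by (simp add: pick_def)

lemma pick_pick:
  assumes "\<rho> permutes {..<n}" "a + p \<le> n"
  shows "pick (pick xs \<sigma> 0 n) \<rho> a p = pick xs (\<sigma> \<circ> \<rho>) a p"
proof (rule nth_equalityI)
  fix i assume "i < length (pick (pick xs \<sigma> 0 n) \<rho> a p)"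
  then have "i < p" by simp
  moreover have "\<rho> (a + i) < n" using assms \<open>i < p\<close> permutes_in_image[OF assms(1), of "a + i"] by auto
  ultimately show "pick (pick xs \<sigma> 0 n) \<rho> a p ! i = pick xs (\<sigma> \<circ> \<rho>) a p ! i" by simp
qed simp

text \<open>A permutation of a permuted list is a composition. In this form the inner sum of a
  product has the shape \<open>F (\<sigma> \<circ> \<rho>) (\<tau> \<circ> \<rho>')\<close> that
  \<open>sum_sign_collapse2\<close> absorbs.\<close>

lemma dprod_pick:
  "dprod p p r r \<omega> \<eta> (pick xs \<sigma> 0 (p + r)) (pick ys \<tau> 0 (p + r)) =
     (\<Sum>\<rho> | \<rho> permutes {..<p + r}. \<Sum>\<rho>' | \<rho>' permutes {..<p + r}.
        of_int (sign \<rho>) * of_int (sign \<rho>')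
          * (\<omega> (pick xs (\<sigma> \<circ> \<rho>) 0 p) (pick ys (\<tau> \<circ> \<rho>') 0 p)
            * \<eta> (pick xs (\<sigma> \<circ> \<rho>) p r) (pick ys (\<tau> \<circ> \<rho>') p r)))
       / (fact p * fact r) ^ 2"
  unfolding dprod_def
  by (intro arg_cong2[where f = "(/)"] sum.cong) (auto simp: pick_pick power2_eq_square mult_ac)

text \<open>The alternation is made by the sum over all permutations in \<open>dprod\<close>: left
  translation by \<open>\<rho>\<close> and \<open>\<rho>'\<close> reindexes it and leaves the two
  signs behind.\<close>

lemma dprod_pick_compose:
  assumes "\<rho> permutes {..<p + r}" "\<rho>' permutes {..<p + r}"
  shows "dprod p p r r \<omega> \<eta> (pick xs (\<sigma> \<circ> \<rho>) 0 (p + r)) (pick ys (\<tau> \<circ> \<rho>') 0 (p + r))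
       = of_int (sign \<rho>) * of_int (sign \<rho>')
          * dprod p p r r \<omega> \<eta> (pick xs \<sigma> 0 (p + r)) (pick ys \<tau> 0 (p + r))"
proof -
  define F where "F \<alpha> \<beta> = \<omega> (pick xs (\<sigma> \<circ> \<alpha>) 0 p) (pick ys (\<tau> \<circ> \<beta>) 0 p)
            * \<eta> (pick xs (\<sigma> \<circ> \<alpha>) p r) (pick ys (\<tau> \<circ> \<beta>) p r)" for \<alpha> \<beta>
  define P where "P = {\<alpha>. \<alpha> permutes {..<p + r}}"
  have "(\<Sum>\<alpha>\<in>P. \<Sum>\<beta>\<in>P. of_int (sign \<alpha>) * of_int (sign \<beta>) * F (\<rho> \<circ> \<alpha>) (\<rho>' \<circ> \<beta>))
     = of_int (sign \<rho>) * of_int (sign \<rho>') *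
        (\<Sum>\<alpha>\<in>P. \<Sum>\<beta>\<in>P. of_int (sign (\<rho> \<circ> \<alpha>)) * of_int (sign (\<rho>' \<circ> \<beta>)) * F (\<rho> \<circ> \<alpha>) (\<rho>' \<circ> \<beta>))"
  proof -
    have s: "of_int (sign (r \<circ> \<alpha>)) = (of_int (sign r) * of_int (sign \<alpha>) :: real)"
      if "\<alpha> \<in> P" "r \<in> P" for r \<alpha>
      using that unfolding P_def
      by (metis finite_lessThan mem_Collect_eq of_int_mult permutes_imp_permutation sign_compose)
    have m: "\<rho> \<in> P" "\<rho>' \<in> P" using assms by (auto simp: P_def)
    have 1: "of_int (sign \<rho>) * of_int (sign \<rho>) = (1::real)" "of_int (sign \<rho>') * of_int (sign \<rho>') = (1::real)"
      by (simp_all flip: of_int_mult)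
    show ?thesis
      unfolding sum_distrib_left
      apply (intro sum.cong refl)
      apply (simp add: s m)
      using 1 by (metis (no_types, opaque_lifting) mult.commute mult.left_commute mult_1)
  qed
  also have "(\<Sum>\<alpha>\<in>P. \<Sum>\<beta>\<in>P. of_int (sign (\<rho> \<circ> \<alpha>)) * of_int (sign (\<rho>' \<circ> \<beta>)) * F (\<rho> \<circ> \<alpha>) (\<rho>' \<circ> \<beta>))
     = (\<Sum>\<alpha>\<in>P. \<Sum>\<beta>\<in>P. of_int (sign \<alpha>) * of_int (sign \<beta>) * F \<alpha> \<beta>)"
    unfolding P_def
    unfolding setum_permutations_compose_left[OF assms(1), of "\<lambda>\<alpha>. \<Sum>\<beta> | \<beta> permutes {..<p + r}.
        of_int (sign \<alpha>) * of_int (sign \<beta>) * F \<alpha> \<beta>"]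
    unfolding setum_permutations_compose_left[OF assms(2), of "\<lambda>\<beta>. _ * of_int (sign \<beta>) * F _ \<beta>"] ..
  finally show ?thesis
    unfolding dprod_pick F_def P_def by (simp add: comp_assoc)
qed

text \<open>The value is \<open>m!\<close> times the determinant of the numbers
  \<open>b (xs ! i) (ys ! j)\<close>. It is kept as a double sum over permutations, the form in
  which \<open>sum_sign_collapse2\<close> absorbs it into a larger product. In the induction the new
  factor comes in front, and the \<open>(fact m)\<^sup>2\<close> pairs of inner permutations cancel
  the denominator of \<open>dprod\<close>.\<close>

lemma dpow_dform_of:
  "dpow 1 1 m (dform_of b) xs ys =
     (\<Sum>\<sigma> | \<sigma> permutes {..<m}. \<Sum>\<tau> | \<tau> permutes {..<m}.
        of_int (sign \<sigma>) * of_int (sign \<tau>) * (\<Prod>i<m. b (xs ! \<sigma> i) (ys ! \<tau> i)))"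
proof (induction m arbitrary: xs ys)
  case 0
  then show ?case by (simp add: permutes_empty)
next
  case (Suc m)
  define P where "P m = {\<sigma>. \<sigma> permutes {..<m::nat}}" for m
  define F where "F \<sigma> \<tau> = (\<Prod>i<Suc m. b (xs ! \<sigma> i) (ys ! \<tau> i))" for \<sigma> \<tau>
  \<comment> \<open>\<open>S\<close> lifts a permutation of the last \<open>m\<close> positions to
    all \<open>Suc m\<close> positions, fixing the first one, where the new factor stands.\<close>
  have "\<exists>S. \<forall>\<rho>\<in>P m. S \<rho> permutes {..<Suc m} \<and> sign (S \<rho>) = sign \<rho> \<and> S \<rho> 0 = 0 \<and>
      (\<forall>i<m. S \<rho> (Suc i) = Suc (\<rho> i))"
    by (rule bchoice) (metis P_def mem_Collect_eq permutes_Suc_conjugate)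
  then obtain S where S: "\<And>\<rho>. \<rho> \<in> P m \<Longrightarrow> S \<rho> permutes {..<Suc m}" "\<And>\<rho>. \<rho> \<in> P m \<Longrightarrow> sign (S \<rho>) = sign \<rho>"
      "\<And>\<rho>. \<rho> \<in> P m \<Longrightarrow> S \<rho> 0 = 0" "\<And>\<rho> i. \<rho> \<in> P m \<Longrightarrow> i < m \<Longrightarrow> S \<rho> (Suc i) = Suc (\<rho> i)"
    by blast
  have fin: "finite (P m)" for m by (simp add: P_def finite_permutations)
  have lt: "\<rho> i < m" if "\<rho> \<in> P m" "i < m" for \<rho> i
    using that permutes_in_image[of \<rho> "{..<m}" i] by (auto simp: P_def)
  have A: "b (pick xs \<sigma> 0 1 ! 0) (pick ys \<tau> 0 1 ! 0) *
      (\<Prod>i<m. b (pick xs \<sigma> 1 m ! \<rho> i) (pick ys \<tau> 1 m ! \<rho>' i)) = F (\<sigma> \<circ> S \<rho>) (\<tau> \<circ> S \<rho>')"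
    if "\<rho> \<in> P m" "\<rho>' \<in> P m" for \<sigma> \<tau> \<rho> \<rho>'
    unfolding F_def prod.lessThan_Suc_shift using that S lt by auto
  have swap4: "(\<Sum>\<sigma>\<in>P (Suc m). \<Sum>\<tau>\<in>P (Suc m). \<Sum>\<rho>\<in>P m. \<Sum>\<rho>'\<in>P m. h \<sigma> \<tau> \<rho> \<rho>')
     = (\<Sum>\<rho>\<in>P m. \<Sum>\<rho>'\<in>P m. \<Sum>\<sigma>\<in>P (Suc m). \<Sum>\<tau>\<in>P (Suc m). h \<sigma> \<tau> \<rho> \<rho>')" for h :: "_ \<Rightarrow> _ \<Rightarrow> _ \<Rightarrow> _ \<Rightarrow> real"
  proof -
    have s3: "(\<Sum>b\<in>B. \<Sum>c\<in>C. \<Sum>d\<in>D. f b c d) = (\<Sum>c\<in>C. \<Sum>d\<in>D. \<Sum>b\<in>B. f b c d)"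
      for f :: "(nat \<Rightarrow> nat) \<Rightarrow> (nat \<Rightarrow> nat) \<Rightarrow> (nat \<Rightarrow> nat) \<Rightarrow> real" and B C D
      by (subst sum.swap, rule sum.cong[OF refl], rule sum.swap)
    show ?thesis by (subst s3, rule s3)
  qed
  have B: "(\<Sum>\<sigma>\<in>P (Suc m). \<Sum>\<tau>\<in>P (Suc m). of_int (sign \<sigma>) * of_int (sign \<tau>) * F (\<sigma> \<circ> S \<rho>) (\<tau> \<circ> S \<rho>'))
     = of_int (sign \<rho>) * of_int (sign \<rho>') *
       (\<Sum>\<sigma>\<in>P (Suc m). \<Sum>\<tau>\<in>P (Suc m). of_int (sign \<sigma>) * of_int (sign \<tau>) * F \<sigma> \<tau>)"
    if "\<rho> \<in> P m" "\<rho>' \<in> P m" for \<rho> \<rho>'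
  proof -
    have "(\<Sum>\<sigma>\<in>P (Suc m). \<Sum>\<tau>\<in>P (Suc m). of_int (sign \<sigma>) * of_int (sign \<tau>) * F (\<sigma> \<circ> S \<rho>) (\<tau> \<circ> S \<rho>'))
      = (\<Sum>\<sigma>\<in>P (Suc m). of_int (sign \<sigma>) * (\<Sum>\<tau>\<in>P (Suc m). of_int (sign \<tau>) * F (\<sigma> \<circ> S \<rho>) (\<tau> \<circ> S \<rho>')))"
      by (simp add: sum_distrib_left mult_ac)
    also have "\<dots> = of_int (sign \<rho>) * (\<Sum>\<sigma>\<in>P (Suc m). of_int (sign \<sigma>) * (\<Sum>\<tau>\<in>P (Suc m). of_int (sign \<tau>) * F \<sigma> (\<tau> \<circ> S \<rho>')))"
      unfolding P_def
      using sum_sign_compose[OF S(1)[OF that(1)], of "\<lambda>\<sigma>. (\<Sum>\<tau> | \<tau> permutes {..<Suc m}. of_int (sign \<tau>) * F \<sigma> (\<tau> \<circ> S \<rho>'))"]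
      by (simp add: S that)
    also have "\<dots> = of_int (sign \<rho>) * (\<Sum>\<sigma>\<in>P (Suc m). of_int (sign \<sigma>) * (of_int (sign \<rho>') * (\<Sum>\<tau>\<in>P (Suc m). of_int (sign \<tau>) * F \<sigma> \<tau>)))"
      unfolding P_def
      using sum_sign_compose[OF S(1)[OF that(2)], of "F _"]
      by (simp add: S that)
    finally show ?thesis by (simp add: sum_distrib_left mult_ac)
  qed
  have "dpow 1 1 (Suc m) (dform_of b) xs ys * (fact m)^2 =
     (\<Sum>\<sigma>\<in>P (Suc m). \<Sum>\<tau>\<in>P (Suc m). of_int (sign \<sigma>) * of_int (sign \<tau>) *
        b (pick xs \<sigma> 0 1 ! 0) (pick ys \<tau> 0 1 ! 0) *
       (\<Sum>\<rho>\<in>P m. \<Sum>\<rho>'\<in>P m. of_int (sign \<rho>) * of_int (sign \<rho>') *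
         (\<Prod>i<m. b (pick xs \<sigma> 1 m ! \<rho> i) (pick ys \<tau> 1 m ! \<rho>' i))))"
    unfolding P_def dpow.simps dprod_def mult_1_right Suc.IH
    by (simp add: dform_of_def power2_eq_square)
  also have "\<dots> = (\<Sum>\<sigma>\<in>P (Suc m). \<Sum>\<tau>\<in>P (Suc m). \<Sum>\<rho>\<in>P m. \<Sum>\<rho>'\<in>P m.
        of_int (sign \<rho>) * of_int (sign \<rho>') * (of_int (sign \<sigma>) * of_int (sign \<tau>) * F (\<sigma> \<circ> S \<rho>) (\<tau> \<circ> S \<rho>')))"
    unfolding sum_distrib_left by (intro sum.cong refl) (simp add: A[symmetric] mult_ac)
  also have "\<dots> = (\<Sum>\<rho>\<in>P m. \<Sum>\<rho>'\<in>P m. of_int (sign \<rho>) * of_int (sign \<rho>') *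
      (\<Sum>\<sigma>\<in>P (Suc m). \<Sum>\<tau>\<in>P (Suc m). of_int (sign \<sigma>) * of_int (sign \<tau>) * F (\<sigma> \<circ> S \<rho>) (\<tau> \<circ> S \<rho>')))"
    unfolding swap4 sum_distrib_left ..
  also have "\<dots> = (\<Sum>\<rho>\<in>P m. \<Sum>\<rho>'\<in>P m. (\<Sum>\<sigma>\<in>P (Suc m). \<Sum>\<tau>\<in>P (Suc m). of_int (sign \<sigma>) * of_int (sign \<tau>) * F \<sigma> \<tau>))"
  proof (intro sum.cong refl)
    fix \<rho> \<rho>' assume "\<rho> \<in> P m" "\<rho>' \<in> P m"
    then show "of_int (sign \<rho>) * of_int (sign \<rho>') *
      (\<Sum>\<sigma>\<in>P (Suc m). \<Sum>\<tau>\<in>P (Suc m). of_int (sign \<sigma>) * of_int (sign \<tau>) * F (\<sigma> \<circ> S \<rho>) (\<tau> \<circ> S \<rho>'))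
      = (\<Sum>\<sigma>\<in>P (Suc m). \<Sum>\<tau>\<in>P (Suc m). of_int (sign \<sigma>) * of_int (sign \<tau>) * F \<sigma> \<tau>)"
      by (simp only: B) (simp add: sign_def)
  qed
  also have "\<dots> = (fact m)^2 * (\<Sum>\<sigma>\<in>P (Suc m). \<Sum>\<tau>\<in>P (Suc m). of_int (sign \<sigma>) * of_int (sign \<tau>) * F \<sigma> \<tau>)"
    by (simp add: P_def card_permutations power2_eq_square)
  finally have "dpow 1 1 (Suc m) (dform_of b) xs ys = (\<Sum>\<sigma>\<in>P (Suc m). \<Sum>\<tau>\<in>P (Suc m). of_int (sign \<sigma>) * of_int (sign \<tau>) * F \<sigma> \<tau>)"
    by simp
  then show ?case unfolding P_def F_def .
qed

section \<open>Orthonormal bases of an inner product\<close>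

text \<open>The condition inside \<open>onb\<close>, for lists of any length, so that Gram-Schmidt
  can proceed by induction on the length.\<close>

definition orthonormal_list :: "('v::euclidean_space \<Rightarrow> 'v \<Rightarrow> real) \<Rightarrow> 'v list \<Rightarrow> bool" where
  "orthonormal_list g es \<longleftrightarrow>
     (\<forall>i<length es. \<forall>j<length es. g (es ! i) (es ! j) = (if i = j then 1 else 0))"

lemma orthonormal_list_independent:
  assumes g: "bilinear g" and es: "orthonormal_list g es"
  shows "distinct es" "independent (set es)"
proof -
  show "distinct es"
    using es unfolding distinct_conv_nth orthonormal_list_def by (metis zero_neq_one)
  show "independent (set es)"
    unfolding dependent_def
  proof safe
    fix v assume "v \<in> set es" and sp: "v \<in> span (set es - {v})"
    then obtain j where j: "j < length es" "v = es ! j" by (metis in_set_conv_nth)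
    have "linear (\<lambda>x. g x v)" using g by (simp add: bilinear_def)
    moreover have "g x v = 0" if "x \<in> set es - {v}" for x
      using that es j unfolding orthonormal_list_def by (metis Diff_iff in_set_conv_nth singletonI)
    ultimately have "g v v = 0" using linear_eq_0_on_span[of "\<lambda>x. g x v"] sp by blast
    moreover have "g v v = 1" using es j unfolding orthonormal_list_def by simp
    ultimately show False by simp
  qed
qed

text \<open>Each induction step is a Gram-Schmidt step: fewer than \<open>DIM('v)\<close> vectors do
  not span, and a vector outside their span survives the subtraction of its projection.\<close>

lemma ex_orthonormal_list:
  fixes g :: "'v::euclidean_space \<Rightarrow> 'v \<Rightarrow> real"
  assumes "inner_product g" "k \<le> DIM('v)"
  shows "\<exists>es. length es = k \<and> orthonormal_list g es"
  using assms(2)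
proof (induction k)
  case 0
  then show ?case by (simp add: orthonormal_list_def)
next
  case (Suc k)
  then obtain es where es: "length es = k" "orthonormal_list g es" by auto
  have bil: "bilinear g" and sym: "\<And>u v. g u v = g v u" and pos: "\<And>u. u \<noteq> 0 \<Longrightarrow> 0 < g u u"
    using assms by (auto simp: inner_product_def)
  have lin: "linear (\<lambda>x. g x y)" for y using bil by (simp add: bilinear_def)
  have "dim (span (set es)) \<le> card (set es)" by (simp add: dim_le_card')
  also have "\<dots> \<le> k" using card_length es by blast
  finally have "span (set es) \<noteq> UNIV"
    using Suc.prems by (metis dim_UNIV not_less_eq_eq)
  then obtain w where w: "w \<notin> span (set es)" by blast
  define v where "v = w - (\<Sum>i<k. g w (es ! i) *\<^sub>R es ! i)"
  have "(\<Sum>i<k. g w (es ! i) *\<^sub>R es ! i) \<in> span (set es)"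
    using es by (intro span_sum span_mul span_base) auto
  then have "v \<noteq> 0" using w by (auto simp: v_def)
  have v0: "g v (es ! j) = 0" if "j < k" for j
  proof -
    have "g v (es ! j) = g w (es ! j) - (\<Sum>i<k. g w (es ! i) * g (es ! i) (es ! j))"
      unfolding v_def by (simp add: linear_diff[OF lin] linear_sum[OF lin] linear_scale[OF lin])
    also have "(\<Sum>i<k. g w (es ! i) * g (es ! i) (es ! j)) = (\<Sum>i<k. if i = j then g w (es ! i) else 0)"
      using es that by (intro sum.cong) (auto simp: orthonormal_list_def)
    finally show ?thesis using that by (simp add: sum.delta)
  qed
  define u where "u = (1 / sqrt (g v v)) *\<^sub>R v"
  have u1: "g u u = 1" using pos[OF \<open>v \<noteq> 0\<close>]
    by (simp add: u_def bilinear_lmul[OF bil] bilinear_rmul[OF bil])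
  have u0: "g u (es ! j) = 0" "g (es ! j) u = 0" if "j < k" for j
    using v0[OF that] sym by (simp_all add: u_def bilinear_lmul[OF bil] bilinear_rmul[OF bil])
  have "orthonormal_list g (es @ [u])"
    using es u0 u1 by (auto simp: orthonormal_list_def nth_append less_Suc_eq)
  then show ?case using es by (intro exI[of _ "es @ [u]"]) simp
qed

context
  fixes g :: "'v::euclidean_space \<Rightarrow> 'v \<Rightarrow> real"
  assumes g: "inner_product g"
begin

lemma inner_product_bilinear: "bilinear g"
  and inner_product_pos: "u \<noteq> 0 \<Longrightarrow> 0 < g u u"
  using g by (auto simp: inner_product_def)

lemma inner_product_linear: "linear (\<lambda>x. g x y)" "linear (g x)"
  using inner_product_bilinear by (auto simp: bilinear_def)

lemma length_onb: "length (onb g) = DIM('v)"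
  and onb_orthonormal: "orthonormal_list g (onb g)"
proof -
  have "\<exists>es. length es = DIM('v) \<and>
      (\<forall>i<DIM('v). \<forall>j<DIM('v). g (es ! i) (es ! j) = (if i = j then 1 else 0))"
    using ex_orthonormal_list[OF g, of "DIM('v)"] unfolding orthonormal_list_def by force
  from someI_ex[OF this, folded onb_def]
  show "length (onb g) = DIM('v)" "orthonormal_list g (onb g)"
    by (auto simp: orthonormal_list_def)
qed

lemma onb_inner: "i < DIM('v) \<Longrightarrow> j < DIM('v) \<Longrightarrow> g (onb g ! i) (onb g ! j) = (if i = j then 1 else 0)"
  using onb_orthonormal length_onb by (simp add: orthonormal_list_def)

lemma distinct_onb: "distinct (onb g)"
  by (rule orthonormal_list_independent[OF inner_product_bilinear onb_orthonormal])

lemma span_onb: "span (set (onb g)) = UNIV"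
proof -
  have "independent (set (onb g))"
    by (rule orthonormal_list_independent[OF inner_product_bilinear onb_orthonormal])
  moreover have "card (set (onb g)) = DIM('v)"
    using distinct_onb length_onb distinct_card by metis
  ultimately show ?thesis
    by (metis card_eq_dim dim_UNIV finite_set span_UNIV top_greatest card_ge_dim_independent top.extremum_uniqueI order_refl)
qed

lemma onb_eqI:
  assumes "\<And>i. i < DIM('v) \<Longrightarrow> g u (onb g ! i) = g v (onb g ! i)"
  shows "u = v"
proof -
  have lin: "linear (g (u - v))" by (rule inner_product_linear)
  have "g (u - v) x = 0" if "x \<in> set (onb g)" for x
    using that assms length_onb inner_product_bilinear
    by (auto simp: in_set_conv_nth bilinear_lsub)
  then have "g (u - v) (u - v) = 0"
    using linear_eq_0_on_span[OF lin] span_onb by blast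
  then show ?thesis using inner_product_pos[of "u - v"] by fastforce
qed

lemma onb_expansion: "v = (\<Sum>i<DIM('v). g v (onb g ! i) *\<^sub>R onb g ! i)"
proof (rule onb_eqI)
  fix j assume j: "j < DIM('v)"
  have "g (\<Sum>i<DIM('v). g v (onb g ! i) *\<^sub>R onb g ! i) (onb g ! j)
      = (\<Sum>i<DIM('v). g v (onb g ! i) * g (onb g ! i) (onb g ! j))"
    by (simp add: linear_sum[OF inner_product_linear(1)] linear_scale[OF inner_product_linear(1)])
  also have "\<dots> = (\<Sum>i<DIM('v). if i = j then g v (onb g ! i) else 0)"
    using j by (intro sum.cong) (auto simp: onb_inner)
  finally show "g v (onb g ! j) = g (\<Sum>i<DIM('v). g v (onb g ! i) *\<^sub>R onb g ! i) (onb g ! j)"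
    using j by (simp add: sum.delta)
qed

lemma onb_parseval: "g u v = (\<Sum>i<DIM('v). g u (onb g ! i) * g v (onb g ! i))"
proof -
  have "g u v = g u (\<Sum>i<DIM('v). g v (onb g ! i) *\<^sub>R onb g ! i)" using onb_expansion[of v] by simp
  also have "\<dots> = (\<Sum>i<DIM('v). g u (onb g ! i) * g v (onb g ! i))"
    using inner_product_linear(2)[of u] by (simp add: linear_sum linear_scale mult.commute)
  finally show ?thesis .
qed

end

text \<open>The sum is the trace of \<open>T\<close> against \<open>b\<close>; expanding \<open>b\<close> in a basis orthonormal for \<open>b\<close>
  itself turns it into a sum of values \<open>T w w\<close>.\<close>

lemma trace_pos:
  fixes g :: "'v::euclidean_space \<Rightarrow> 'v \<Rightarrow> real"
  assumes g: "inner_product g" and T: "bilinear T" "positive_definite T" and b: "inner_product b"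
  shows "0 < (\<Sum>i<DIM('v). \<Sum>j<DIM('v). T (onb g ! i) (onb g ! j) * b (onb g ! i) (onb g ! j))"
    (is "0 < ?S")
proof -
  define e f where "e = onb g" and "f = onb b"
  \<comment> \<open>\<open>w k\<close> represents the functional
    \<open>\<lambda>x. b x (f ! k)\<close> with respect to \<open>g\<close>. It does not vanish,
    since this functional takes the value 1 at \<open>f ! k\<close>.\<close>
  define w where "w k = (\<Sum>i<DIM('v). b (e ! i) (f ! k) *\<^sub>R e ! i)" for k
  have "?S = (\<Sum>i<DIM('v). \<Sum>j<DIM('v). \<Sum>k<DIM('v).
      b (e ! i) (f ! k) * b (e ! j) (f ! k) * T (e ! i) (e ! j))"
    unfolding e_def[symmetric] f_def
    by (intro sum.cong refl, subst onb_parseval[OF b]) (simp add: sum_distrib_left mult_ac)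
  also have "\<dots> = (\<Sum>k<DIM('v). \<Sum>i<DIM('v). \<Sum>j<DIM('v).
      b (e ! i) (f ! k) * b (e ! j) (f ! k) * T (e ! i) (e ! j))"
    by (subst (2) sum.swap, subst sum.swap) simp
  also have "\<dots> = (\<Sum>k<DIM('v). T (w k) (w k))"
  proof (rule sum.cong[OF refl])
    fix k
    have l: "linear (T x)" "linear (\<lambda>x. T x y)" for x y using T(1) by (auto simp: bilinear_def)
    show "(\<Sum>i<DIM('v). \<Sum>j<DIM('v). b (e ! i) (f ! k) * b (e ! j) (f ! k) * T (e ! i) (e ! j)) = T (w k) (w k)"
      unfolding w_def using l
      by (subst sum.swap) (simp add: linear_sum[OF l(1)] linear_sum[OF l(2)] linear_scale[OF l(1)]
          linear_scale[OF l(2)] sum_distrib_left mult_ac)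
  qed
  also have "0 < (\<Sum>k<DIM('v). T (w k) (w k))"
  proof (rule sum_pos)
    fix k assume "k \<in> {..<DIM('v)}"
    then have k: "k < DIM('v)" by simp
    have "w k \<noteq> 0"
    proof
      assume "w k = 0"
      have lin: "linear (\<lambda>x. b x (f ! k))" by (rule inner_product_linear[OF b])
      have "b (e ! i) (f ! k) = 0" if "i < DIM('v)" for i
      proof -
        have "g (w k) (e ! i) = (\<Sum>j<DIM('v). b (e ! j) (f ! k) * g (e ! j) (e ! i))"
          unfolding w_def
          by (simp add: linear_sum[OF inner_product_linear(1)[OF g]] linear_scale[OF inner_product_linear(1)[OF g]])
        also have "\<dots> = (\<Sum>j<DIM('v). if j = i then b (e ! j) (f ! k) else 0)"
          using that unfolding e_def by (intro sum.cong) (auto simp: onb_inner[OF g])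
        finally have "g (w k) (e ! i) = b (e ! i) (f ! k)" using that by (simp add: sum.delta)
        then show ?thesis using \<open>w k = 0\<close> inner_product_bilinear[OF g] by (simp add: bilinear_lzero)
      qed
      then have "b x (f ! k) = 0" if "x \<in> set (onb g)" for x
        using that length_onb[OF g] unfolding e_def by (auto simp: in_set_conv_nth)
      then have "b (f ! k) (f ! k) = 0"
        using linear_eq_0_on_span[OF lin] span_onb[OF g] by blast
      then show False using onb_inner[OF b k k] by (simp add: f_def)
    qed
    then show "0 < T (w k) (w k)" using T by (simp add: positive_definite_def)
  qed (use DIM_positive[where 'a = 'v] in \<open>auto simp: lessThan_empty_iff\<close>)
  finally show ?thesis .
qed

section \<open>Traces of double forms of degree \<open>n - 1\<close>\<close>

lemma gvol_permute:
  fixes g :: "'v::euclidean_space \<Rightarrow> 'v \<Rightarrow> real"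
  assumes "\<rho> permutes {..<DIM('v)}" "\<And>i. i < DIM('v) \<Longrightarrow> ys ! i = xs ! \<rho> i"
  shows "gvol g ys = of_int (sign \<rho>) * gvol g xs"
proof -
  define G where "G \<sigma> = (\<Prod>i<DIM('v). g (ys ! i) (onb g ! \<sigma> i))" for \<sigma>
  have "G (\<sigma> \<circ> \<rho>) = (\<Prod>i<DIM('v). g (xs ! i) (onb g ! \<sigma> i))" for \<sigma>
  proof -
    have "G (\<sigma> \<circ> \<rho>) = (\<Prod>i<DIM('v). g (xs ! \<rho> i) (onb g ! \<sigma> (\<rho> i)))"
      unfolding G_def using assms by (intro prod.cong) auto
    also have "\<dots> = (\<Prod>i<DIM('v). g (xs ! i) (onb g ! \<sigma> i))"
      using prod.permute[OF assms(1), of "\<lambda>i. g (xs ! i) (onb g ! \<sigma> i)"] by (simp add: o_def)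
    finally show ?thesis .
  qed
  then have "gvol g xs = of_int (sign \<rho>) * gvol g ys"
    using sum_sign_compose[OF assms(1), of G] by (simp add: gvol_def G_def)
  then show ?thesis by (simp flip: mult.assoc of_int_mult)
qed

lemma gvol_repeated:
  fixes g :: "'v::euclidean_space \<Rightarrow> 'v \<Rightarrow> real"
  assumes "a < DIM('v)" "b < DIM('v)" "a \<noteq> b" "xs ! a = xs ! b"
  shows "gvol g xs = 0"
proof -
  have "gvol g xs = of_int (sign (Transposition.transpose a b)) * gvol g xs"
    using assms by (intro gvol_permute permutes_swap_id) (auto simp: Transposition.transpose_def)
  then show ?thesis using assms by (simp add: sign_swap_id)
qed

lemma gvol_onb:
  fixes g :: "'v::euclidean_space \<Rightarrow> 'v \<Rightarrow> real"
  assumes g: "inner_product g"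
  shows "gvol g (onb g) = 1"
proof -
  have "(\<Prod>i<DIM('v). g (onb g ! i) (onb g ! \<sigma> i)) = (if \<sigma> = id then 1 else 0)"
    if \<sigma>: "\<sigma> permutes {..<DIM('v)}" for \<sigma>
  proof (cases "\<sigma> = id")
    case True
    then show ?thesis by (simp add: onb_inner[OF g])
  next
    case False
    then obtain i where i: "\<sigma> i \<noteq> i" by (auto simp: fun_eq_iff)
    then have "i < DIM('v)" using \<sigma> by (auto simp: permutes_def)
    moreover have "\<sigma> i < DIM('v)" using \<sigma> calculation permutes_in_image[OF \<sigma>, of i] by auto
    ultimately have "g (onb g ! i) (onb g ! \<sigma> i) = 0" using i by (simp add: onb_inner[OF g])
    then show ?thesis using False \<open>i < DIM('v)\<close> by (auto intro: prod_zero)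
  qed
  then have "gvol g (onb g) = (\<Sum>\<sigma> | \<sigma> permutes {..<DIM('v)}. if \<sigma> = id then 1 else 0)"
    unfolding gvol_def by (intro sum.cong) (auto simp: sign_id)
  also have "\<dots> = 1" by (simp add: finite_permutations permutes_id sum.delta)
  finally show ?thesis .
qed

lemma gvol_linear_Cons:
  fixes g :: "'v::euclidean_space \<Rightarrow> 'v \<Rightarrow> real"
  assumes g: "inner_product g"
  shows "linear (\<lambda>u. gvol g (u # xs))"
proof -
  obtain N where N: "DIM('v) = Suc N" using DIM_positive by (metis Suc_pred')
  have "gvol g (u # xs) = (\<Sum>\<sigma> | \<sigma> permutes {..<Suc N}. of_int (sign \<sigma>) *
      (g u (onb g ! \<sigma> 0) * (\<Prod>i<N. g (xs ! i) (onb g ! \<sigma> (Suc i)))))" for u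
    unfolding gvol_def N prod.lessThan_Suc_shift by simp
  moreover have "linear (\<lambda>u. (\<Sum>\<sigma> | \<sigma> permutes {..<Suc N}. of_int (sign \<sigma>) *
      (g u (onb g ! \<sigma> 0) * (\<Prod>i<N. g (xs ! i) (onb g ! \<sigma> (Suc i))))))"
  proof (rule linear_compose_sum, rule ballI)
    fix \<sigma> :: "nat \<Rightarrow> nat"
    have l: "linear (\<lambda>u. g u (onb g ! \<sigma> 0))" by (rule inner_product_linear[OF g])
    show "linear (\<lambda>u. of_int (sign \<sigma>) *
      (g u (onb g ! \<sigma> 0) * (\<Prod>i<N. g (xs ! i) (onb g ! \<sigma> (Suc i)))))"
      by (rule linearI) (simp_all add: linear_add[OF l] linear_scale[OF l] algebra_simps)
  qed
  ultimately show ?thesis by simp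
qed

text \<open>The arguments of \<open>hodge\<close> enter only through \<open>gvol\<close>, each as
  the first vector of its list, so bilinearity is inherited from the volume form.\<close>

lemma lovelock_form_bilinear:
  fixes g :: "'v::euclidean_space \<Rightarrow> 'v \<Rightarrow> real"
  assumes g: "inner_product g"
  shows "bilinear (lovelock_form k g R)"
proof -
  have l: "linear (\<lambda>u. gvol g ([u] @ xs))" for xs using gvol_linear_Cons[OF g] by simp
  show ?thesis
    unfolding bilinear_def lovelock_form_def hodge_def
    by (auto intro!: linearI
        simp: linear_add[OF l] linear_scale[OF l] algebra_simps sum.distrib sum_distrib_left simp del: append_Cons append_Nil)
qed

text \<open>Double forms are evaluated below on lists of basis vectors, which a permutation brings
  into increasing order; what is recorded is the effect of such a permutation in each of the two
  arguments.\<close>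

definition alternating_dform :: "nat \<Rightarrow> 'v dform \<Rightarrow> bool" where
  "alternating_dform N \<Gamma> \<longleftrightarrow>
     (\<forall>\<rho> \<rho>' xs ys. \<rho> permutes {..<N} \<longrightarrow> \<rho>' permutes {..<N} \<longrightarrow> length xs = N \<longrightarrow> length ys = N \<longrightarrow>
        \<Gamma> (pick xs \<rho> 0 N) (pick ys \<rho>' 0 N) = of_int (sign \<rho>) * of_int (sign \<rho>') * \<Gamma> xs ys)"

section \<open>Alternating double forms and the Hodge star in degree \<open>n - 1\<close>\<close>

lemma pick_id: "length xs = N \<Longrightarrow> pick xs id 0 N = xs"
  by (rule nth_equalityI) auto

lemma alternating_dprod: "alternating_dform (p + r) (dprod p p r r \<omega> \<eta>)"
  unfolding alternating_dform_def
proof safe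
  fix \<rho> \<rho>' and xs ys :: "'a list"
  assume "\<rho> permutes {..<p + r}" "\<rho>' permutes {..<p + r}" "length xs = p + r" "length ys = p + r"
  then show "dprod p p r r \<omega> \<eta> (pick xs \<rho> 0 (p + r)) (pick ys \<rho>' 0 (p + r)) =
       of_int (sign \<rho>) * of_int (sign \<rho>') * dprod p p r r \<omega> \<eta> xs ys"
    using dprod_pick_compose[of \<rho> p r \<rho>' \<omega> \<eta> xs id ys id] by (simp add: pick_id)
qed

lemma alternating_gR:
  fixes g :: "'v::euclidean_space \<Rightarrow> 'v \<Rightarrow> real"
  assumes "2 * k < DIM('v)"
  shows "alternating_dform (DIM('v) - 1) (gR k g R)"
proof -
  have "DIM('v) - 1 = DIM('v) - 2 * k - 1 + 2 * k" using assms by simp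
  then have "alternating_dform (DIM('v) - 1) (dprod (DIM('v) - 2 * k - 1) (DIM('v) - 2 * k - 1) (2 * k) (2 * k)
      (dpow 1 1 (DIM('v) - 2 * k - 1) (dform_of g)) (dpow 2 2 k R))"
    using alternating_dprod by metis
  then show ?thesis unfolding alternating_dform_def gR_def Let_def by simp
qed

text \<open>Each index is the last value of \<open>fact N\<close> permutations, which form one coset
  of the permutations fixing \<open>N\<close>.\<close>

lemma sum_permutes_last:
  "(\<Sum>\<sigma> | \<sigma> permutes {..<Suc N}. F (\<sigma> N) :: real) = fact N * (\<Sum>i<Suc N. F i)"
proof -
  have "(\<Sum>\<sigma> | \<sigma> permutes {..<Suc N}. F (\<sigma> N))
      = (\<Sum>b\<in>insert N {..<N}. \<Sum>q | q permutes {..<N}. F ((Transposition.transpose N b \<circ> q) N))"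
    unfolding lessThan_Suc by (rule sum_over_permutations_insert) auto
  also have "\<dots> = (\<Sum>b\<in>insert N {..<N}. \<Sum>q | q permutes {..<N}. F b)"
    by (intro sum.cong refl) (auto simp: permutes_not_in)
  also have "\<dots> = fact N * (\<Sum>b<Suc N. F b)"
    by (simp add: card_permutations sum_distrib_left lessThan_Suc distrib_left)
  finally show ?thesis .
qed

text \<open>The star of an \<open>(n-1,n-1)\<close>-form acts like a matrix of cofactors: only the
  complements of the two indices contribute, and \<open>\<Gamma>\<close> is evaluated on them in the
  orders of \<open>\<sigma>\<close> and \<open>\<tau>\<close>. Indexing by full permutations rather
  than by the two indices absorbs all position signs and matches the terms of a product with a
  \<open>(1,1)\<close>-form.\<close>

lemma hodge_onb:
  fixes g :: "'v::euclidean_space \<Rightarrow> 'v \<Rightarrow> real"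
  assumes g: "inner_product g" and N: "DIM('v) = Suc N" and \<Gamma>: "alternating_dform N \<Gamma>"
    and \<sigma>: "\<sigma> permutes {..<Suc N}" and \<tau>: "\<tau> permutes {..<Suc N}"
  shows "hodge g N N \<Gamma> [onb g ! \<sigma> N] [onb g ! \<tau> N] =
      of_int (sign \<sigma>) * of_int (sign \<tau>) * \<Gamma> (pick (onb g) \<sigma> 0 N) (pick (onb g) \<tau> 0 N)"
proof -
  define e where "e = onb g"
  have len: "length e = Suc N" using length_onb[OF g] N by (simp add: e_def)
  have dist: "distinct e" using distinct_onb[OF g] by (simp add: e_def)
  define Q where "Q \<sigma> = nths e ({..<Suc N} - {\<sigma> N})" for \<sigma> :: "nat \<Rightarrow> nat"
  \<comment> \<open>An \<open>N\<close>-element set other than the complement of \<open>i\<close>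
    contains \<open>i\<close>; then a basis vector is repeated and the volume vanishes.\<close>
  have other: "gvol g ([e ! i] @ nths e I) = 0"
    if "i < Suc N" "I \<subseteq> {..<Suc N}" "card I = N" "I \<noteq> {..<Suc N} - {i}" for i I
  proof -
    have "i \<in> I"
    proof (rule ccontr)
      assume "i \<notin> I"
      then have "I \<subseteq> {..<Suc N} - {i}" using that by auto
      moreover have "card ({..<Suc N} - {i}) = N" using that by simp
      ultimately show False using that by (metis card_subset_eq finite_Diff finite_lessThan)
    qed
    then have "e ! i \<in> set (nths e I)" using len that by (auto simp: set_nths)
    moreover have "length (nths e I) = N"
    proof -
      have "{j. j < length e \<and> j \<in> I} = I" using that len by auto
      then show ?thesis using that by (simp add: length_nths)
    qed
    ultimately obtain b where "b < N" "nths e I ! b = e ! i" by (metis in_set_conv_nth)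
    then show ?thesis by (intro gvol_repeated[of 0 "Suc b"]) (auto simp: N)
  qed
  have sN: "\<sigma> N < Suc N" if "\<sigma> permutes {..<Suc N}" for \<sigma>
    using permutes_in_image[OF that, of N] by simp
  have sum1: "(\<Sum>I | I \<subseteq> {..<Suc N} \<and> card I = N. gvol g ([e ! i] @ nths e I) * h I)
     = gvol g ([e ! i] @ nths e ({..<Suc N} - {i})) * h ({..<Suc N} - {i})"
    if "i < Suc N" for i h
  proof -
    have "(\<Sum>I | I \<subseteq> {..<Suc N} \<and> card I = N. gvol g ([e ! i] @ nths e I) * h I)
       = (\<Sum>I\<in>{{..<Suc N} - {i}}. gvol g ([e ! i] @ nths e I) * h I)"
    proof (intro sum.mono_neutral_right ballI)
      show "gvol g ([e ! i] @ nths e I) * h I = 0"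
        if "I \<in> {I. I \<subseteq> {..<Suc N} \<and> card I = N} - {{..<Suc N} - {i}}" for I
        using other[of i I] that \<open>i < Suc N\<close> by simp
    qed (use that in \<open>auto simp: finite_subset\<close>)
    then show ?thesis by simp
  qed
  have "hodge g N N \<Gamma> [e ! \<sigma> N] [e ! \<tau> N] =
     (\<Sum>I | I \<subseteq> {..<Suc N} \<and> card I = N. gvol g ([e ! \<sigma> N] @ nths e I) *
       (\<Sum>J | J \<subseteq> {..<Suc N} \<and> card J = N. gvol g ([e ! \<tau> N] @ nths e J) * \<Gamma> (nths e I) (nths e J)))"
    unfolding hodge_def N e_def[symmetric] sum_distrib_left
    by (simp add: mult_ac flip: mult_2)
  also have "\<dots> = gvol g (e ! \<sigma> N # Q \<sigma>) * gvol g (e ! \<tau> N # Q \<tau>) * \<Gamma> (Q \<sigma>) (Q \<tau>)"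
    unfolding sum1[OF sN[OF \<tau>]] sum1[OF sN[OF \<sigma>]] Q_def by simp
  finally have 1: "hodge g N N \<Gamma> [e ! \<sigma> N] [e ! \<tau> N] =
      gvol g (e ! \<sigma> N # Q \<sigma>) * gvol g (e ! \<tau> N # Q \<tau>) * \<Gamma> (Q \<sigma>) (Q \<tau>)" .
  \<comment> \<open>\<open>c\<close> is the cycle that brings the last entry to the front. Its sign
    occurs once for \<open>\<sigma>\<close> and once for \<open>\<tau>\<close>, and so drops out of
    the result.\<close>
  have "mset (N # [0..<N]) = mset [0..<Suc N]" by simp
  then obtain c where c: "c permutes {..<length [0..<Suc N]}" "permute_list c [0..<Suc N] = N # [0..<N]"
    by (rule mset_eq_permutation)
  have cp: "c permutes {..<Suc N}" using c by simp
  have cn: "(N # [0..<N]) ! i = c i" if "i < Suc N" for i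
  proof -
    have "(N # [0..<N]) ! i = [0..<Suc N] ! c i"
      using c that permute_list_nth[OF c(1), of i] by simp
    also have "\<dots> = c i" using permutes_in_image[OF cp, of i] that by (simp del: upt_Suc)
    finally show ?thesis .
  qed
  \<comment> \<open>\<open>Q \<sigma>\<close> lists the same basis vectors as
    \<open>pick e \<sigma> 0 N\<close>, but in increasing order, and \<open>\<rho>\<close> is the
    permutation between them. Its sign enters the volume and, by alternation, also
    \<open>\<Gamma>\<close>, and so cancels.\<close>
  have "\<exists>\<rho>. \<rho> permutes {..<N} \<and> pick e \<sigma> 0 N = pick (Q \<sigma>) \<rho> 0 N \<and> length (Q \<sigma>) = N \<and>
     gvol g (e ! \<sigma> N # Q \<sigma>) = of_int (sign \<rho>) * of_int (sign \<sigma>) * of_int (sign c)"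
    if \<sigma>: "\<sigma> permutes {..<Suc N}" for \<sigma>
  proof -
    have inj: "inj \<sigma>" using \<sigma> permutes_inj by blast
    have img: "\<sigma> ` {..<N} = {..<Suc N} - {\<sigma> N}"
    proof -
      have "\<sigma> ` {..<Suc N} = {..<Suc N}" by (rule permutes_image[OF \<sigma>])
      moreover have "{..<N} = {..<Suc N} - {N}" by auto
      ultimately show ?thesis using inj by (metis image_insert image_empty image_set_diff)
    qed
    have "set (pick e \<sigma> 0 N) = (\<lambda>i. e ! i) ` (\<sigma> ` {..<N})"
      unfolding pick_def by (auto simp: atLeast0LessThan)
    also have "\<dots> = set (Q \<sigma>)" unfolding img Q_def set_nths using len by auto
    finally have set: "set (pick e \<sigma> 0 N) = set (Q \<sigma>)" .
    have "distinct (pick e \<sigma> 0 N)"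
    proof -
      have "\<sigma> i < Suc N" if "i < N" for i using permutes_in_image[OF \<sigma>, of i] that by simp
      then show ?thesis
        using dist len inj unfolding distinct_conv_nth by (auto simp: nth_eq_iff_index_eq[OF dist] dest: injD)
    qed
    moreover have "distinct (Q \<sigma>)" using dist by (simp add: Q_def)
    ultimately have "mset (pick e \<sigma> 0 N) = mset (Q \<sigma>)"
      using set by (simp add: set_eq_iff_mset_eq_distinct)
    then obtain \<rho> where \<rho>: "\<rho> permutes {..<length (Q \<sigma>)}" "permute_list \<rho> (Q \<sigma>) = pick e \<sigma> 0 N"
      by (rule mset_eq_permutation)
    have lQ: "length (Q \<sigma>) = N" using \<rho>(2) by (metis length_permute_list length_pick)
    have nthp: "pick e \<sigma> 0 N ! i = Q \<sigma> ! \<rho> i" if "i < N" for i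
      using permute_list_nth[OF \<rho>(1), of i] \<rho>(2) that lQ by simp
    have 2: "pick e \<sigma> 0 N = pick (Q \<sigma>) \<rho> 0 N"
      by (rule nth_equalityI) (use nthp in auto)
    have \<rho>N: "\<rho> permutes {..<N}" using \<rho> lQ by simp
    obtain \<rho>' where \<rho>': "\<rho>' permutes {..<Suc N}" "sign \<rho>' = sign \<rho>" "\<rho>' 0 = 0"
      "\<And>i. i < N \<Longrightarrow> \<rho>' (Suc i) = Suc (\<rho> i)"
      using permutes_Suc_conjugate[OF \<rho>N] by blast
    have "gvol g (e ! \<sigma> N # pick e \<sigma> 0 N) = of_int (sign \<rho>') * gvol g (e ! \<sigma> N # Q \<sigma>)"
    proof (rule gvol_permute, unfold N)
      fix i assume "i < Suc N"
      then show "(e ! \<sigma> N # pick e \<sigma> 0 N) ! i = (e ! \<sigma> N # Q \<sigma>) ! \<rho>' i"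
        using \<rho>' nthp by (cases i) auto
    qed fact
    moreover have "gvol g (e ! \<sigma> N # pick e \<sigma> 0 N) = of_int (sign (\<sigma> \<circ> c)) * gvol g e"
    proof (rule gvol_permute, unfold N)
      show "\<sigma> \<circ> c permutes {..<Suc N}" using cp \<sigma> by (rule permutes_compose)
      fix i assume "i < Suc N"
      then show "(e ! \<sigma> N # pick e \<sigma> 0 N) ! i = e ! (\<sigma> \<circ> c) i"
        using cn[of i] by (cases i) (simp_all del: upt_Suc)
    qed
    moreover have "sign (\<sigma> \<circ> c) = sign \<sigma> * sign c"
      using cp \<sigma> by (metis finite_lessThan permutes_imp_permutation sign_compose)
    ultimately have "of_int (sign \<rho>) * gvol g (e ! \<sigma> N # Q \<sigma>) = of_int (sign \<sigma>) * of_int (sign c)"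
      using \<rho>' gvol_onb[OF g] by (simp add: e_def)
    then have "gvol g (e ! \<sigma> N # Q \<sigma>) = of_int (sign \<rho>) * of_int (sign \<sigma>) * of_int (sign c)"
      by (auto simp: sign_def split: if_splits)
    then show ?thesis using \<rho>N 2 lQ by blast
  qed
  note this[OF \<sigma>] this[OF \<tau>]
  then obtain \<rho> \<rho>' where \<rho>: "\<rho> permutes {..<N}" "pick e \<sigma> 0 N = pick (Q \<sigma>) \<rho> 0 N" "length (Q \<sigma>) = N"
     "gvol g (e ! \<sigma> N # Q \<sigma>) = of_int (sign \<rho>) * of_int (sign \<sigma>) * of_int (sign c)"
     and \<rho>': "\<rho>' permutes {..<N}" "pick e \<tau> 0 N = pick (Q \<tau>) \<rho>' 0 N" "length (Q \<tau>) = N"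
     "gvol g (e ! \<tau> N # Q \<tau>) = of_int (sign \<rho>') * of_int (sign \<tau>) * of_int (sign c)"
    by blast
  have "\<Gamma> (pick e \<sigma> 0 N) (pick e \<tau> 0 N) = of_int (sign \<rho>) * of_int (sign \<rho>') * \<Gamma> (Q \<sigma>) (Q \<tau>)"
    unfolding \<rho>(2) \<rho>'(2) using \<Gamma> \<rho> \<rho>' unfolding alternating_dform_def by blast
  then show ?thesis
    unfolding e_def[symmetric] 1 \<rho>(4) \<rho>'(4) by (simp add: sign_def split: if_splits)
qed

lemma hodge_top:
  fixes g :: "'v::euclidean_space \<Rightarrow> 'v \<Rightarrow> real"
  assumes g: "inner_product g"
  shows "hodge g (DIM('v)) (DIM('v)) \<Omega> [] [] = \<Omega> (onb g) (onb g)"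
proof -
  have "{I. I \<subseteq> {..<DIM('v)} \<and> card I = DIM('v)} = {{..<DIM('v)}}"
    by (auto dest: card_subset_eq[OF finite_lessThan])
  moreover have "nths (onb g) {..<DIM('v)} = onb g" using length_onb[OF g] by (intro nths_all) simp
  ultimately show ?thesis unfolding hodge_def by (simp add: gvol_onb[OF g] flip: mult_2)
qed

lemma h_form_eq_sum:
  fixes g :: "'v::euclidean_space \<Rightarrow> 'v \<Rightarrow> real"
  assumes g: "inner_product g" and k: "2 * k < DIM('v)" and N: "DIM('v) = Suc N"
  shows "h_form k g R b =
      (\<Sum>\<sigma> | \<sigma> permutes {..<Suc N}. \<Sum>\<tau> | \<tau> permutes {..<Suc N}.
         of_int (sign \<sigma>) * of_int (sign \<tau>) * gR k g R (pick (onb g) \<sigma> 0 N) (pick (onb g) \<tau> 0 N)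
         * b (onb g ! \<sigma> N) (onb g ! \<tau> N)) / (fact N)\<^sup>2"
proof -
  have "h_form k g R b = dprod N N 1 1 (gR k g R) (dform_of b) (onb g) (onb g)"
    using k hodge_top[OF g] by (simp add: h_form_def N)
  then show ?thesis
    unfolding dprod_def by (simp add: dform_of_def power2_eq_square)
qed

text \<open>In the product, \<open>b\<close> receives the last entries of the two permuted bases,
  and what is left is the cofactor of \<open>hodge_onb\<close>. Each pair of last values occurs
  \<open>(fact N)\<^sup>2\<close> times, which cancels the denominator.\<close>

lemma h_form_eq_trace:
  fixes g :: "'v::euclidean_space \<Rightarrow> 'v \<Rightarrow> real"
  assumes g: "inner_product g" and k: "2 * k < DIM('v)"
  shows "h_form k g R b = (\<Sum>i<DIM('v). \<Sum>j<DIM('v).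
           lovelock_form k g R (onb g ! i) (onb g ! j) * b (onb g ! i) (onb g ! j))"
proof -
  obtain N where N: "DIM('v) = Suc N" using DIM_positive by (metis Suc_pred')
  define e where "e = onb g"
  define T where "T i j = lovelock_form k g R (e ! i) (e ! j) * b (e ! i) (e ! j)" for i j
  have N1: "DIM('v) - 1 = N" using N by simp
  have alt: "alternating_dform N (gR k g R)" using alternating_gR[OF k, of g R] N by simp
  note h_form_eq_sum[OF g k N, of R b, folded e_def]
  also have "(\<Sum>\<sigma> | \<sigma> permutes {..<Suc N}. \<Sum>\<tau> | \<tau> permutes {..<Suc N}.
       of_int (sign \<sigma>) * of_int (sign \<tau>) * gR k g R (pick e \<sigma> 0 N) (pick e \<tau> 0 N)
        * b (e ! \<sigma> N) (e ! \<tau> N)) = (\<Sum>\<sigma> | \<sigma> permutes {..<Suc N}. \<Sum>\<tau> | \<tau> permutes {..<Suc N}. T (\<sigma> N) (\<tau> N))"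
    unfolding T_def lovelock_form_def e_def N1 using k
    by (intro sum.cong refl) (simp add: hodge_onb[OF g N alt])
  also have "\<dots> = fact N * (fact N * (\<Sum>i<Suc N. \<Sum>j<Suc N. T i j))"
    using sum_permutes_last[of "T _" N] sum_permutes_last[of "\<lambda>i. fact N * (\<Sum>j<Suc N. T i j)" N]
    by (simp add: sum_distrib_left del: sum.lessThan_Suc)
  finally show ?thesis by (simp add: T_def N e_def power2_eq_square del: sum.lessThan_Suc)
qed

text \<open>The trace of \<open>T\<close> against \<open>-b\<close> is positive by
  \<open>trace_pos\<close>; for negative definite \<open>T\<close> the same is applied to its
  negative.\<close>

lemma h_form_nonzero:
  fixes g :: "'v::euclidean_space \<Rightarrow> 'v \<Rightarrow> real"
  assumes g: "inner_product g" and k: "2 * k < DIM('v)"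
    and T: "positive_definite (lovelock_form k g R) \<or> negative_definite (lovelock_form k g R)"
    and b: "inner_product (\<lambda>u v. - b u v)"
  shows "h_form k g R b \<noteq> 0"
proof -
  let ?T = "lovelock_form k g R"
  have bil: "bilinear ?T" by (rule lovelock_form_bilinear[OF g])
  show ?thesis
  proof (cases "positive_definite ?T")
    case True
    from trace_pos[OF g bil True b] show ?thesis
      unfolding h_form_eq_trace[OF g k] by (simp add: sum_negf)
  next
    case False
    then have "positive_definite (\<lambda>u v. - ?T u v)"
      using T by (auto simp: positive_definite_def negative_definite_def)
    moreover have "bilinear (\<lambda>u v. - ?T u v)"
      using bil by (auto simp: bilinear_def intro: linear_compose_neg)
    ultimately show ?thesis
      using trace_pos[OF g _ _ b, of "\<lambda>u v. - ?T u v"] unfolding h_form_eq_trace[OF g k] by simp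
  qed
qed

text \<open>Every pair of distinct values is taken at \<open>a\<close> and \<open>b\<close> by
  \<open>fact (card S)\<close> permutations; two successive transpositions run through the cosets of
  the permutations of \<open>S\<close>.\<close>

lemma sum_permutes_two:
  assumes "finite S" "a \<notin> S" "b \<notin> S" "a \<noteq> b"
  shows "(\<Sum>\<sigma> | \<sigma> permutes insert a (insert b S). F (\<sigma> a) (\<sigma> b) :: real)
       = fact (card S) * (\<Sum>p\<in>insert a (insert b S). \<Sum>q\<in>insert a (insert b S) - {p}. F p q)"
proof -
  let ?t = Transposition.transpose
  let ?S = "insert a (insert b S)"
  have "(\<Sum>\<sigma> | \<sigma> permutes ?S. F (\<sigma> a) (\<sigma> b))
     = (\<Sum>p\<in>?S. \<Sum>\<sigma> | \<sigma> permutes insert b S. F ((?t a p \<circ> \<sigma>) a) ((?t a p \<circ> \<sigma>) b))"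
    using assms by (intro sum_over_permutations_insert) auto
  also have "\<dots> = (\<Sum>p\<in>?S. \<Sum>\<sigma> | \<sigma> permutes insert b S. F p (?t a p (\<sigma> b)))"
  proof (intro sum.cong refl)
    fix p \<sigma> assume "\<sigma> \<in> {\<sigma>. \<sigma> permutes insert b S}"
    then have "\<sigma> a = a" using assms by (auto simp: permutes_def)
    then show "F ((?t a p \<circ> \<sigma>) a) ((?t a p \<circ> \<sigma>) b) = F p (?t a p (\<sigma> b))" by simp
  qed
  also have "\<dots> = (\<Sum>p\<in>?S. \<Sum>p'\<in>insert b S. fact (card S) * F p (?t a p p'))"
  proof (rule sum.cong[OF refl])
    fix p
    have "(\<Sum>\<sigma> | \<sigma> permutes insert b S. F p (?t a p (\<sigma> b))) =
        (\<Sum>p'\<in>insert b S. \<Sum>q | q permutes S. F p (?t a p ((?t b p' \<circ> q) b)))"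
      using assms by (intro sum_over_permutations_insert) auto
    also have "\<dots> = (\<Sum>p'\<in>insert b S. \<Sum>q | q permutes S. F p (?t a p p'))"
      using assms by (intro sum.cong refl) (auto simp: permutes_not_in)
    finally show "(\<Sum>\<sigma> | \<sigma> permutes insert b S. F p (?t a p (\<sigma> b))) =
        (\<Sum>p'\<in>insert b S. fact (card S) * F p (?t a p p'))"
      using assms by (simp add: card_permutations)
  qed
  also have "\<dots> = (\<Sum>p\<in>?S. fact (card S) * (\<Sum>q\<in>?S - {p}. F p q))"
  proof (rule sum.cong[OF refl])
    fix p assume p: "p \<in> ?S"
    have "bij_betw (?t a p) (insert b S) (?S - {p})"
      by (rule bij_betw_byWitness[where f' = "?t a p"])
         (use assms p in \<open>auto simp: Transposition.transpose_def\<close>)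
    then have "(\<Sum>p'\<in>insert b S. F p (?t a p p')) = (\<Sum>q\<in>?S - {p}. F p q)"
      by (rule sum.reindex_bij_betw)
    then show "(\<Sum>p'\<in>insert b S. fact (card S) * F p (?t a p p')) = fact (card S) * (\<Sum>q\<in>?S - {p}. F p q)"
      by (simp flip: sum_distrib_left)
  qed
  finally show ?thesis by (simp add: sum_distrib_left)
qed

text \<open>Even the first power is a product, with the constant form 1, and antisymmetrizes
  \<open>R\<close>. If \<open>R\<close> already alternates in both pairs, this gives four equal
  terms over \<open>fact 2 * fact 2\<close>.\<close>

lemma dpow_one:
  assumes a1: "\<And>u v w z. R [v, u] [w, z] = - R [u, v] [w, z]"
    and a2: "\<And>u v w z. R [u, v] [z, w] = - R [u, v] [w, z]"
  shows "dpow 2 2 1 R xs ys = R [xs ! 0, xs ! 1] [ys ! 0, ys ! 1]"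
proof -
  have 2: "{..<2} = insert 0 (insert (1::nat) {})" by auto
  have s: "(\<Sum>\<sigma> | \<sigma> permutes {..<2::nat}. F \<sigma>) = F id + F (Transposition.transpose 0 1)" for F :: "_ \<Rightarrow> real"
    unfolding 2 by (simp add: sum_over_permutations_insert permutes_empty)
  have p: "pick zs \<sigma> 0 2 = [zs ! \<sigma> 0, zs ! \<sigma> 1]" for zs :: "'a list" and \<sigma>
    by (simp add: pick_def upt_rec)
  have d: "dpow 2 2 1 R = dprod 2 2 0 0 R (\<lambda>xs ys. 1)" by simp
  show ?thesis
    unfolding d dprod_def
    by (simp add: s p sign_swap_id sign_id) (simp add: a1[of "xs ! 0" "xs ! Suc 0"] a2[of _ _ "ys ! Suc 0" "ys ! 0"])
qed

text \<open>\<open>h_form 1 g R g\<close> is computed in two ways. By \<open>h_form_eq_trace\<close>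
  it is the trace of \<open>T\<^sub>2\<close>. Expanded on the orthonormal basis it is a signed sum
  of values of \<open>g^(n-3) R g\<close>, in which the factors \<open>g\<close> force the two
  permutations to agree outside the two positions of \<open>R\<close>.\<close>

lemma lovelock_trace:
  fixes g :: "'v::euclidean_space \<Rightarrow> 'v \<Rightarrow> real"
  assumes g: "inner_product g" and n: "2 < DIM('v)"
    and a1: "\<And>u v w z. R [v, u] [w, z] = - R [u, v] [w, z]"
    and a2: "\<And>u v w z. R [u, v] [z, w] = - R [u, v] [w, z]"
  shows "(\<Sum>i<DIM('v). lovelock_form 1 g R (onb g ! i) (onb g ! i)) =
     (real (DIM('v)) - 2) / 2 *
      (\<Sum>i<DIM('v). \<Sum>j<DIM('v). R [onb g ! i, onb g ! j] [onb g ! i, onb g ! j])"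
proof -
  \<comment> \<open>With \<open>n = m + 3\<close> the product consists of \<open>m\<close> factors
    \<open>g\<close>, then \<open>R\<close> at the positions \<open>m\<close> and
    \<open>m + 1\<close>, then one more \<open>g\<close> at the last position
    \<open>N\<close>.\<close>
  obtain m where m: "DIM('v) = m + 3" using n by (metis add.commute less_eqE numeral_3_eq_3 Suc_leI eval_nat_numeral(3))
  define e where "e = onb g"
  define N where "N = m + 2"
  have N: "DIM('v) = Suc N" by (simp add: m N_def)
  define P where "P n = {\<sigma>. \<sigma> permutes {..<n::nat}}" for n
  define sg where "sg \<sigma> = (of_int (sign \<sigma>) :: real)" for \<sigma> :: "nat \<Rightarrow> nat"
  define D where "D = dpow 1 1 m (dform_of g)"
  define R1 where "R1 = dpow 2 2 1 R"
  define \<Psi> where "\<Psi> \<sigma> \<tau> = R1 (pick e \<sigma> m 2) (pick e \<tau> m 2) * g (e ! \<sigma> N) (e ! \<tau> N)" for \<sigma> \<tau>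
  define \<Phi> where "\<Phi> \<sigma> \<tau> = D (pick e \<sigma> 0 m) (pick e \<tau> 0 m) * \<Psi> \<sigma> \<tau>" for \<sigma> \<tau>
  \<comment> \<open>The first \<open>fact m\<close> is the divisor in \<open>gR\<close>; the square
    is the denominator of the product of the power of \<open>g\<close> with \<open>R\<close>, the
    number 2 being \<open>fact 2\<close>.\<close>
  define c where "c = fact m * (fact m * (2::real))\<^sup>2"
  have 1: "gR 1 g R (pick e \<sigma> 0 N) (pick e \<tau> 0 N) * g (e ! \<sigma> N) (e ! \<tau> N)
     = (\<Sum>\<rho>\<in>P N. \<Sum>\<rho>'\<in>P N. sg \<rho> * sg \<rho>' * \<Phi> (\<sigma> \<circ> \<rho>) (\<tau> \<circ> \<rho>')) / c" for \<sigma> \<tau>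
  proof -
    have "DIM('v) - 2 * 1 - 1 = m" by (simp add: m)
    then have "gR 1 g R (pick e \<sigma> 0 N) (pick e \<tau> 0 N) =
       (\<Sum>\<rho>\<in>P N. \<Sum>\<rho>'\<in>P N. sg \<rho> * sg \<rho>' * (D (pick e (\<sigma> \<circ> \<rho>) 0 m) (pick e (\<tau> \<circ> \<rho>') 0 m)
          * R1 (pick e (\<sigma> \<circ> \<rho>) m 2) (pick e (\<tau> \<circ> \<rho>') m 2))) / c"
      unfolding gR_def Let_def N_def P_def sg_def c_def D_def R1_def
      by (simp only: mult_1_right dprod_pick fact_2) (simp add: mult.commute)
    moreover have fN: "(e ! \<sigma> (\<rho> N)) = e ! \<sigma> N" if "\<rho> \<in> P N" for \<rho> \<sigma>
      using that by (simp add: P_def permutes_not_in)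
    ultimately have "gR 1 g R (pick e \<sigma> 0 N) (pick e \<tau> 0 N) * g (e ! \<sigma> N) (e ! \<tau> N) =
       (\<Sum>\<rho>\<in>P N. \<Sum>\<rho>'\<in>P N. sg \<rho> * sg \<rho>' * (D (pick e (\<sigma> \<circ> \<rho>) 0 m) (pick e (\<tau> \<circ> \<rho>') 0 m)
          * R1 (pick e (\<sigma> \<circ> \<rho>) m 2) (pick e (\<tau> \<circ> \<rho>') m 2) * g (e ! \<sigma> N) (e ! \<tau> N))) / c"
      by (simp add: sum_distrib_left mult_ac)
    then show ?thesis by (simp add: \<Phi>_def \<Psi>_def mult.assoc fN cong: sum.cong)
  qed
  have 2: "\<Phi> \<sigma> \<tau> = (\<Sum>\<rho>\<in>P m. \<Sum>\<rho>'\<in>P m. sg \<rho> * sg \<rho>' *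
      ((\<Prod>i<m. g (e ! (\<sigma> \<circ> \<rho>) i) (e ! (\<tau> \<circ> \<rho>') i)) * \<Psi> (\<sigma> \<circ> \<rho>) (\<tau> \<circ> \<rho>')))" for \<sigma> \<tau>
  proof -
    have "\<Psi> (\<sigma> \<circ> \<rho>) (\<tau> \<circ> \<rho>') = \<Psi> \<sigma> \<tau>" if "\<rho> \<in> P m" "\<rho>' \<in> P m" for \<rho> \<rho>'
    proof -
      have "\<rho> i = i" "\<rho>' i = i" if "m \<le> i" for i
        using that \<open>\<rho> \<in> P m\<close> \<open>\<rho>' \<in> P m\<close> by (simp_all add: P_def permutes_not_in)
      then show ?thesis unfolding \<Psi>_def N_def by (simp add: pick_def)
    qed
    moreover have "\<rho> i < m" if "\<rho> \<in> P m" "i < m" for \<rho> i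
      using that permutes_in_image[of \<rho> "{..<m}" i] by (auto simp: P_def)
    ultimately show ?thesis
      unfolding \<Phi>_def D_def dpow_dform_of sg_def sum_distrib_right P_def[symmetric]
      by (intro sum.cong refl) (auto simp: mult.assoc intro!: prod.cong)
  qed
  define \<Theta> where "\<Theta> \<sigma> \<tau> = (\<Prod>i<m. g (e ! \<sigma> i) (e ! \<tau> i)) * \<Psi> \<sigma> \<tau>" for \<sigma> \<tau>
  have "h_form 1 g R g = (\<Sum>\<sigma>\<in>P (Suc N). \<Sum>\<tau>\<in>P (Suc N). sg \<sigma> * sg \<tau> *
       (gR 1 g R (pick e \<sigma> 0 N) (pick e \<tau> 0 N) * g (e ! \<sigma> N) (e ! \<tau> N))) / (fact N)\<^sup>2"
    using h_form_eq_sum[OF g _ N, of 1 R g] n by (simp add: P_def sg_def e_def mult.assoc)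
  also have "\<dots> = (\<Sum>\<sigma>\<in>P (Suc N). \<Sum>\<tau>\<in>P (Suc N). sg \<sigma> * sg \<tau> *
       (\<Sum>\<rho>\<in>P N. \<Sum>\<rho>'\<in>P N. sg \<rho> * sg \<rho>' * \<Phi> (\<sigma> \<circ> \<rho>) (\<tau> \<circ> \<rho>'))) / (fact N)\<^sup>2 / c"
    unfolding 1 by (simp add: mult.commute flip: sum_divide_distrib)
  \<comment> \<open>The permutations of the first \<open>N\<close> positions inside
    \<open>gR\<close> are absorbed and cancel \<open>(fact N)\<^sup>2\<close>. Below, those of the
    first \<open>m\<close> positions inside the power of \<open>g\<close> are absorbed in the same
    way.\<close>
  also have "\<dots> = (\<Sum>\<sigma>\<in>P (Suc N). \<Sum>\<tau>\<in>P (Suc N). sg \<sigma> * sg \<tau> * \<Phi> \<sigma> \<tau>) / c"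
    unfolding P_def sg_def by (subst sum_sign_collapse2) auto
  also have "\<dots> = (\<Sum>\<sigma>\<in>P (Suc N). \<Sum>\<tau>\<in>P (Suc N). sg \<sigma> * sg \<tau> *
       (\<Sum>\<rho>\<in>P m. \<Sum>\<rho>'\<in>P m. sg \<rho> * sg \<rho>' * \<Theta> (\<sigma> \<circ> \<rho>) (\<tau> \<circ> \<rho>'))) / c"
    unfolding 2 \<Theta>_def ..
  also have "\<dots> = (fact m)\<^sup>2 * (\<Sum>\<sigma>\<in>P (Suc N). \<Sum>\<tau>\<in>P (Suc N). sg \<sigma> * sg \<tau> * \<Theta> \<sigma> \<tau>) / c"
    unfolding P_def sg_def by (subst sum_sign_collapse2) (auto simp: N_def)
  also have "\<dots> = (\<Sum>\<sigma>\<in>P (Suc N). \<Sum>\<tau>\<in>P (Suc N). sg \<sigma> * sg \<tau> * \<Theta> \<sigma> \<tau>) / (4 * fact m)"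
    by (simp add: c_def power2_eq_square)
  finally have 3: "h_form 1 g R g = (\<Sum>\<sigma>\<in>P (Suc N). \<Sum>\<tau>\<in>P (Suc N). sg \<sigma> * sg \<tau> * \<Theta> \<sigma> \<tau>) / (4 * fact m)" .
  define r where "r p q = R [e ! p, e ! q] [e ! p, e ! q]" for p q
  \<comment> \<open>Writing \<open>\<tau> = \<sigma> \<circ> \<pi>\<close>, orthonormality lets a
    term survive only if \<open>\<pi>\<close> fixes every position occupied by a factor
    \<open>g\<close>. The identity and the transposition of \<open>m\<close> and
    \<open>m + 1\<close> remain, and they contribute equally because \<open>R\<close> is skew in its
    second pair.\<close>
  have "(\<Sum>\<tau>\<in>P (Suc N). sg \<sigma> * sg \<tau> * \<Theta> \<sigma> \<tau>) = 2 * r (\<sigma> m) (\<sigma> (Suc m))"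
    if "\<sigma> \<in> P (Suc N)" for \<sigma>
  proof -
    let ?t = "Transposition.transpose m (Suc m)"
    have \<sigma>: "\<sigma> permutes {..<Suc N}" using that by (simp add: P_def)
    have inj: "inj \<sigma>" using \<sigma> permutes_inj by blast
    have lt: "\<sigma> i < Suc N" if "\<sigma> \<in> P (Suc N)" "i < Suc N" for \<sigma> i
      using that permutes_in_image[of \<sigma> "{..<Suc N}" i] by (auto simp: P_def)
    have sg: "sg (\<sigma> \<circ> \<pi>) = sg \<sigma> * sg \<pi>" if "\<pi> \<in> P (Suc N)" for \<pi>
      using that \<sigma> unfolding sg_def P_def
      by (metis finite_lessThan mem_Collect_eq of_int_mult permutes_imp_permutation sign_compose)
    have tP: "?t \<in> P (Suc N)" by (auto simp: P_def N_def intro!: permutes_swap_id)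
    have idP: "id \<in> P (Suc N)" by (simp add: P_def permutes_id)
    have ss: "sg \<sigma> * sg \<sigma> = 1" by (simp add: sg_def flip: of_int_mult)
    have "(\<Sum>\<tau>\<in>P (Suc N). sg \<sigma> * sg \<tau> * \<Theta> \<sigma> \<tau>) = (\<Sum>\<pi>\<in>P (Suc N). sg \<sigma> * sg (\<sigma> \<circ> \<pi>) * \<Theta> \<sigma> (\<sigma> \<circ> \<pi>))"
      unfolding P_def by (rule setum_permutations_compose_left[OF \<sigma>])
    also have "\<dots> = (\<Sum>\<pi>\<in>{id, ?t}. sg \<sigma> * sg (\<sigma> \<circ> \<pi>) * \<Theta> \<sigma> (\<sigma> \<circ> \<pi>))"
    proof (rule sum.mono_neutral_right)
      show "finite (P (Suc N))" by (simp add: P_def finite_permutations)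
      show "{id, ?t} \<subseteq> P (Suc N)" using tP idP by simp
      show "\<forall>\<pi>\<in>P (Suc N) - {id, ?t}. sg \<sigma> * sg (\<sigma> \<circ> \<pi>) * \<Theta> \<sigma> (\<sigma> \<circ> \<pi>) = 0"
      proof
        fix \<pi> assume \<pi>: "\<pi> \<in> P (Suc N) - {id, ?t}"
        have "\<exists>i<Suc N. i \<noteq> m \<and> i \<noteq> Suc m \<and> \<pi> i \<noteq> i"
        proof (rule ccontr)
          assume "\<not> ?thesis"
          then have fix_: "\<pi> i = i" if "i \<noteq> m" "i \<noteq> Suc m" for i
            using that \<pi> by (cases "i < Suc N") (auto simp: P_def permutes_not_in)
          have "inj \<pi>" using \<pi> by (auto simp: P_def permutes_inj)
          then have "\<pi> m \<in> {m, Suc m}" "\<pi> (Suc m) \<in> {m, Suc m}" "\<pi> m \<noteq> \<pi> (Suc m)"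
            using fix_ by (metis injD insert_iff n_not_Suc_n)+
          then consider "\<pi> m = m" "\<pi> (Suc m) = Suc m" | "\<pi> m = Suc m" "\<pi> (Suc m) = m" by auto
          then show False
          proof cases
            case 1
            then have "\<pi> i = id i" for i using fix_ by (cases "i = m \<or> i = Suc m") auto
            then show False using \<pi> by (auto simp: fun_eq_iff)
          next
            case 2
            then have "\<pi> i = ?t i" for i
              using fix_ by (cases "i = m \<or> i = Suc m") (auto simp: Transposition.transpose_def)
            then show False using \<pi> by (auto simp: fun_eq_iff)
          qed
        qed
        then obtain i where i: "i < Suc N" "i \<noteq> m" "i \<noteq> Suc m" "\<pi> i \<noteq> i" by blast
        have "\<sigma> (\<pi> i) \<noteq> \<sigma> i" using i inj by (auto dest: injD)
        then have z: "g (e ! \<sigma> i) (e ! (\<sigma> \<circ> \<pi>) i) = 0"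
          using i lt[OF that i(1)] lt[of \<pi> i] lt[OF that, of "\<pi> i"] \<pi> unfolding e_def
          by (simp add: onb_inner[OF g] N)
        have "i < m \<or> i = N" using i by (auto simp: N_def)
        then show "sg \<sigma> * sg (\<sigma> \<circ> \<pi>) * \<Theta> \<sigma> (\<sigma> \<circ> \<pi>) = 0"
          using z unfolding \<Theta>_def \<Psi>_def by (auto intro!: prod_zero)
      qed
    qed
    also have "\<dots> = sg \<sigma> * sg (\<sigma> \<circ> id) * \<Theta> \<sigma> (\<sigma> \<circ> id) + sg \<sigma> * sg (\<sigma> \<circ> ?t) * \<Theta> \<sigma> (\<sigma> \<circ> ?t)"
      by (subst sum.insert) (auto simp: fun_eq_iff Transposition.transpose_def)
    also have "\<dots> = \<Theta> \<sigma> \<sigma> - \<Theta> \<sigma> (\<sigma> \<circ> ?t)"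
      unfolding sg[OF tP] using ss by (simp add: sg_def sign_swap_id flip: mult.assoc)
    also have "\<dots> = 2 * r (\<sigma> m) (\<sigma> (Suc m))"
    proof -
      have one: "g (e ! \<sigma> i) (e ! \<sigma> i) = 1" if "i < Suc N" for i
        using lt[OF \<open>\<sigma> \<in> P (Suc N)\<close> that] unfolding e_def by (simp add: onb_inner[OF g] N)
      have p: "pick e \<sigma> m 2 = [e ! \<sigma> m, e ! \<sigma> (Suc m)]" for \<sigma> by (simp add: pick_def upt_rec)
      have t: "?t i = i" if "i < m \<or> i = N" for i using that by (auto simp: N_def Transposition.transpose_def)
      have "\<Theta> \<sigma> \<sigma> = r (\<sigma> m) (\<sigma> (Suc m))"
        unfolding \<Theta>_def \<Psi>_def R1_def dpow_one[of R, OF a1 a2] p using one by (simp add: r_def N_def)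
      moreover have "\<Theta> \<sigma> (\<sigma> \<circ> ?t) = - r (\<sigma> m) (\<sigma> (Suc m))"
        unfolding \<Theta>_def \<Psi>_def R1_def dpow_one[of R, OF a1 a2] p using one t
        by (simp add: r_def N_def a2[of _ _ "e ! \<sigma> (Suc m)" "e ! \<sigma> m"])
      ultimately show ?thesis by simp
    qed
    finally show ?thesis .
  qed
  then have "h_form 1 g R g = (\<Sum>\<sigma>\<in>P (Suc N). 2 * r (\<sigma> m) (\<sigma> (Suc m))) / (4 * fact m)"
    unfolding 3 by simp
  also have "\<dots> = (\<Sum>\<sigma>\<in>P (Suc N). r (\<sigma> m) (\<sigma> (Suc m))) / (2 * fact m)"
    by (simp flip: sum_distrib_left)
  \<comment> \<open>The \<open>Suc m\<close> positions other than \<open>m\<close> and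
    \<open>m + 1\<close> are free. The quotient \<open>fact (Suc m) / (2 * fact m)\<close> becomes
    the factor \<open>(n - 2) / 2\<close>.\<close>
  also have "(\<Sum>\<sigma>\<in>P (Suc N). r (\<sigma> m) (\<sigma> (Suc m))) =
     fact (Suc m) * (\<Sum>p<Suc N. \<Sum>q\<in>{..<Suc N} - {p}. r p q)"
  proof -
    define S where "S = {..<Suc N} - {m, Suc m}"
    have S: "{..<Suc N} = insert m (insert (Suc m) S)" by (auto simp: S_def N_def)
    have cS: "card S = Suc m" by (auto simp: S_def N_def card_Diff_subset)
    show ?thesis
      unfolding P_def S using sum_permutes_two[of S m "Suc m" r] cS by (simp add: S_def)
  qed
  also have "(\<Sum>p<Suc N. \<Sum>q\<in>{..<Suc N} - {p}. r p q) = (\<Sum>p<Suc N. \<Sum>q<Suc N. r p q)"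
  proof (rule sum.cong[OF refl])
    fix p
    have "r p p = 0" using a1[of "e ! p" "e ! p"] by (simp add: r_def)
    then show "(\<Sum>q\<in>{..<Suc N} - {p}. r p q) = (\<Sum>q<Suc N. r p q)"
      by (intro sum.mono_neutral_left) auto
  qed
  also have "fact (Suc m) * (\<Sum>p<Suc N. \<Sum>q<Suc N. r p q) / (2 * fact m)
      = (real m + 1) / 2 * (\<Sum>p<Suc N. \<Sum>q<Suc N. r p q)"
    by (simp del: sum.lessThan_Suc)
  finally have A: "h_form 1 g R g = (real m + 1) / 2 * (\<Sum>p<Suc N. \<Sum>q<Suc N. r p q)" .
  have "h_form 1 g R g = (\<Sum>i<DIM('v). \<Sum>j<DIM('v). if j = i then lovelock_form 1 g R (e ! i) (e ! j) else 0)"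
  proof -
    have n2: "2 * 1 < DIM('v)" using n by simp
    show ?thesis
      unfolding h_form_eq_trace[OF g n2] e_def
      by (intro sum.cong refl) (simp add: onb_inner[OF g])
  qed
  also have "\<dots> = (\<Sum>i<DIM('v). lovelock_form 1 g R (e ! i) (e ! i))"
    by (intro sum.cong refl) (simp add: sum.delta)
  finally have T: "h_form 1 g R g = (\<Sum>i<DIM('v). lovelock_form 1 g R (e ! i) (e ! i))" .
  have "(real (DIM('v)) - 2) / 2 = (real m + 1) / 2" by (simp add: m)
  then show ?thesis using A T unfolding r_def e_def N by (simp only:)
qed

section \<open>Smooth maps\<close>

lemma has_derivative_dd: "f differentiable (at x) \<Longrightarrow> (f has_derivative dd f x) (at x)"
  unfolding dd_def by (simp add: frechet_derivative_works eta_contract_eq)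

lemma dd_eqI: "(f has_derivative f') (at x) \<Longrightarrow> dd f x = f'"
  unfolding dd_def fun_eq_iff by (simp add: frechet_derivative_at[symmetric])

lemma linear_dd: "f differentiable (at x) \<Longrightarrow> linear (dd f x)"
  by (rule has_derivative_linear[OF has_derivative_dd])

text \<open>Identities between coordinate expressions hold only on the domain of a chart; this lemma
  allows them to be differentiated, although \<open>dd\<close> takes functions on the whole
  space.\<close>

lemma dd_cong:
  assumes "open S" "x \<in> S" "\<And>y. y \<in> S \<Longrightarrow> f y = g y"
  shows "dd f x = dd g x" "f differentiable (at x) \<longleftrightarrow> g differentiable (at x)"
proof -
  have *: "(f has_derivative D) (at x) \<longleftrightarrow> (g has_derivative D) (at x)" for D
    using has_derivative_transform_within_open[of f D x UNIV S g]
      has_derivative_transform_within_open[of g D x UNIV S f] assms by auto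
  then show "f differentiable (at x) \<longleftrightarrow> g differentiable (at x)" by (simp add: differentiable_def)
  show "dd f x = dd g x" unfolding dd_def frechet_derivative_def * ..
qed

lemma Ck_on_cong:
  assumes "open S" "\<And>y. y \<in> S \<Longrightarrow> f y = g y" "Ck_on k S f"
  shows "Ck_on k S g"
  using assms(2,3)
proof (induction k arbitrary: f g)
  case 0
  then show ?case by (simp cong: continuous_on_cong)
next
  case (Suc k)
  have "dd f y = dd g y" "f differentiable (at y) \<longleftrightarrow> g differentiable (at y)" if "y \<in> S" for y
    using dd_cong[OF assms(1) that, of f g] Suc.prems(1) by auto
  note * = this
  have "Ck_on k S (\<lambda>x. dd g x v)" for v
    by (rule Suc.IH[of "\<lambda>x. dd f x v"]) (use * Suc.prems in \<open>simp_all add: dd_def\<close>)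
  then show ?case using * Suc.prems by (simp add: dd_def)
qed

lemma Ck_on_subset: "Ck_on k S f \<Longrightarrow> T \<subseteq> S \<Longrightarrow> Ck_on k T f"
  by (induction k arbitrary: f) (auto intro: continuous_on_subset)

lemma smooth_on_dd: "smooth_on S f \<Longrightarrow> smooth_on S (\<lambda>x. dd f x v)"
  unfolding smooth_on_def dd_def
  by (rule allI) (metis Ck_on.simps(2))

lemma smooth_on_differentiable: "smooth_on S f \<Longrightarrow> x \<in> S \<Longrightarrow> f differentiable (at x)"
  unfolding smooth_on_def by (drule spec[of _ "Suc 0"]) simp

lemma smooth_on_continuous: "smooth_on S f \<Longrightarrow> continuous_on S f"
  unfolding smooth_on_def by (drule spec[of _ 0]) simp

lemma smooth_on_subset: "smooth_on S f \<Longrightarrow> T \<subseteq> S \<Longrightarrow> smooth_on T f"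
  unfolding smooth_on_def using Ck_on_subset by blast

lemma smooth_on_cong: "open S \<Longrightarrow> (\<And>y. y \<in> S \<Longrightarrow> f y = g y) \<Longrightarrow> smooth_on S f \<Longrightarrow> smooth_on S g"
  unfolding smooth_on_def using Ck_on_cong by blast

section \<open>Sums and linear images of smooth maps, symmetry of second derivatives\<close>

lemma Ck_on_add:
  assumes "open S" "Ck_on k S f" "Ck_on k S g"
  shows "Ck_on k S (\<lambda>x. f x + g x)"
  using assms(2,3)
proof (induction k arbitrary: f g)
  case 0
  then show ?case by (simp add: continuous_on_add)
next
  case (Suc k)
  have d: "f differentiable (at x)" "g differentiable (at x)" if "x \<in> S" for x using Suc that by auto
  have "Ck_on k S (\<lambda>x. dd (\<lambda>x. f x + g x) x v)" for v
  proof (rule Ck_on_cong[OF assms(1)])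
    show "dd f x v + dd g x v = dd (\<lambda>x. f x + g x) x v" if "x \<in> S" for x
      using dd_eqI[OF has_derivative_add[OF has_derivative_dd has_derivative_dd], OF d[OF that]] by simp
    show "Ck_on k S (\<lambda>x. dd f x v + dd g x v)" using Suc by (simp add: dd_def)
  qed
  then show ?case using d by (simp add: dd_def)
qed

lemma Ck_on_bounded_linear:
  assumes "open S" "bounded_linear L" "Ck_on k S f"
  shows "Ck_on k S (\<lambda>x. L (f x))"
  using assms(3)
proof (induction k arbitrary: f)
  case 0
  then show ?case using assms(2) by (simp add: linear_continuous_on_compose bounded_linear.continuous_on)
next
  case (Suc k)
  have d: "f differentiable (at x)" if "x \<in> S" for x using Suc that by auto
  have D: "((\<lambda>x. L (f x)) has_derivative (\<lambda>v. L (dd f x v))) (at x)" if "x \<in> S" for x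
    using bounded_linear.has_derivative[OF assms(2) has_derivative_dd[OF d[OF that]]] .
  have "Ck_on k S (\<lambda>x. dd (\<lambda>x. L (f x)) x v)" for v
  proof (rule Ck_on_cong[OF assms(1)])
    show "L (dd f x v) = dd (\<lambda>x. L (f x)) x v" if "x \<in> S" for x
      using dd_eqI[OF D[OF that]] by simp
    show "Ck_on k S (\<lambda>x. L (dd f x v))" using Suc by (simp add: dd_def)
  qed
  then show ?case using D by (auto simp: dd_def differentiable_def)
qed

lemma smooth_on_bounded_linear:
  "open S \<Longrightarrow> bounded_linear L \<Longrightarrow> smooth_on S f \<Longrightarrow> smooth_on S (\<lambda>x. L (f x))"
  unfolding smooth_on_def using Ck_on_bounded_linear by blast

lemma dd_bounded_linear:
  "bounded_linear L \<Longrightarrow> f differentiable (at x) \<Longrightarrow> dd (\<lambda>x. L (f x)) x v = L (dd f x v)"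
  by (simp add: dd_eqI[OF bounded_linear.has_derivative[OF _ has_derivative_dd]])

text \<open>The mean value theorem is applied twice to the second difference over a parallelogram:
  in the direction \<open>u\<close> to the difference of \<open>f\<close> along two opposite sides,
  then in the direction \<open>v\<close> to the derivative so obtained.\<close>

lemma mixed_difference:
  fixes f :: "'a::euclidean_space \<Rightarrow> real"
  assumes S: "open S" "smooth_on S f" and h: "0 < h"
    and inS: "\<And>s t. 0 \<le> s \<Longrightarrow> s \<le> h \<Longrightarrow> 0 \<le> t \<Longrightarrow> t \<le> h \<Longrightarrow> x + s *\<^sub>R u + t *\<^sub>R v \<in> S"
  shows "\<exists>s t. 0 < s \<and> s < h \<and> 0 < t \<and> t < h \<and>
     f (x + h *\<^sub>R u + h *\<^sub>R v) - f (x + h *\<^sub>R u) - f (x + h *\<^sub>R v) + f x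
      = h * h * dd (\<lambda>y. dd f y u) (x + s *\<^sub>R u + t *\<^sub>R v) v"
proof -
  have line: "((\<lambda>s. q (z + s *\<^sub>R w)) has_real_derivative dd q (z + s *\<^sub>R w) w) (at s)"
    if "smooth_on S q" "z + s *\<^sub>R w \<in> S" for q :: "'a \<Rightarrow> real" and z w s
  proof -
    have d: "q differentiable (at (z + s *\<^sub>R w))" using smooth_on_differentiable that by blast
    have "((\<lambda>s. z + s *\<^sub>R w) has_derivative (\<lambda>s. s *\<^sub>R w)) (at s)"
      by (auto intro!: derivative_eq_intros)
    from diff_chain_at[OF this has_derivative_dd[OF d]]
    have "((\<lambda>s. q (z + s *\<^sub>R w)) has_derivative (\<lambda>t. dd q (z + s *\<^sub>R w) (t *\<^sub>R w))) (at s)"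
      by (simp add: o_def)
    moreover have "(\<lambda>t. dd q (z + s *\<^sub>R w) (t *\<^sub>R w)) = (*) (dd q (z + s *\<^sub>R w) w)"
      by (rule ext) (simp add: linear_scale[OF linear_dd[OF d]] mult.commute)
    ultimately show ?thesis by (simp add: has_field_derivative_def)
  qed
  define p where "p s = f (x + h *\<^sub>R v + s *\<^sub>R u) - f (x + s *\<^sub>R u)" for s
  have "(p has_real_derivative dd f (x + h *\<^sub>R v + s *\<^sub>R u) u - dd f (x + s *\<^sub>R u) u) (at s)"
    if "0 \<le> s" "s \<le> h" for s
    unfolding p_def using inS[of s h] inS[of s 0] that h S
    by (intro DERIV_diff line) (auto simp: algebra_simps)
  from MVT2[OF h this] obtain s where s: "0 < s" "s < h"
    "p h - p 0 = h * (dd f (x + h *\<^sub>R v + s *\<^sub>R u) u - dd f (x + s *\<^sub>R u) u)" by auto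
  define q where "q t = dd f (x + s *\<^sub>R u + t *\<^sub>R v) u" for t
  have "(q has_real_derivative dd (\<lambda>y. dd f y u) (x + s *\<^sub>R u + t *\<^sub>R v) v) (at t)"
    if "0 \<le> t" "t \<le> h" for t
    unfolding q_def using inS[of s t] that s S
    by (intro line smooth_on_dd) (auto simp: algebra_simps)
  from MVT2[OF h this] obtain t where t: "0 < t" "t < h"
    "q h - q 0 = h * dd (\<lambda>y. dd f y u) (x + s *\<^sub>R u + t *\<^sub>R v) v" by auto
  have "p h - p 0 = h * (q h - q 0)" using s(3) by (simp add: q_def algebra_simps)
  then show ?thesis using s t by (intro exI[of _ s] exI[of _ t]) (simp add: p_def algebra_simps)
qed

text \<open>The second difference is symmetric in \<open>u\<close> and \<open>v\<close>. By
  \<open>mixed_difference\<close> both mixed derivatives, at suitable points near \<open>x\<close>,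
  equal this difference divided by \<open>h * h\<close>, and continuity then excludes different
  values at \<open>x\<close>.\<close>

lemma second_derivative_symmetric_real:
  fixes f :: "'a::euclidean_space \<Rightarrow> real"
  assumes S: "open S" "smooth_on S f" and x: "x \<in> S"
  shows "dd (\<lambda>y. dd f y v) x u = dd (\<lambda>y. dd f y u) x v"
proof (rule ccontr)
  define A where "A y = dd (\<lambda>y. dd f y v) y u" for y
  define B where "B y = dd (\<lambda>y. dd f y u) y v" for y
  assume "\<not> ?thesis"
  then have "0 < dist (A x) (B x) / 2" by (simp add: A_def B_def)
  define \<epsilon> where "\<epsilon> = dist (A x) (B x) / 2"
  have "continuous_on S A" "continuous_on S B"
    unfolding A_def B_def by (intro smooth_on_continuous smooth_on_dd S)+
  then have "isCont A x" "isCont B x" using S x by (simp_all add: continuous_on_eq_continuous_at)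
  moreover have \<epsilon>: "0 < \<epsilon>" using \<open>0 < dist (A x) (B x) / 2\<close> by (simp add: \<epsilon>_def)
  ultimately obtain d1 d2 where d12: "0 < d1" "\<forall>y. dist y x < d1 \<longrightarrow> dist (A y) (A x) < \<epsilon>"
    "0 < d2" "\<forall>y. dist y x < d2 \<longrightarrow> dist (B y) (B x) < \<epsilon>"
    unfolding continuous_at_eps_delta by (elim allE[of _ \<epsilon>]) blast
  have d: "0 < d1" "\<And>y. dist y x < d1 \<Longrightarrow> dist (A y) (A x) < \<epsilon>"
    "0 < d2" "\<And>y. dist y x < d2 \<Longrightarrow> dist (B y) (B x) < \<epsilon>"
    using d12 by simp_all
  obtain d3 where d3: "0 < d3" "ball x d3 \<subseteq> S" using S x open_contains_ball by blast
  define \<delta> where "\<delta> = min d1 (min d2 d3)"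
  have \<delta>: "0 < \<delta>" using d d3 by (simp add: \<delta>_def)
  \<comment> \<open>This size keeps the whole parallelogram within \<open>\<delta>\<close> of
    \<open>x\<close>; the added 1 keeps the denominator positive when \<open>u\<close> and
    \<open>v\<close> vanish.\<close>
  define h where "h = \<delta> / (2 * (norm u + norm v + 1))"
  have den: "0 < 2 * (norm u + norm v + 1)" by (simp add: add_nonneg_pos)
  have h: "0 < h" using \<delta> den by (simp add: h_def)
  have near: "dist (x + s *\<^sub>R u + t *\<^sub>R v) x < \<delta>" if "0 \<le> s" "s \<le> h" "0 \<le> t" "t \<le> h" for s t
  proof -
    have "dist (x + s *\<^sub>R u + t *\<^sub>R v) x = norm (s *\<^sub>R u + t *\<^sub>R v)" by (simp add: dist_norm algebra_simps)
    also have "\<dots> \<le> s * norm u + t * norm v" using norm_triangle_ineq[of "s *\<^sub>R u" "t *\<^sub>R v"] that by simp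
    also have "\<dots> \<le> h * norm u + h * norm v" using that by (intro add_mono mult_right_mono) auto
    also have "\<dots> < h * (2 * (norm u + norm v + 1))"
    proof -
      have "h * (2 * (norm u + norm v + 1)) - (h * norm u + h * norm v) = h * (norm u + norm v + 2)"
        by (simp add: algebra_simps)
      moreover have "0 < h * (norm u + norm v + 2)"
        using h by (simp add: add_nonneg_pos)
      ultimately show ?thesis by linarith
    qed
    also have "\<dots> = \<delta>" using den by (simp add: h_def)
    finally show ?thesis .
  qed
  then have inS: "x + s *\<^sub>R u + t *\<^sub>R v \<in> S" if "0 \<le> s" "s \<le> h" "0 \<le> t" "t \<le> h" for s t
  proof -
    have "x + s *\<^sub>R u + t *\<^sub>R v \<in> ball x d3"
      using near[OF that] by (simp add: \<delta>_def dist_commute)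
    then show ?thesis using d3 by blast
  qed
  have "\<exists>s t. 0 < s \<and> s < h \<and> 0 < t \<and> t < h \<and>
     f (x + h *\<^sub>R u + h *\<^sub>R v) - f (x + h *\<^sub>R u) - f (x + h *\<^sub>R v) + f x
      = h * h * B (x + s *\<^sub>R u + t *\<^sub>R v)"
    unfolding B_def by (rule mixed_difference[OF S h inS])
  then obtain s t where 1: "0 < s" "s < h" "0 < t" "t < h"
     "f (x + h *\<^sub>R u + h *\<^sub>R v) - f (x + h *\<^sub>R u) - f (x + h *\<^sub>R v) + f x = h * h * B (x + s *\<^sub>R u + t *\<^sub>R v)"
    by (elim exE conjE)
  have "\<exists>s t. 0 < s \<and> s < h \<and> 0 < t \<and> t < h \<and>
     f (x + h *\<^sub>R v + h *\<^sub>R u) - f (x + h *\<^sub>R v) - f (x + h *\<^sub>R u) + f x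
      = h * h * A (x + s *\<^sub>R v + t *\<^sub>R u)"
    unfolding A_def
  proof (rule mixed_difference[OF S h])
    fix s t assume "0 \<le> s" "s \<le> h" "0 \<le> t" "t \<le> h"
    then show "x + s *\<^sub>R v + t *\<^sub>R u \<in> S" using inS[of t s] by (simp add: algebra_simps)
  qed
  then obtain t' s' where 2: "0 < t'" "t' < h" "0 < s'" "s' < h"
     "f (x + h *\<^sub>R v + h *\<^sub>R u) - f (x + h *\<^sub>R v) - f (x + h *\<^sub>R u) + f x = h * h * A (x + t' *\<^sub>R v + s' *\<^sub>R u)"
    by (elim exE conjE)
  have "h * h * A (x + s' *\<^sub>R u + t' *\<^sub>R v) = h * h * B (x + s *\<^sub>R u + t *\<^sub>R v)"
  proof -
    have e: "x + h *\<^sub>R v + h *\<^sub>R u = x + h *\<^sub>R u + h *\<^sub>R v" "x + t' *\<^sub>R v + s' *\<^sub>R u = x + s' *\<^sub>R u + t' *\<^sub>R v"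
      by (simp_all add: add_ac)
    show ?thesis using 1(5) 2(5) unfolding e by linarith
  qed
  then have "A (x + s' *\<^sub>R u + t' *\<^sub>R v) = B (x + s *\<^sub>R u + t *\<^sub>R v)" using h by simp
  moreover have "dist (A (x + s' *\<^sub>R u + t' *\<^sub>R v)) (A x) < \<epsilon>"
    using near[of s' t'] 2 by (intro d) (simp add: \<delta>_def)
  moreover have "dist (B (x + s *\<^sub>R u + t *\<^sub>R v)) (B x) < \<epsilon>"
    using near[of s t] 1 by (intro d) (simp add: \<delta>_def)
  ultimately show False
    using dist_triangle2[of "A x" "B x" "A (x + s' *\<^sub>R u + t' *\<^sub>R v)"]
    by (simp add: \<epsilon>_def dist_commute)
qed

lemma second_derivative_symmetric:
  fixes f :: "'a::euclidean_space \<Rightarrow> 'b::euclidean_space"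
  assumes S: "open S" "smooth_on S f" and x: "x \<in> S"
  shows "dd (\<lambda>y. dd f y v) x u = dd (\<lambda>y. dd f y u) x v"
proof (rule euclidean_eqI)
  fix b :: 'b assume "b \<in> Basis"
  have bl: "bounded_linear (\<lambda>z. z \<bullet> b)" by (rule bounded_linear_inner_left)
  have *: "dd (\<lambda>y. dd (\<lambda>z. f z \<bullet> b) y v) x u = dd (\<lambda>y. dd f y v) x u \<bullet> b" for u v
  proof -
    have "dd (\<lambda>y. dd (\<lambda>z. f z \<bullet> b) y v) x = dd (\<lambda>y. dd f y v \<bullet> b) x"
      by (rule dd_cong[OF S(1) x], rule dd_bounded_linear[OF bl smooth_on_differentiable[OF S(2)]])
    then show ?thesis
      using dd_bounded_linear[OF bl smooth_on_differentiable[OF smooth_on_dd[OF S(2)] x]] by simp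
  qed
  show "dd (\<lambda>y. dd f y v) x u \<bullet> b = dd (\<lambda>y. dd f y u) x v \<bullet> b"
    unfolding *[symmetric]
    by (rule second_derivative_symmetric_real[OF S(1) _ x], rule smooth_on_bounded_linear[OF S(1) bl S(2)])
qed

lemma differentiable_det:
  fixes A :: "'a::real_normed_vector \<Rightarrow> real^'n^'n"
  assumes "\<And>i j. (\<lambda>y. A y $ i $ j) differentiable (at x)"
  shows "(\<lambda>y. det (A y)) differentiable (at x)"
proof -
  have p: "(\<lambda>y. \<Prod>i\<in>I. A y $ i $ p i) differentiable (at x)" if "finite I" for I p
    using that by (induction I rule: finite_induct) (auto intro!: differentiable_mult assms)
  show ?thesis unfolding det_def
    by (intro differentiable_sum finite_permutations ballI differentiable_mult p) auto
qed

section \<open>Immersed charts\<close>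

text \<open>The Moore-Penrose inverse of an injective \<open>L\<close>, described by the normal
  equations. This is the shape in which the Koszul formula defines \<open>christoffel\<close>, so
  the two descriptions can be identified directly.\<close>

definition pinv :: "('a::euclidean_space \<Rightarrow> 'b::euclidean_space) \<Rightarrow> 'b \<Rightarrow> 'a" where
  "pinv L w = (THE z. \<forall>y. L z \<bullet> L y = w \<bullet> L y)"

context
  fixes L :: "'a::euclidean_space \<Rightarrow> 'b::euclidean_space"
  assumes L: "linear L" "inj L"
begin

lemma pullback_inner_product: "inner_product (\<lambda>u v. L u \<bullet> L v)"
proof -
  have "L u \<noteq> 0" if "u \<noteq> 0" for u using that L by (metis linear_injective_0)
  then show ?thesis
    unfolding inner_product_def bilinear_def using L
    by (auto intro!: linearI simp: linear_add linear_scale inner_add_left inner_add_right inner_commute)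
qed

lemma gram_unique:
  assumes "\<And>y. L z \<bullet> L y = L z' \<bullet> L y"
  shows "z = z'"
proof -
  have "L (z - z') \<bullet> L (z - z') = 0"
    using assms[of "z - z'"] L(1) by (simp add: linear_diff inner_diff_left)
  then show ?thesis using L by (metis eq_iff_diff_eq_0 inner_eq_zero_iff linear_diff injD)
qed

text \<open>The normal equations are solvable because \<open>adjoint L \<circ> L\<close> is
  injective by \<open>gram_unique\<close>, hence surjective.\<close>

lemma pinv: "L (pinv L w) \<bullet> L y = w \<bullet> L y"
proof -
  let ?M = "adjoint L \<circ> L"
  have lin: "linear ?M" using L(1) by (simp add: linear_compose adjoint_linear)
  have M: "L z \<bullet> L y = y \<bullet> ?M z" for z y
    by (simp add: adjoint_works[OF L(1)] inner_commute)
  have "inj ?M"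
    by (rule injI, rule gram_unique) (simp add: M)
  then have "surj ?M" using lin by (intro linear_inj_imp_surj)
  then obtain z where "?M z = adjoint L w" by (metis surjD)
  then have z: "\<forall>y. L z \<bullet> L y = w \<bullet> L y"
    unfolding M by (simp add: adjoint_works[OF L(1)] inner_commute)
  have "\<forall>y. L (pinv L w) \<bullet> L y = w \<bullet> L y"
    unfolding pinv_def
  proof (rule theI[of _ z])
    show "\<forall>y. L z \<bullet> L y = w \<bullet> L y" by (rule z)
    show "z' = z" if "\<forall>y. L z' \<bullet> L y = w \<bullet> L y" for z'
      by (rule gram_unique) (use that z in simp)
  qed
  then show ?thesis by blast
qed

lemma pinv_unique: "(\<And>y. L z \<bullet> L y = w \<bullet> L y) \<Longrightarrow> pinv L w = z"
  by (rule gram_unique) (simp add: pinv)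

lemma linear_pinv: "linear (pinv L)"
  by (rule linearI; rule pinv_unique)
     (use L(1) in \<open>simp_all add: linear_add linear_scale inner_add_left pinv\<close>)

text \<open>\<open>L \<circ> pinv L\<close> is the orthogonal projection onto the range of \<open>L\<close>, whatever the parametrization
  \<open>L\<close> of that subspace.\<close>

lemma proj_unique:
  assumes "p \<in> range L" "\<And>q. q \<in> range L \<Longrightarrow> (w - p) \<bullet> q = 0"
  shows "L (pinv L w) = p"
proof -
  obtain z where z: "p = L z" using assms(1) by auto
  have "pinv L w = z"
    using assms(2) z by (intro pinv_unique) (simp add: inner_diff_left)
  then show ?thesis by (simp add: z)
qed

end

lemma proj_cong_range:
  assumes "linear L" "inj L" "linear L'" "inj L'" "range L = range L'"
  shows "L (pinv L w) = L' (pinv L' w)"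
proof (rule proj_unique[OF assms(1,2)])
  show "L' (pinv L' w) \<in> range L" using assms(5) by auto
  show "(w - L' (pinv L' w)) \<bullet> q = 0" if "q \<in> range L" for q
    using that assms(5) pinv[OF assms(3,4)] by (auto simp: inner_diff_left)
qed

text \<open>The common local setting of an immersion read in a chart,
  \<open>f \<circ> snd c\<close>, and of a parametrization of a submanifold; the curvature
  computations serve both.\<close>

locale immersed_chart =
  fixes V :: "(real ^ 'n) set" and F :: "real ^ 'n \<Rightarrow> 'e::euclidean_space"
  assumes openV: "open V" and smoothF: "smooth_on V F"
    and injF: "\<And>x. x \<in> V \<Longrightarrow> inj (dd F x)"
begin

definition H :: "real ^ 'n \<Rightarrow> real ^ 'n \<Rightarrow> real ^ 'n \<Rightarrow> 'e" where
  "H x u v = dd (\<lambda>y. dd F y v) x u"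

text \<open>\<open>Q x w\<close> consists of the coordinates of the tangential part of
  \<open>w\<close>. Accordingly \<open>B\<close> below is the normal part of the second derivative
  \<open>H\<close>.\<close>

definition Q :: "real ^ 'n \<Rightarrow> 'e \<Rightarrow> real ^ 'n" where
  "Q x = pinv (dd F x)"

definition B :: "real ^ 'n \<Rightarrow> real ^ 'n \<Rightarrow> real ^ 'n \<Rightarrow> 'e" where
  "B x u v = H x u v - dd F x (Q x (H x u v))"

definition metric :: "real ^ 'n \<Rightarrow> real ^ 'n \<Rightarrow> real ^ 'n \<Rightarrow> real" where
  "metric x u v = dd F x u \<bullet> dd F x v"

lemma diffF: "x \<in> V \<Longrightarrow> F differentiable (at x)"
  using smoothF smooth_on_differentiable by blast

lemma linL: "x \<in> V \<Longrightarrow> linear (dd F x)"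
  using diffF linear_dd by blast

lemma smooth_L: "smooth_on V (\<lambda>y. dd F y v)"
  using smoothF smooth_on_dd by blast

lemma smooth_H: "smooth_on V (\<lambda>y. H y u v)"
  unfolding H_def by (intro smooth_on_dd smoothF)

lemma diffL: "x \<in> V \<Longrightarrow> (\<lambda>y. dd F y v) differentiable (at x)"
  using smooth_L smooth_on_differentiable by blast

lemma diffH: "x \<in> V \<Longrightarrow> (\<lambda>y. H y u v) differentiable (at x)"
  using smooth_H smooth_on_differentiable by blast

lemma H_sym: "x \<in> V \<Longrightarrow> H x u v = H x v u"
  unfolding H_def by (rule second_derivative_symmetric[OF openV smoothF])

lemma H_linear_left: "x \<in> V \<Longrightarrow> linear (\<lambda>u. H x u v)"
  unfolding H_def by (rule linear_dd[OF diffL])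

lemma H_linear_right: "x \<in> V \<Longrightarrow> linear (H x u)"
proof -
  assume x: "x \<in> V"
  then have "H x u = (\<lambda>v. H x v u)" using H_sym by blast
  then show ?thesis using H_linear_left[OF x] by simp
qed

lemma linear_Q: "x \<in> V \<Longrightarrow> linear (Q x)"
  unfolding Q_def by (rule linear_pinv[OF linL injF])

lemma Q_inner: "x \<in> V \<Longrightarrow> dd F x (Q x w) \<bullet> dd F x y = w \<bullet> dd F x y"
  unfolding Q_def by (rule pinv[OF linL injF])

lemma Q_unique: "x \<in> V \<Longrightarrow> (\<And>y. dd F x z \<bullet> dd F x y = w \<bullet> dd F x y) \<Longrightarrow> Q x w = z"
  unfolding Q_def by (rule pinv_unique[OF linL injF])

lemma Q_image: "x \<in> V \<Longrightarrow> Q x (dd F x z) = z"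
  by (rule Q_unique) auto

lemma metric_inner_product: "x \<in> V \<Longrightarrow> inner_product (metric x)"
  unfolding metric_def by (rule pullback_inner_product[OF linL injF])

lemma B_normal: "x \<in> V \<Longrightarrow> B x u v \<bullet> dd F x w = 0"
  by (simp add: B_def inner_diff_left Q_inner)

lemma B_linear_left: "x \<in> V \<Longrightarrow> linear (\<lambda>u. B x u v)"
  unfolding B_def
  by (rule linearI) (simp_all add: linear_add[OF H_linear_left] linear_scale[OF H_linear_left]
      linear_add[OF linear_Q] linear_scale[OF linear_Q] linear_add[OF linL] linear_scale[OF linL] algebra_simps)

lemma B_sym: "x \<in> V \<Longrightarrow> B x u v = B x v u"
  by (simp add: B_def H_sym[of x u v])

lemma B_linear_right: "x \<in> V \<Longrightarrow> linear (B x u)"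
proof -
  assume x: "x \<in> V"
  then have "B x u = (\<lambda>v. B x v u)" using B_sym by blast
  then show ?thesis using B_linear_left[OF x] by simp
qed

lemma dd_inner:
  assumes "f differentiable (at x)" "g differentiable (at x)"
  shows "dd (\<lambda>y. f y \<bullet> g y) x u = f x \<bullet> dd g x u + dd f x u \<bullet> g x"
  by (rule fun_cong[OF dd_eqI, OF has_derivative_inner[OF has_derivative_dd[OF assms(1)] has_derivative_dd[OF assms(2)]]])

lemma vec_expand: "z = (\<Sum>i\<in>UNIV. z $ i *\<^sub>R axis i (1::real))"
  by (simp add: vec_eq_iff axis_def if_distrib cong: if_cong)

lemma L_expand: "x \<in> V \<Longrightarrow> dd F x z = (\<Sum>i\<in>UNIV. z $ i *\<^sub>R dd F x (axis i 1))"
  by (subst vec_expand) (simp add: linear_sum[OF linL] linear_scale[OF linL])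

lemma differentiable_vec_nth:
  "(f :: real ^ 'n \<Rightarrow> real ^ 'k) differentiable (at x) \<Longrightarrow> (\<lambda>y. f y $ i) differentiable (at x)"
  by (rule differentiable_compose[of "\<lambda>z. z $ i"]) (auto intro: bounded_linear_imp_differentiable bounded_linear_vec_nth)

lemma differentiable_vecI:
  assumes "\<And>i. (\<lambda>y. (f :: real ^ 'n \<Rightarrow> real ^ 'k) y $ i) differentiable (at x)"
  shows "f differentiable (at x)"
proof -
  have "(\<lambda>y. \<Sum>i\<in>UNIV. f y $ i *\<^sub>R axis i (1::real)) differentiable (at x)"
    by (intro differentiable_sum ballI differentiable_scaleR assms) auto
  moreover have "f = (\<lambda>y. \<Sum>i\<in>UNIV. f y $ i *\<^sub>R axis i (1::real))"
    by (simp add: fun_eq_iff vec_eq_iff axis_def if_distrib cong: if_cong)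
  ultimately show ?thesis by (rule ssubst[rotated])
qed

text \<open>Differentiability of \<open>dd F\<close> is known with a fixed direction only. For a
  moving argument the product rule is therefore applied to the expansion of \<open>z y\<close> in
  the standard basis.\<close>

lemma diff_L_apply:
  assumes x: "x \<in> V" and z: "z differentiable (at x)"
  shows "(\<lambda>y. dd F y (z y)) differentiable (at x)"
    "dd (\<lambda>y. dd F y (z y)) x u = H x u (z x) + dd F x (dd z x u)"
proof -
  have D: "((\<lambda>y. \<Sum>i\<in>UNIV. z y $ i *\<^sub>R dd F y (axis i 1)) has_derivative
      (\<lambda>u. \<Sum>i\<in>UNIV. z x $ i *\<^sub>R dd (\<lambda>y. dd F y (axis i 1)) x u + dd z x u $ i *\<^sub>R dd F x (axis i 1))) (at x)"
    by (intro has_derivative_sum has_derivative_scaleR has_derivative_dd[OF diffL[OF x]]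
        bounded_linear.has_derivative[OF bounded_linear_vec_nth has_derivative_dd[OF z]])
  have eq: "(\<Sum>i\<in>UNIV. z y $ i *\<^sub>R dd F y (axis i 1)) = dd F y (z y)" if "y \<in> V" for y
    by (rule L_expand[OF that, symmetric])
  show "(\<lambda>y. dd F y (z y)) differentiable (at x)"
    by (rule iffD1[OF dd_cong(2)[OF openV x eq]], assumption, rule differentiableI[OF D])
  have "dd (\<lambda>y. dd F y (z y)) x u =
     (\<Sum>i\<in>UNIV. z x $ i *\<^sub>R H x u (axis i 1) + dd z x u $ i *\<^sub>R dd F x (axis i 1))"
    using dd_cong(1)[OF openV x eq] dd_eqI[OF D] by (simp add: H_def)
  also have "\<dots> = H x u (\<Sum>i\<in>UNIV. z x $ i *\<^sub>R axis i 1) + dd F x (dd z x u)"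
    unfolding L_expand[OF x, of "dd z x u"]
    by (simp add: sum.distrib linear_sum[OF H_linear_right[OF x]] linear_scale[OF H_linear_right[OF x]])
  finally show "dd (\<lambda>y. dd F y (z y)) x u = H x u (z x) + dd F x (dd z x u)"
    by (simp only: vec_expand[symmetric])
qed

lemma diff_H_apply:
  assumes x: "x \<in> V" and z: "z differentiable (at x)" "w differentiable (at x)"
  shows "(\<lambda>y. H y (z y) (w y)) differentiable (at x)"
proof -
  have eq: "(\<Sum>i\<in>UNIV. \<Sum>j\<in>UNIV. (z y $ i * w y $ j) *\<^sub>R H y (axis i 1) (axis j 1)) = H y (z y) (w y)" if "y \<in> V" for y
  proof -
    have "H y (z y) (w y) = H y (\<Sum>i\<in>UNIV. z y $ i *\<^sub>R axis i 1) (\<Sum>j\<in>UNIV. w y $ j *\<^sub>R axis j 1)"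
      by (simp only: vec_expand[symmetric])
    then show ?thesis
      by (simp add: linear_sum[OF H_linear_right[OF that]] linear_scale[OF H_linear_right[OF that]]
       linear_sum[OF H_linear_left[OF that]] linear_scale[OF H_linear_left[OF that]] scaleR_sum_right mult.commute)
         (rule sum.swap)
  qed
  show ?thesis
    by (rule iffD1[OF dd_cong(2)[OF openV x eq]], assumption)
       (intro differentiable_sum ballI differentiable_scaleR differentiable_mult differentiable_vec_nth z diffH[OF x]; simp)
qed

text \<open>Cramer's rule exhibits \<open>pinv\<close> as a quotient of determinants.\<close>

lemma diff_Q:
  assumes x: "x \<in> V" and w: "w differentiable (at x)"
  shows "(\<lambda>y. Q y (w y)) differentiable (at x)"
proof -
  \<comment> \<open>In coordinates the equations characterizing \<open>Q y (w y)\<close> form a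
    linear system with the Gram matrix \<open>G y\<close> and the right-hand side
    \<open>r y\<close>; \<open>C k y\<close> has \<open>r y\<close> in column
    \<open>k\<close>.\<close>
  define G :: "real ^ 'n \<Rightarrow> real ^ 'n ^ 'n" where "G y = (\<chi> i j. dd F y (axis j 1) \<bullet> dd F y (axis i 1))" for y
  define r :: "real ^ 'n \<Rightarrow> real ^ 'n" where "r y = (\<chi> i. w y \<bullet> dd F y (axis i 1))" for y
  define C :: "'n \<Rightarrow> real ^ 'n \<Rightarrow> real ^ 'n ^ 'n" where "C k y = (\<chi> i j. if j = k then r y $ i else G y $ i $ j)" for k y
  have Gz: "G y *v z = (\<chi> i. dd F y z \<bullet> dd F y (axis i 1))" if "y \<in> V" for y z
    by (subst L_expand[OF that, of z]) (simp add: G_def vec_eq_iff matrix_vector_mult_def inner_sum_left mult.commute)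
  have det: "det (G y) \<noteq> 0" if y: "y \<in> V" for y
  proof -
    have "inj ((*v) (G y))"
    proof (rule injI)
      fix z z' assume "G y *v z = G y *v z'"
      then have *: "dd F y z \<bullet> dd F y (axis i 1) = dd F y z' \<bullet> dd F y (axis i 1)" for i
        unfolding Gz[OF y] by (simp add: vec_eq_iff)
      have "dd F y z \<bullet> dd F y v = dd F y z' \<bullet> dd F y v" for v
        unfolding L_expand[OF y, of v] inner_sum_right by (simp add: *)
      then show "z = z'" by (rule gram_unique[OF linL[OF y] injF[OF y]])
    qed
    then show ?thesis
      by (metis invertible_det_nz invertible_left_inverse matrix_left_invertible_injective)
  qed
  have Qk: "Q y (w y) $ k = det (C k y) / det (G y)" if y: "y \<in> V" for y k
  proof -
    have "G y *v Q y (w y) = r y"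
      unfolding Gz[OF y] Q_inner[OF y] r_def ..
    then have "Q y (w y) = (\<chi> k. det (\<chi> i j. if j = k then r y $ i else G y $ i $ j) / det (G y))"
      using cramer[OF det[OF y]] by blast
    then show ?thesis by (simp add: C_def)
  qed
  have dG: "(\<lambda>y. G y $ i $ j) differentiable (at x)" for i j
    unfolding G_def by (simp add: differentiable_inner diffL[OF x])
  have dr: "(\<lambda>y. r y $ i) differentiable (at x)" for i
    unfolding r_def by (simp add: differentiable_inner diffL[OF x] w)
  have dC: "(\<lambda>y. C k y $ i $ j) differentiable (at x)" for k i j
    unfolding C_def by (cases "j = k") (simp_all add: dr dG)
  show ?thesis
  proof (rule differentiable_vecI)
    fix k
    have "(\<lambda>y. det (C k y) / det (G y)) differentiable (at x)"
      by (intro differentiable_divide differentiable_det dC dG det[OF x])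
    then show "(\<lambda>y. Q y (w y) $ k) differentiable (at x)"
      using dd_cong(2)[OF openV x, of "\<lambda>y. Q y (w y) $ k" "\<lambda>y. det (C k y) / det (G y)"] Qk by blast
  qed
qed

end

section \<open>The Gauss equation\<close>

context immersed_chart
begin

lemma dd_metric:
  "x \<in> V \<Longrightarrow> dd (\<lambda>y. metric y v w) x u = H x u v \<bullet> dd F x w + dd F x v \<bullet> H x u w"
  unfolding metric_def H_def by (subst dd_inner) (auto intro: diffL)

text \<open>In the Koszul formula the symmetry of \<open>H\<close> cancels four of the six terms and
  doubles the remaining one. The Levi-Civita derivative is thus the tangential part of the
  derivative in the ambient space.\<close>

lemma christoffel_metric:
  assumes x: "x \<in> V"
  shows "christoffel metric x u v = Q x (H x u v)"
proof -
  have "(dd (\<lambda>y. metric y v w) x u + dd (\<lambda>y. metric y u w) x v - dd (\<lambda>y. metric y u v) x w) / 2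
      = H x u v \<bullet> dd F x w" for w
    unfolding dd_metric[OF x]
    by (simp add: H_sym[OF x, of v u] H_sym[OF x, of w u] H_sym[OF x, of w v] inner_commute)
  then show ?thesis unfolding christoffel_def Q_def pinv_def by (simp add: metric_def)
qed

text \<open>This is the equation \<open>dd F y (Q y (H y v z)) \<bullet> dd F y w = H y v z
  \<bullet> dd F y w\<close> differentiated along \<open>u\<close>. The terms with
  \<open>H x u w\<close> combine to \<open>B x v z \<bullet> B x u w\<close>, because
  \<open>B\<close> is normal.\<close>

lemma dd_christoffel:
  assumes x: "x \<in> V"
  shows "dd F x (dd (\<lambda>y. Q y (H y v z)) x u) \<bullet> dd F x w + H x u (Q x (H x v z)) \<bullet> dd F x w =
     dd (\<lambda>y. H y v z) x u \<bullet> dd F x w + B x v z \<bullet> B x u w"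
proof -
  define \<Gamma> where "\<Gamma> y = Q y (H y v z)" for y
  have d\<Gamma>: "\<Gamma> differentiable (at x)" unfolding \<Gamma>_def[abs_def] by (intro diff_Q diffH x)
  have "dd F y (\<Gamma> y) \<bullet> dd F y w = H y v z \<bullet> dd F y w" if "y \<in> V" for y
    unfolding \<Gamma>_def by (rule Q_inner[OF that])
  then have "dd (\<lambda>y. dd F y (\<Gamma> y) \<bullet> dd F y w) x = dd (\<lambda>y. H y v z \<bullet> dd F y w) x"
    by (intro dd_cong(1)[OF openV x])
  then have "dd (\<lambda>y. dd F y (\<Gamma> y) \<bullet> dd F y w) x u = dd (\<lambda>y. H y v z \<bullet> dd F y w) x u"
    by (rule fun_cong)
  then have "dd F x (\<Gamma> x) \<bullet> H x u w + (H x u (\<Gamma> x) + dd F x (dd \<Gamma> x u)) \<bullet> dd F x w =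
     H x v z \<bullet> H x u w + dd (\<lambda>y. H y v z) x u \<bullet> dd F x w"
    by (simp add: dd_inner diff_L_apply x d\<Gamma> diffL diffH H_def[symmetric])
  moreover have "(H x v z - dd F x (\<Gamma> x)) \<bullet> H x u w = B x v z \<bullet> B x u w"
  proof -
    have "B x v z \<bullet> B x u w = B x v z \<bullet> H x u w - B x v z \<bullet> dd F x (Q x (H x u w))"
      unfolding B_def[of x u w] by (simp add: inner_diff_right)
    then show ?thesis by (simp add: B_normal[OF x]) (simp add: B_def \<Gamma>_def)
  qed
  ultimately show ?thesis unfolding \<Gamma>_def[symmetric] by (simp add: inner_diff_left inner_add_left)
qed

text \<open>Each half \<open>K\<close> of the curvature consists of a third derivative of
  \<open>F\<close> and a product of values of \<open>B\<close>. The third derivatives agree by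
  symmetry and cancel in \<open>K u v - K v u\<close>.\<close>

lemma gauss_equation:
  assumes x: "x \<in> V"
  shows "riemann metric x [u, v] [w, z] = B x v z \<bullet> B x u w - B x u z \<bullet> B x v w"
proof -
  define K where "K u v = dd (\<lambda>y. christoffel metric y v z) x u + christoffel metric x u (christoffel metric x v z)" for u v
  have K: "dd F x (K u v) \<bullet> dd F x w = dd (\<lambda>y. H y v z) x u \<bullet> dd F x w + B x v z \<bullet> B x u w" for u v
  proof -
    have "dd (\<lambda>y. christoffel metric y v z) x = dd (\<lambda>y. Q y (H y v z)) x"
      by (rule dd_cong[OF openV x]) (rule christoffel_metric)
    then have "dd F x (K u v) \<bullet> dd F x w =
      dd F x (dd (\<lambda>y. Q y (H y v z)) x u) \<bullet> dd F x w + H x u (Q x (H x v z)) \<bullet> dd F x w"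
      unfolding K_def christoffel_metric[OF x]
      by (simp add: linear_add[OF linL[OF x]] inner_add_left Q_inner[OF x])
    then show ?thesis using dd_christoffel[OF x] by simp
  qed
  have "dd (\<lambda>y. H y v z) x u = dd (\<lambda>y. H y u z) x v"
    unfolding H_def by (rule second_derivative_symmetric[OF openV smooth_L x])
  moreover have "curvature metric x u v z = K u v - K v u"
    unfolding curvature_def K_def by simp
  ultimately show ?thesis
    by (simp add: riemann_def metric_def linear_diff[OF linL[OF x]] inner_diff_left K)
qed

text \<open>The scalar curvature according to the Gauss equation. The images under \<open>Q x\<close> of an orthonormal
  basis of the ambient space replace an orthonormal basis of the tangent space: \<open>onb\<close> does not depend
  continuously on the metric.\<close>

definition sc :: "real ^ 'n \<Rightarrow> real" where
  "sc x = (\<Sum>a\<in>Basis. \<Sum>b\<in>Basis. B x (Q x b) (Q x b) \<bullet> B x (Q x a) (Q x a)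
            - B x (Q x a) (Q x b) \<bullet> B x (Q x b) (Q x a))"

text \<open>The images of the orthonormal basis under \<open>dd F x\<close> are orthonormal in the
  ambient space, and \<open>Q x a\<close> has the coefficients
  \<open>a \<bullet> dd F x (e i)\<close>. Parseval's identity over the ambient basis then turns one
  trace into the other.\<close>

lemma trace_Q:
  assumes x: "x \<in> V" and h: "bilinear (h :: _ \<Rightarrow> _ \<Rightarrow> real)"
  shows "(\<Sum>i<CARD('n). h (onb (metric x) ! i) (onb (metric x) ! i)) = (\<Sum>a\<in>Basis. h (Q x a) (Q x a))"
proof -
  define e where "e i = onb (metric x) ! i" for i
  have ip: "inner_product (metric x)" by (rule metric_inner_product[OF x])
  have on: "dd F x (e i) \<bullet> dd F x (e j) = (if i = j then 1 else 0)" if "i < CARD('n)" "j < CARD('n)" for i j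
    using onb_inner[OF ip, of i j] that by (simp add: e_def metric_def)
  have "Q x a = (\<Sum>i<CARD('n). (a \<bullet> dd F x (e i)) *\<^sub>R e i)" for a
    proof -
    have "metric x (Q x a) y = a \<bullet> dd F x y" for y unfolding metric_def by (rule Q_inner[OF x])
    then show ?thesis using onb_expansion[OF ip, of "Q x a"] by (simp add: e_def)
  qed
  moreover have l: "linear (h u)" "linear (\<lambda>u. h u v)" for u v using h by (auto simp: bilinear_def)
  ultimately have "h (Q x a) (Q x a) = (\<Sum>i<CARD('n). \<Sum>j<CARD('n). (a \<bullet> dd F x (e j)) * (a \<bullet> dd F x (e i)) * h (e j) (e i))" for a
    by (simp add: linear_sum[OF l(1)] linear_sum[OF l(2)] linear_scale[OF l(1)] linear_scale[OF l(2)] sum_distrib_left mult_ac)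
  then have "(\<Sum>a\<in>Basis. h (Q x a) (Q x a)) =
     (\<Sum>a\<in>Basis. \<Sum>i<CARD('n). \<Sum>j<CARD('n). (a \<bullet> dd F x (e j)) * (a \<bullet> dd F x (e i)) * h (e j) (e i))"
    by simp
  also have "\<dots> = (\<Sum>i<CARD('n). \<Sum>j<CARD('n). \<Sum>a\<in>Basis. (a \<bullet> dd F x (e j)) * (a \<bullet> dd F x (e i)) * h (e j) (e i))"
    by (subst sum.swap, rule sum.cong[OF refl], rule sum.swap)
  also have "\<dots> = (\<Sum>i<CARD('n). \<Sum>j<CARD('n). (dd F x (e j) \<bullet> dd F x (e i)) * h (e j) (e i))"
    by (intro sum.cong refl)
       (simp add: euclidean_inner[of "dd F x (e _)" "dd F x (e _)"] sum_distrib_left inner_commute mult_ac)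
  also have "\<dots> = (\<Sum>i<CARD('n). \<Sum>j<CARD('n). if j = i then h (e j) (e i) else 0)"
    by (intro sum.cong refl) (simp add: on)
  also have "\<dots> = (\<Sum>i<CARD('n). h (e i) (e i))" by (intro sum.cong refl) simp
  finally show ?thesis by (simp add: e_def)
qed

lemma bilinear_B_terms:
  assumes x: "x \<in> V"
  shows "bilinear (\<lambda>p q. B x p q \<bullet> c - B x d q \<bullet> B x p d')"
    "bilinear (\<lambda>p q. c \<bullet> B x p q - B x p d \<bullet> B x d' q)"
  unfolding bilinear_def
  by (auto intro!: linearI simp: linear_add[OF B_linear_left[OF x]] linear_scale[OF B_linear_left[OF x]]
      linear_add[OF B_linear_right[OF x]] linear_scale[OF B_linear_right[OF x]] algebra_simps inner_simps)

lemma scal_metric: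
  assumes x: "x \<in> V"
  shows "scal metric x = sc x"
proof -
  define e where "e i = onb (metric x) ! i" for i
  have "scal metric x = (\<Sum>i<CARD('n). \<Sum>j<CARD('n).
      B x (e j) (e j) \<bullet> B x (e i) (e i) - B x (e i) (e j) \<bullet> B x (e j) (e i))"
    unfolding scal_def Let_def gauss_equation[OF x] e_def by simp
  also have "\<dots> = (\<Sum>i<CARD('n). \<Sum>b\<in>Basis.
      B x (Q x b) (Q x b) \<bullet> B x (e i) (e i) - B x (e i) (Q x b) \<bullet> B x (Q x b) (e i))"
    unfolding e_def by (intro sum.cong refl trace_Q[OF x] bilinear_B_terms[OF x])
  also have "\<dots> = (\<Sum>b\<in>Basis. \<Sum>i<CARD('n).
      B x (Q x b) (Q x b) \<bullet> B x (e i) (e i) - B x (e i) (Q x b) \<bullet> B x (Q x b) (e i))"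
    by (rule sum.swap)
  also have "\<dots> = (\<Sum>b\<in>Basis. \<Sum>a\<in>Basis.
      B x (Q x b) (Q x b) \<bullet> B x (Q x a) (Q x a) - B x (Q x a) (Q x b) \<bullet> B x (Q x b) (Q x a))"
    unfolding e_def by (intro sum.cong refl trace_Q[OF x] bilinear_B_terms[OF x])
  also have "\<dots> = sc x" unfolding sc_def by (rule sum.swap)
  finally show ?thesis .
qed

lemma continuous_sc: "continuous_on V sc"
proof -
  have "sc differentiable (at x)" if x: "x \<in> V" for x
  proof -
    have BQ: "(\<lambda>y. B y (Q y a) (Q y b)) differentiable (at x)" for a b
      unfolding B_def
      by (intro differentiable_diff diff_L_apply(1) diff_H_apply diff_Q x differentiable_const)
    show ?thesis unfolding sc_def[abs_def]
      by (intro differentiable_sum differentiable_diff differentiable_inner BQ ballI finite_Basis)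
  qed
  then show ?thesis
    by (intro continuous_at_imp_continuous_on ballI differentiable_imp_continuous_within)
qed

lemma lovelock_one_trace:
  assumes x: "x \<in> V" and n: "2 < CARD('n)"
  shows "(\<Sum>i<CARD('n). lovelock 1 metric x (onb (metric x) ! i) (onb (metric x) ! i))
     = (real CARD('n) - 2) / 2 * sc x"
  unfolding lovelock_def scal_metric[OF x, symmetric] scal_def Let_def
  using lovelock_trace[OF metric_inner_product[OF x], of "riemann metric x"] n
  by (simp add: gauss_equation[OF x] inner_commute)

lemma sc_sign:
  assumes x: "x \<in> V" and n: "2 < CARD('n)"
  shows "positive_definite (lovelock 1 metric x) \<Longrightarrow> 0 < sc x"
    and "negative_definite (lovelock 1 metric x) \<Longrightarrow> sc x < 0"
proof -
  let ?e = "onb (metric x)"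
  have ip: "inner_product (metric x)" by (rule metric_inner_product[OF x])
  have ne: "?e ! i \<noteq> 0" if "i < CARD('n)" for i
    using onb_inner[OF ip, of i i] that inner_product_bilinear[OF ip] by (auto simp: bilinear_lzero)
  have c: "0 < (real CARD('n) - 2) / 2" using n by simp
  show "0 < sc x" if "positive_definite (lovelock 1 metric x)"
  proof -
    have "0 < (\<Sum>i<CARD('n). lovelock 1 metric x (?e ! i) (?e ! i))"
      using that ne by (intro sum_pos) (auto simp: positive_definite_def lessThan_empty_iff)
    then show ?thesis unfolding lovelock_one_trace[OF assms] using c by (simp add: zero_less_mult_iff)
  qed
  show "sc x < 0" if "negative_definite (lovelock 1 metric x)"
  proof -
    have "0 < (\<Sum>i<CARD('n). - lovelock 1 metric x (?e ! i) (?e ! i))"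
      using that ne by (intro sum_pos) (auto simp: negative_definite_def lessThan_empty_iff)
    then show ?thesis unfolding sum_negf lovelock_one_trace[OF assms] using c by (simp add: mult_less_0_iff)
  qed
qed

text \<open>The second fundamental form is the derivative of the projection onto the tangent space, which
  depends on the image of the chart only.\<close>

lemma B_eq_dd_projection:
  assumes x: "x \<in> V"
  shows "B x u v = dd (\<lambda>y. dd F y (Q y (dd F x v))) x u"
    and "(\<lambda>y. dd F y (Q y w)) differentiable (at x)"
proof -
  define P where "P w y = dd F y (Q y w)" for w y
  have dP: "P w differentiable (at x)" for w
    unfolding P_def by (intro diff_L_apply(1) diff_Q x differentiable_const)
  then show "(\<lambda>y. dd F y (Q y w)) differentiable (at x)" unfolding P_def .
  have linP: "linear (\<lambda>w. P w y)" if "y \<in> V" for y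
    unfolding P_def by (rule linear_compose[OF linear_Q[OF that] linL[OF that], unfolded o_def])
  have Pexp: "P w y = (\<Sum>b\<in>Basis. (w \<bullet> b) *\<^sub>R P b y)" if "y \<in> V" for y w
  proof -
    have "P w y = P (\<Sum>b\<in>Basis. (w \<bullet> b) *\<^sub>R b) y" by (simp add: euclidean_representation)
    then show ?thesis by (simp add: linear_sum[OF linP[OF that]] linear_scale[OF linP[OF that]])
  qed
  have D: "((\<lambda>y. \<Sum>b\<in>Basis. (dd F y v \<bullet> b) *\<^sub>R P b y) has_derivative
     (\<lambda>u. \<Sum>b\<in>Basis. (dd F x v \<bullet> b) *\<^sub>R dd (P b) x u + (H x u v \<bullet> b) *\<^sub>R P b x)) (at x)"
    unfolding H_def
    by (intro has_derivative_sum has_derivative_scaleR has_derivative_dd[OF dP]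
        has_derivative_inner_left has_derivative_dd[OF diffL[OF x]])
  have D2: "((\<lambda>y. \<Sum>b\<in>Basis. (w \<bullet> b) *\<^sub>R P b y) has_derivative
     (\<lambda>u. \<Sum>b\<in>Basis. (w \<bullet> b) *\<^sub>R dd (P b) x u)) (at x)" for w
    by (intro has_derivative_sum has_derivative_scaleR_right has_derivative_dd[OF dP])
  have eq: "(\<Sum>b\<in>Basis. (dd F y v \<bullet> b) *\<^sub>R P b y) = dd F y v" if "y \<in> V" for y
    unfolding Pexp[OF that, symmetric] by (simp add: P_def Q_image[OF that])
  \<comment> \<open>Leibniz rule for \<open>P (dd F y v) y = dd F y v\<close>: the derivative of the
    projection contributes \<open>B\<close>, and that of its argument the tangential part of
    \<open>H\<close>.\<close>
  have "H x u v = (\<Sum>b\<in>Basis. (dd F x v \<bullet> b) *\<^sub>R dd (P b) x u + (H x u v \<bullet> b) *\<^sub>R P b x)"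
  proof -
    have "H x u v = dd (\<lambda>y. \<Sum>b\<in>Basis. (dd F y v \<bullet> b) *\<^sub>R P b y) x u"
      unfolding H_def by (rule fun_cong[OF dd_cong(1)[OF openV x eq, symmetric]])
    also have "\<dots> = (\<Sum>b\<in>Basis. (dd F x v \<bullet> b) *\<^sub>R dd (P b) x u + (H x u v \<bullet> b) *\<^sub>R P b x)"
      by (rule fun_cong[OF dd_eqI[OF D]])
    finally show ?thesis .
  qed
  also have "\<dots> = dd (P (dd F x v)) x u + P (H x u v) x"
  proof -
    have "dd (P (dd F x v)) x = (\<lambda>u. \<Sum>b\<in>Basis. (dd F x v \<bullet> b) *\<^sub>R dd (P b) x u)"
    proof -
      have "dd (P (dd F x v)) x = dd (\<lambda>y. \<Sum>b\<in>Basis. (dd F x v \<bullet> b) *\<^sub>R P b y) x"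
        by (rule dd_cong(1)[OF openV x]) (rule Pexp)
      then show ?thesis unfolding dd_eqI[OF D2] .
    qed
    then show ?thesis unfolding Pexp[OF x, of "H x u v"] by (simp add: sum.distrib)
  qed
  finally show "B x u v = dd (\<lambda>y. dd F y (Q y (dd F x v))) x u"
    unfolding B_def P_def by (simp add: algebra_simps)
qed

end

section \<open>Change of parametrization\<close>

text \<open>The transition map is assumed to be continuous, as the homeomorphisms in
  \<open>sub_params\<close> provide it; its differentiability is derived from the two
  immersions.\<close>

locale chart_change = A: immersed_chart V F + C: immersed_chart W K
  for V :: "(real ^ 'n) set" and F :: "real ^ 'n \<Rightarrow> 'e::euclidean_space"
    and W :: "(real ^ 'n) set" and K :: "real ^ 'n \<Rightarrow> 'e" +
  fixes U :: "(real ^ 'n) set" and \<phi> :: "real ^ 'n \<Rightarrow> real ^ 'n"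
  assumes openU: "open U" and UV: "U \<subseteq> V" and \<phi>W: "\<And>x. x \<in> U \<Longrightarrow> \<phi> x \<in> W"
    and K\<phi>: "\<And>x. x \<in> U \<Longrightarrow> K (\<phi> x) = F x" and cont: "continuous_on U \<phi>"
begin

text \<open>Let \<open>P\<close> be the left inverse of the derivative of \<open>K\<close> at
  \<open>y = \<phi> x\<close>. Then \<open>P (K z)\<close> has the identity as derivative at
  \<open>y\<close>, and \<open>P (K (\<phi> x')) = P (F x')\<close>. Comparing the two linear
  approximations shows that \<open>\<phi> x' - y\<close> is close to \<open>D (x' - x)\<close>, as
  soon as its norm is known to be bounded by a multiple of that of \<open>x' - x\<close>.\<close>

lemma \<phi>_has_derivative:
  assumes x: "x \<in> U"
  shows "(\<phi> has_derivative (\<lambda>u. C.Q (\<phi> x) (dd F x u))) (at x)"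
proof -
  define y where "y = \<phi> x"
  define P where "P = C.Q y"
  define D where "D u = P (dd F x u)" for u
  have y: "y \<in> W" using \<phi>W x by (simp add: y_def)
  have xV: "x \<in> V" using UV x by blast
  have P: "bounded_linear P" unfolding P_def using C.linear_Q[OF y] by (rule linear_conv_bounded_linear[THEN iffD1])
  have dK: "((\<lambda>z. P (K z)) has_derivative (\<lambda>v. v)) (at y)"
    using bounded_linear.has_derivative[OF P has_derivative_dd[OF C.diffF[OF y]]]
    by (simp add: P_def C.Q_image[OF y])
  have dF: "((\<lambda>z. P (F z)) has_derivative D) (at x)"
    unfolding D_def by (rule bounded_linear.has_derivative[OF P has_derivative_dd[OF A.diffF[OF xV]]])
  have bD: "bounded_linear D" using dF by (rule has_derivative_bounded_linear)
  then obtain M where M: "0 < M" "\<And>u. norm (D u) \<le> norm u * M"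
    using bounded_linear.pos_bounded by blast
  have "\<exists>d>0. \<forall>x'. norm (x' - x) < d \<longrightarrow> norm (\<phi> x' - \<phi> x - D (x' - x)) \<le> e * norm (x' - x)" if e: "0 < e" for e
  proof -
    \<comment> \<open>The bound \<open>1/2\<close> lets the term \<open>\<epsilon> * a\<close> be
      absorbed on the left, which gives \<open>a \<le> 2 * (M + 1) * b\<close>; the other bound
      makes the total error \<open>\<epsilon> * b + \<epsilon> * a\<close> at most
      \<open>e * b\<close>.\<close>
    define \<epsilon> where "\<epsilon> = min (1/2) (e / (2 * (M + 1) + 1))"
    have \<epsilon>: "0 < \<epsilon>" "\<epsilon> \<le> 1/2" "\<epsilon> * (2 * (M + 1) + 1) \<le> e"
    proof -
      have c: "0 < 2 * (M + 1) + 1" using M by simp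
      show "0 < \<epsilon>" using e c by (simp add: \<epsilon>_def)
      show "\<epsilon> \<le> 1/2" unfolding \<epsilon>_def by (rule min.cobounded1)
      have "\<epsilon> \<le> e / (2 * (M + 1) + 1)" unfolding \<epsilon>_def by (rule min.cobounded2)
      then show "\<epsilon> * (2 * (M + 1) + 1) \<le> e" using c by (simp only: pos_le_divide_eq)
    qed
    obtain d1 where d1: "0 < d1" "\<And>z. norm (z - y) < d1 \<Longrightarrow> norm (P (K z) - P (K y) - (z - y)) \<le> \<epsilon> * norm (z - y)"
      using dK \<epsilon>(1) unfolding has_derivative_at_alt by blast
    obtain d2 where d2: "0 < d2" "\<And>x'. norm (x' - x) < d2 \<Longrightarrow> norm (P (F x') - P (F x) - D (x' - x)) \<le> \<epsilon> * norm (x' - x)"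
      using dF \<epsilon>(1) unfolding has_derivative_at_alt by blast
    have "isCont \<phi> x" using cont openU x by (simp add: continuous_on_eq_continuous_at)
    then obtain d3 where d3: "0 < d3" "\<And>x'. dist x' x < d3 \<Longrightarrow> dist (\<phi> x') (\<phi> x) < d1"
      using d1(1) unfolding continuous_at_eps_delta by blast
    obtain d4 where d4: "0 < d4" "ball x d4 \<subseteq> U" using openU x open_contains_ball by blast
    show ?thesis
    proof (intro exI[of _ "min d2 (min d3 d4)"] conjI allI impI)
      fix x' assume x': "norm (x' - x) < min d2 (min d3 d4)"
      then have "x' \<in> U" using d4 by (auto simp: dist_norm norm_minus_commute subset_iff)
      then have K': "K (\<phi> x') = F x'" by (rule K\<phi>)
      have Ky: "K y = F x" unfolding y_def by (rule K\<phi>[OF x])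
      define a where "a = norm (\<phi> x' - y)"
      define b where "b = norm (x' - x)"
      have "norm (\<phi> x' - y) < d1" using d3(2)[of x'] x' by (simp add: dist_norm y_def)
      then have 1: "norm (P (F x') - P (F x) - (\<phi> x' - y)) \<le> \<epsilon> * a"
        using d1(2)[of "\<phi> x'"] K' Ky by (simp add: a_def)
      have 2: "norm (P (F x') - P (F x) - D (x' - x)) \<le> \<epsilon> * b" using d2(2)[of x'] x' by (simp add: b_def)
      have eq: "\<phi> x' - y - D (x' - x) = (P (F x') - P (F x) - D (x' - x)) - (P (F x') - P (F x) - (\<phi> x' - y))"
        by simp
      have 3: "norm (\<phi> x' - y - D (x' - x)) \<le> \<epsilon> * b + \<epsilon> * a"
        unfolding eq using norm_triangle_ineq4 1 2 by (meson add_mono order_trans)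
      have "a \<le> norm (\<phi> x' - y - D (x' - x)) + norm (D (x' - x))"
        unfolding a_def using norm_triangle_ineq[of "\<phi> x' - y - D (x' - x)" "D (x' - x)"] by simp
      also have "\<dots> \<le> (\<epsilon> * b + \<epsilon> * a) + b * M" using 3 M(2)[of "x' - x"] by (simp add: b_def)
      also have "\<dots> \<le> 1/2 * b + 1/2 * a + b * M"
        using \<epsilon> M by (intro add_mono mult_right_mono) (auto simp: a_def b_def)
      finally have "a \<le> 1/2 * b + 1/2 * a + b * M" .
      moreover have "0 \<le> b" by (simp add: b_def)
      ultimately have "a \<le> 2 * (M + 1) * b" by (simp add: algebra_simps)
      then have "\<epsilon> * b + \<epsilon> * a \<le> \<epsilon> * b + \<epsilon> * (2 * (M + 1) * b)" using \<epsilon> by (intro add_left_mono mult_left_mono) auto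
      also have "\<dots> = (\<epsilon> * (2 * (M + 1) + 1)) * b" by (simp add: algebra_simps)
      also have "\<dots> \<le> e * b" using \<epsilon> by (intro mult_right_mono) (auto simp: b_def)
      finally show "norm (\<phi> x' - \<phi> x - D (x' - x)) \<le> e * norm (x' - x)"
        using 3 by (simp add: b_def y_def)
    qed (use d2 d3 d4 in auto)
  qed
  then have "(\<phi> has_derivative D) (at x)" unfolding has_derivative_at_alt using bD by blast
  then show ?thesis unfolding D_def P_def y_def .
qed

lemma dd_eq:
  assumes x: "x \<in> U"
  shows "dd F x u = dd K (\<phi> x) (dd \<phi> x u)"
proof -
  have d\<phi>: "(\<phi> has_derivative dd \<phi> x) (at x)"
    using \<phi>_has_derivative[OF x] dd_eqI by metis
  have "((\<lambda>x. K (\<phi> x)) has_derivative (\<lambda>u. dd K (\<phi> x) (dd \<phi> x u))) (at x)"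
    using diff_chain_at[OF d\<phi> has_derivative_dd[OF C.diffF[OF \<phi>W[OF x]]]] by (simp add: o_def)
  then show ?thesis using dd_cong(1)[OF openU x, of "\<lambda>x. K (\<phi> x)" F] K\<phi> dd_eqI by metis
qed

lemma linear_d\<phi>: "x \<in> U \<Longrightarrow> linear (dd \<phi> x)"
  by (rule linear_dd, rule differentiableI, rule \<phi>_has_derivative)

lemma inj_d\<phi>: "x \<in> U \<Longrightarrow> inj (dd \<phi> x)"
  using A.injF[of x] UV dd_eq by (metis (no_types, opaque_lifting) injD injI subsetD)

lemma range_eq: "x \<in> U \<Longrightarrow> range (dd F x) = range (dd K (\<phi> x))"
proof -
  assume x: "x \<in> U"
  have "surj (dd \<phi> x)" by (rule linear_inj_imp_surj[OF linear_d\<phi>[OF x] inj_d\<phi>[OF x]])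
  moreover have "dd F x = dd K (\<phi> x) \<circ> dd \<phi> x" using dd_eq[OF x] by (simp add: fun_eq_iff)
  ultimately show ?thesis by (metis image_comp)
qed

lemma metric_eq: "x \<in> U \<Longrightarrow> A.metric x u v = C.metric (\<phi> x) (dd \<phi> x u) (dd \<phi> x v)"
  unfolding A.metric_def C.metric_def by (simp add: dd_eq)

lemma proj_eq: "x \<in> U \<Longrightarrow> dd F x (A.Q x w) = dd K (\<phi> x) (C.Q (\<phi> x) w)"
  unfolding A.Q_def C.Q_def
  using UV by (intro proj_cong_range A.linL A.injF C.linL C.injF \<phi>W range_eq) auto

text \<open>The tangent projection is the same in both charts, so its derivative obeys the chain
  rule, and only the first derivative of \<open>\<phi>\<close> appears. The vector
  \<open>dd F x v\<close> is held fixed during the differentiation.\<close>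

lemma B_eq:
  assumes x: "x \<in> U"
  shows "A.B x u v = C.B (\<phi> x) (dd \<phi> x u) (dd \<phi> x v)"
proof -
  have xV: "x \<in> V" using UV x by blast
  let ?w = "dd F x v"
  have d\<phi>: "(\<phi> has_derivative dd \<phi> x) (at x)"
    using \<phi>_has_derivative[OF x] dd_eqI by metis
  have "A.B x u v = dd (\<lambda>y. dd F y (A.Q y ?w)) x u" by (rule A.B_eq_dd_projection[OF xV])
  also have "dd (\<lambda>y. dd F y (A.Q y ?w)) x = dd (\<lambda>y. dd K (\<phi> y) (C.Q (\<phi> y) ?w)) x"
    by (rule dd_cong[OF openU x]) (rule proj_eq)
  also have "\<dots> = (\<lambda>u. dd (\<lambda>z. dd K z (C.Q z ?w)) (\<phi> x) (dd \<phi> x u))"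
    using diff_chain_at[OF d\<phi> has_derivative_dd[OF C.B_eq_dd_projection(2)[OF \<phi>W[OF x], of ?w]]]
    by (intro dd_eqI) (simp add: o_def)
  also have "\<dots> u = C.B (\<phi> x) (dd \<phi> x u) (dd \<phi> x v)"
    unfolding C.B_eq_dd_projection(1)[OF \<phi>W[OF x]] dd_eq[OF x] ..
  finally show ?thesis .
qed

lemma Q_eq: "x \<in> U \<Longrightarrow> C.Q (\<phi> x) w = dd \<phi> x (A.Q x w)"
  using proj_eq[of x w] dd_eq[of x] C.Q_image[OF \<phi>W, of x] by metis

text \<open>\<open>B\<close> and \<open>Q\<close> are carried along by the derivative of
  \<open>\<phi>\<close>, and \<open>sc\<close> is built from nothing else.\<close>

lemma sc_eq: "x \<in> U \<Longrightarrow> A.sc x = C.sc (\<phi> x)"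
  unfolding A.sc_def C.sc_def by (simp add: B_eq Q_eq)

end

section \<open>Immersions of compact manifolds\<close>

context immersed_chart
begin

text \<open>The squared norm of \<open>F\<close> along a line through \<open>x\<close> has a maximum
  at 0. The two claims are the vanishing of half its first derivative and the sign of half its
  second derivative.\<close>

lemma sphere_contact_derivatives:
  assumes x: "x \<in> V" and max: "\<And>y. y \<in> V \<Longrightarrow> norm (F y) \<le> norm (F x)"
  shows "F x \<bullet> dd F x u = 0" and "F x \<bullet> H x u u + dd F x u \<bullet> dd F x u \<le> 0"
proof -
  obtain d where d: "0 < d" "ball x d \<subseteq> V" using openV x open_contains_ball by blast
  define c where "c = d / (norm u + 1)"
  have c: "0 < c" using d by (simp add: c_def add_nonneg_pos)
  have inV: "x + s *\<^sub>R u \<in> V" if "\<bar>s\<bar> < c" for s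
  proof -
    have "\<bar>s\<bar> * (norm u + 1) < d"
      using that by (simp add: c_def pos_less_divide_eq add_nonneg_pos)
    moreover have "norm (s *\<^sub>R u) \<le> \<bar>s\<bar> * (norm u + 1)" by (simp add: algebra_simps)
    ultimately show ?thesis using d by (auto simp: subset_iff dist_norm)
  qed
  define q where "q s = F (x + s *\<^sub>R u) \<bullet> F (x + s *\<^sub>R u)" for s
  define q' where "q' s = 2 * (F (x + s *\<^sub>R u) \<bullet> dd F (x + s *\<^sub>R u) u)" for s
  have line: "((\<lambda>s. f (x + s *\<^sub>R u)) has_derivative (\<lambda>t. t *\<^sub>R dd f (x + s *\<^sub>R u) u)) (at s)"
    if "f differentiable (at (x + s *\<^sub>R u))" for f :: "real ^ 'n \<Rightarrow> 'e" and s
  proof -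
    have "((\<lambda>s. x + s *\<^sub>R u) has_derivative (\<lambda>s. s *\<^sub>R u)) (at s)"
      by (auto intro!: derivative_eq_intros)
    from diff_chain_at[OF this has_derivative_dd[OF that]]
    show ?thesis by (simp add: o_def linear_scale[OF linear_dd[OF that]])
  qed
  have dq: "(q has_real_derivative q' s) (at s)" if "\<bar>s\<bar> < c" for s
  proof -
    note l = line[OF diffF[OF inV[OF that]]]
    have "(q has_derivative (\<lambda>t. F (x + s *\<^sub>R u) \<bullet> (t *\<^sub>R dd F (x + s *\<^sub>R u) u)
         + (t *\<^sub>R dd F (x + s *\<^sub>R u) u) \<bullet> F (x + s *\<^sub>R u))) (at s)"
      unfolding q_def by (rule has_derivative_inner[OF l l])
    then show ?thesis
      by (rule has_derivative_imp_has_field_derivative) (simp add: q'_def inner_commute)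
  qed
  have dq': "(q' has_real_derivative 2 * (F x \<bullet> H x u u + dd F x u \<bullet> dd F x u)) (at 0)"
  proof -
    have l: "((\<lambda>s. F (x + s *\<^sub>R u)) has_derivative (\<lambda>t. t *\<^sub>R dd F x u)) (at 0)"
      using line[of F 0] diffF[OF x] by simp
    have l2: "((\<lambda>s. dd F (x + s *\<^sub>R u) u) has_derivative (\<lambda>t. t *\<^sub>R H x u u)) (at 0)"
      using line[of "\<lambda>y. dd F y u" 0] diffL[OF x] by (simp add: H_def)
    have "((\<lambda>s. F (x + s *\<^sub>R u) \<bullet> dd F (x + s *\<^sub>R u) u) has_derivative (\<lambda>t. F x \<bullet> (t *\<^sub>R H x u u)
         + (t *\<^sub>R dd F x u) \<bullet> dd F x u)) (at 0)"
      using has_derivative_inner[OF l l2] by simp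
    then have "((\<lambda>s. F (x + s *\<^sub>R u) \<bullet> dd F (x + s *\<^sub>R u) u) has_real_derivative
        F x \<bullet> H x u u + dd F x u \<bullet> dd F x u) (at 0)"
      by (rule has_derivative_imp_has_field_derivative) (simp add: algebra_simps)
    from DERIV_cmult[OF this, of 2] show ?thesis unfolding q'_def .
  qed
  have le: "q s \<le> q 0" if "\<bar>s\<bar> < c" for s
    using max[OF inV[OF that]] unfolding q_def dot_square_norm by simp
  have "q' 0 = 0"
    by (rule DERIV_local_max[OF dq, of 0 c]) (use c le in auto)
  then show "F x \<bullet> dd F x u = 0" by (simp add: q'_def)
  show "F x \<bullet> H x u u + dd F x u \<bullet> dd F x u \<le> 0"
  proof (rule ccontr)
    assume "\<not> ?thesis"
    then have "0 < 2 * (F x \<bullet> H x u u + dd F x u \<bullet> dd F x u)" by simp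
    \<comment> \<open>A positive second derivative makes \<open>q'\<close> positive just after 0,
      and by the mean value theorem \<open>q\<close> would then exceed its maximum.\<close>
    from DERIV_pos_inc_right[OF dq' this] obtain d where d: "0 < d"
      "\<And>s. 0 < s \<Longrightarrow> s < d \<Longrightarrow> q' 0 < q' (0 + s)" by blast
    define s where "s = min c d / 2"
    have s: "0 < s" "s < c" "s < d" using c d by (auto simp: s_def)
    have "\<And>t. 0 \<le> t \<Longrightarrow> t \<le> s \<Longrightarrow> (q has_real_derivative q' t) (at t)" using dq s by simp
    from MVT2[OF s(1) this] obtain t where t: "0 < t" "t < s" "q s - q 0 = (s - 0) * q' t" by blast
    have "0 < q' t" using d(2)[of t] t s \<open>q' 0 = 0\<close> by simp
    then have "0 < q s - q 0" using t s by simp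
    then show False using le[of s] s by simp
  qed
qed

lemma sphere_contact:
  assumes x: "x \<in> V" and max: "\<And>y. y \<in> V \<Longrightarrow> norm (F y) \<le> norm (F x)"
  shows "F x \<bullet> dd F x u = 0" and "u \<noteq> 0 \<Longrightarrow> B x u u \<bullet> F x < 0"
proof -
  show normal: "F x \<bullet> dd F x u = 0" for u
    by (rule sphere_contact_derivatives[OF assms])
  assume "u \<noteq> 0"
  then have "0 < dd F x u \<bullet> dd F x u"
    using linL[OF x] injF[OF x] by (auto simp: linear_injective_0)
  moreover have "B x u u \<bullet> F x = F x \<bullet> H x u u"
    unfolding inner_commute[of "B x u u"] by (simp add: B_def inner_diff_right normal)
  ultimately show "B x u u \<bullet> F x < 0"
    using sphere_contact_derivatives(2)[OF assms, of u] by linarith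
qed

lemma neg_B_inner_product:
  assumes x: "x \<in> V" and max: "\<And>y. y \<in> V \<Longrightarrow> norm (F y) \<le> norm (F x)"
  shows "inner_product (\<lambda>u v. - (B x u v \<bullet> F x))"
  unfolding inner_product_def bilinear_def
  using sphere_contact(2)[OF assms] B_sym[OF x]
  by (auto intro!: linearI simp: linear_add[OF B_linear_left[OF x]] linear_scale[OF B_linear_left[OF x]]
      linear_add[OF B_linear_right[OF x]] linear_scale[OF B_linear_right[OF x]] inner_add_left)

end

lemma immersion_chart:
  assumes "immersion A f" "c \<in> A" "open (fst c)"
  shows "immersed_chart (fst c) (f \<circ> snd c)"
  using assms unfolding immersion_def by unfold_locales auto

lemma induced_metric_eq:
  assumes "immersed_chart V (f \<circ> snd c)"
  shows "induced_metric f c = immersed_chart.metric (f \<circ> snd c)"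
  using assms by (intro ext) (simp add: induced_metric_def immersed_chart.metric_def)

text \<open>Uniqueness holds because two candidates differ by a vector that is both tangential and
  normal.\<close>

lemma second_fundamental_form_eq:
  assumes "immersed_chart V (f \<circ> snd c)" "x \<in> V"
  shows "second_fundamental_form f c x u v = immersed_chart.B (f \<circ> snd c) x u v"
proof -
  interpret immersed_chart V "f \<circ> snd c" by fact
  show ?thesis unfolding second_fundamental_form_def
  proof (rule the_equality)
    show "B x u v \<in> normal_space f c x \<and> dd (\<lambda>y. dd (f \<circ> snd c) y v) x u - B x u v \<in> range (dd (f \<circ> snd c) x)"
      using B_normal[OF assms(2)] unfolding normal_space_def orthogonal_comp_def
      by (auto simp: orthogonal_def inner_commute) (simp add: B_def H_def)
    fix b assume b: "b \<in> normal_space f c x \<and> dd (\<lambda>y. dd (f \<circ> snd c) y v) x u - b \<in> range (dd (f \<circ> snd c) x)"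
    then obtain w where w: "H x u v - b = dd (f \<circ> snd c) x w" unfolding H_def by auto
    define z where "z = w - Q x (H x u v)"
    have bz: "B x u v - b = dd (f \<circ> snd c) x z"
      unfolding B_def z_def linear_diff[OF linL[OF assms(2)]] w[symmetric] by simp
    have "b \<bullet> dd (f \<circ> snd c) x z = 0"
      using b unfolding normal_space_def orthogonal_comp_def by (auto simp: orthogonal_def inner_commute)
    then have "(B x u v - b) \<bullet> dd (f \<circ> snd c) x z = 0"
      by (simp add: inner_diff_left B_normal[OF assms(2)])
    then have "(B x u v - b) \<bullet> (B x u v - b) = 0" by (simp only: bz)
    then show "b = B x u v" by simp
  qed
qed

text \<open>The topological properties shared by the atlas of a manifold and by the parametrizations
  of a submanifold; the farthest-point argument is stated for these and so covers both.\<close>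

definition topological_atlas :: "'m topology \<Rightarrow> ('n::finite, 'm) param set \<Rightarrow> bool" where
  "topological_atlas X A \<longleftrightarrow>
     (\<forall>c\<in>A. open (fst c) \<and> openin X (snd c ` fst c) \<and>
        homeomorphic_map (top_of_set (fst c)) (subtopology X (snd c ` fst c)) (snd c)) \<and>
     (\<Union>c\<in>A. snd c ` fst c) = topspace X"

lemma topological_atlasD:
  assumes "topological_atlas X A"
  shows "c \<in> A \<Longrightarrow> open (fst c)" "c \<in> A \<Longrightarrow> openin X (snd c ` fst c)"
    "c \<in> A \<Longrightarrow> homeomorphic_map (top_of_set (fst c)) (subtopology X (snd c ` fst c)) (snd c)"
    "(\<Union>c\<in>A. snd c ` fst c) = topspace X"
  using assms by (simp_all add: topological_atlas_def)

lemma smooth_manifold_atlas: "smooth_manifold X A \<Longrightarrow> topological_atlas X A"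
  unfolding smooth_manifold_def topological_atlas_def by (simp add: case_prod_unfold)

lemma continuous_map_atlas:
  fixes h :: "'m \<Rightarrow> real"
  assumes atlas: "topological_atlas X A"
    and h: "\<And>c. c \<in> A \<Longrightarrow> continuous_on (fst c) (h \<circ> snd c)"
  shows "continuous_map X euclidean h"
  unfolding continuous_map_def
proof (intro conjI allI impI)
  show "h \<in> topspace X \<rightarrow> topspace euclidean" by simp
  fix U :: "real set" assume "openin euclidean U"
  then have U: "open U" by simp
  have "{p \<in> topspace X. h p \<in> U} = (\<Union>c\<in>A. snd c ` {x \<in> fst c. h (snd c x) \<in> U})"
    unfolding topological_atlasD(4)[OF atlas, symmetric] by auto
  also have "openin X \<dots>"
  proof (rule openin_Union, safe)
    fix c assume c: "c \<in> A"
    have "openin (top_of_set (fst c)) {x \<in> fst c. h (snd c x) \<in> U}"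
      using continuous_openin_preimage_gen[OF h[OF c] U] by (simp add: vimage_def Int_def conj_commute)
    then have "openin (subtopology X (snd c ` fst c)) (snd c ` {x \<in> fst c. h (snd c x) \<in> U})"
      using topological_atlasD(3)[OF atlas c] homeomorphic_imp_open_map unfolding open_map_def by blast
    then show "openin X (snd c ` {x \<in> fst c. h (snd c x) \<in> U})"
      using topological_atlasD(2)[OF atlas c] openin_trans_full by blast
  qed
  finally show "openin X {p \<in> topspace X. h p \<in> U}" .
qed

theorem no_minimal_immersion:
  fixes A :: "('n::finite, 'm) param set" and f :: "'m \<Rightarrow> 'e::euclidean_space"
  assumes atlas: "topological_atlas X A"
    and X: "topspace X \<noteq> {}" "compact_space X"
    and f: "immersion A f"
    and T: "positive_lovelock k A (induced_metric f) \<or> negative_lovelock k A (induced_metric f)"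
  shows "\<not> minimal_immersion k A f"
proof
  assume minimal: "minimal_immersion k A f"
  have chart: "immersed_chart (fst c) (f \<circ> snd c)" if "c \<in> A" for c
    by (rule immersion_chart[OF f that topological_atlasD(1)[OF atlas that]])
  have "continuous_map X euclidean (\<lambda>p. norm (f p))"
  proof (rule continuous_map_atlas[OF atlas])
    fix c assume c: "c \<in> A"
    interpret immersed_chart "fst c" "f \<circ> snd c" by (rule chart[OF c])
    show "continuous_on (fst c) ((\<lambda>p. norm (f p)) \<circ> snd c)"
      using continuous_on_norm[OF smooth_on_continuous[OF smoothF]] by (simp add: o_def)
  qed
  then have "compact ((\<lambda>p. norm (f p)) ` topspace X)"
    using X(2) image_compactin unfolding compact_space_def compactin_euclidean_iff[symmetric] by blast
  then obtain p where p: "p \<in> topspace X" "\<And>q. q \<in> topspace X \<Longrightarrow> norm (f q) \<le> norm (f p)"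
    using compact_attains_sup[of "(\<lambda>p. norm (f p)) ` topspace X"] X(1) by auto
  obtain c x where c: "c \<in> A" and x: "x \<in> fst c" and px: "p = snd c x"
    using p(1) topological_atlasD(4)[OF atlas] by blast
  interpret immersed_chart "fst c" "f \<circ> snd c" by (rule chart[OF c])
  have max: "norm ((f \<circ> snd c) y) \<le> norm ((f \<circ> snd c) x)" if "y \<in> fst c" for y
    using p(2)[of "snd c y"] that px topological_atlasD(4)[OF atlas] c by auto
  let ?N = "(f \<circ> snd c) x"
  have N: "?N \<in> normal_space f c x"
    using sphere_contact(1)[OF x max] unfolding normal_space_def orthogonal_comp_def
    by (auto simp: orthogonal_def inner_commute)
  have g: "induced_metric f c = metric"
    by (rule induced_metric_eq) (rule chart[OF c])
  have T': "positive_definite (lovelock k metric x) \<or> negative_definite (lovelock k metric x)"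
    using T c x unfolding positive_lovelock_def negative_lovelock_def g[symmetric] by blast
  \<comment> \<open>For \<open>2 * k \<ge> n\<close> the tensor is zero by convention and cannot be
    definite, because \<open>real ^ 'n\<close> contains a nonzero vector. Thus the default value of
    \<open>h_form\<close> is avoided as well.\<close>
  have k: "2 * k < DIM(real ^ 'n)"
  proof (rule ccontr)
    assume "\<not> ?thesis"
    then have "lovelock k metric x u u = 0" for u by (simp add: lovelock_def lovelock_form_def)
    moreover have "axis undefined 1 \<noteq> (0 :: real ^ 'n)" by (simp add: axis_eq_0_iff)
    ultimately show False using T' unfolding positive_definite_def negative_definite_def by force
  qed
  have "h_odd k f c x ?N = h_form k (metric x) (riemann metric x) (\<lambda>u v. B x u v \<bullet> ?N)"
    unfolding h_odd_def g second_fundamental_form_eq[OF chart[OF c] x] ..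
  also have "\<dots> \<noteq> 0"
    by (rule h_form_nonzero[OF metric_inner_product[OF x] k T'[unfolded lovelock_def]
          neg_B_inner_product[OF x max]])
  finally have "h_odd k f c x ?N \<noteq> 0" .
  then show False using minimal N c x unfolding minimal_immersion_def by blast
qed

text \<open>An isometric immersion identifies the two metrics on the domain of a chart only. Since
  the curvature involves derivatives of the metric, equality on an open neighbourhood of
  \<open>x\<close> is what transfers it.\<close>

lemma lovelock_cong:
  assumes "open V" "x \<in> V" and eq: "\<And>y. y \<in> V \<Longrightarrow> g y = g' y"
  shows "lovelock k g x = lovelock k g' x"
proof -
  have d: "dd (\<lambda>y. g y v w) y = dd (\<lambda>y. g' y v w) y" if "y \<in> V" for y v w
    by (rule dd_cong(1)[OF assms(1) that]) (simp add: eq)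
  have chr: "christoffel g y = christoffel g' y" if "y \<in> V" for y
    unfolding christoffel_def by (intro ext) (simp add: d[OF that] eq[OF that])
  have "dd (\<lambda>y. christoffel g y v w) x = dd (\<lambda>y. christoffel g' y v w) x" for v w
    by (rule dd_cong(1)[OF assms(1,2)]) (simp add: chr)
  then have "riemann g x = riemann g' x"
    by (intro ext) (simp add: riemann_def curvature_def chr[OF assms(2)] eq[OF assms(2)])
  then show ?thesis by (simp add: lovelock_def eq[OF assms(2)])
qed

section \<open>Change of variables\<close>

text \<open>The library states the change of variables theorem for well-ordered index types only; \<open>'n idx\<close>
  is a well-ordered type of the same cardinality as \<open>'n\<close>.\<close>

typedef 'n idx = "{..<CARD('n::finite)}"
proof
  show "0 \<in> {..<CARD('n)}" by simp
qed

instance idx :: (finite) finite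
proof
  have "inj (Rep_idx :: 'a idx \<Rightarrow> nat)" by (simp add: inj_def Rep_idx_inject)
  moreover have "range (Rep_idx :: 'a idx \<Rightarrow> nat) \<subseteq> {..<CARD('a)}" using Rep_idx by blast
  ultimately show "finite (UNIV :: 'a idx set)"
    by (meson finite_imageD finite_lessThan finite_subset)
qed

instantiation idx :: (finite) wellorder
begin

definition "i \<le> j \<longleftrightarrow> Rep_idx i \<le> Rep_idx j"
definition "i < j \<longleftrightarrow> Rep_idx i < Rep_idx j"

instance
proof
  fix P :: "'a idx \<Rightarrow> bool" and a :: "'a idx"
  assume *: "\<And>x. (\<And>y. y < x \<Longrightarrow> P y) \<Longrightarrow> P x"
  show "P a"
    by (induction a rule: measure_induct_rule[of Rep_idx]) (auto intro: * simp: less_idx_def)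
qed (auto simp: less_eq_idx_def less_idx_def Rep_idx_inject)

end

lemma card_idx: "CARD('n::finite idx) = CARD('n)"
  using type_definition.card[OF type_definition_idx[where 'n = 'n]] by simp

text \<open>Renaming rows and columns by the same bijection conjugates the permutations in the
  Leibniz formula, and conjugation preserves signs.\<close>

lemma det_reindex:
  fixes M :: "real ^ 'n ^ 'n" and h :: "'m::finite \<Rightarrow> 'n::finite"
  assumes h: "bij h"
  shows "det (\<chi> i j. M $ h i $ h j) = det M"
proof -
  define P where "P q = map_permutation UNIV h q" for q
  have inj: "inj h" and hU: "bij_betw h UNIV UNIV" using h by (auto simp: bij_def)
  have P: "P q permutes UNIV" "sign (P q) = sign q" "\<And>i. P q (h i) = h (q i)" if "q permutes UNIV" for q
    unfolding P_def using that inj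
    by (auto intro: map_permutation_permutes[OF hU] sign_map_permutation simp: map_permutation_apply)
  have bij: "bij_betw P {q. q permutes UNIV} {p. p permutes UNIV}"
  proof (rule bij_betw_byWitness[where f' = "map_permutation UNIV (inv h)"])
    have hi: "bij_betw (inv h) UNIV UNIV" using h by (rule bij_imp_bij_inv)
    show "\<forall>q\<in>{q. q permutes UNIV}. map_permutation UNIV (inv h) (P q) = q"
      unfolding P_def using inj by (auto intro: map_permutation_compose_inv[OF hU])
    show "\<forall>p\<in>{p. p permutes UNIV}. P (map_permutation UNIV (inv h) p) = p"
      unfolding P_def using h by (auto intro!: map_permutation_compose_inv[OF hi] simp: bij_is_surj surj_f_inv_f)
    show "P ` {q. q permutes UNIV} \<subseteq> {p. p permutes UNIV}" using P by auto
    show "map_permutation UNIV (inv h) ` {p. p permutes UNIV} \<subseteq> {q. q permutes UNIV}"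
      by (auto intro: map_permutation_permutes[OF hi])
  qed
  have "det M = (\<Sum>q | q permutes UNIV. of_int (sign (P q)) * (\<Prod>i\<in>UNIV. M $ i $ P q i))"
    unfolding det_def by (rule sum.reindex_bij_betw[OF bij, symmetric])
  also have "\<dots> = (\<Sum>q | q permutes UNIV. of_int (sign q) * (\<Prod>i\<in>UNIV. M $ h i $ h (q i)))"
  proof (rule sum.cong[OF refl])
    fix q :: "'m \<Rightarrow> 'm" assume "q \<in> {q. q permutes UNIV}"
    then have q: "q permutes UNIV" by simp
    have "(\<Prod>i\<in>UNIV. M $ i $ P q i) = (\<Prod>i\<in>UNIV. M $ h i $ P q (h i))"
      by (rule prod.reindex_bij_betw[OF hU, symmetric])
    then show "of_int (sign (P q)) * (\<Prod>i\<in>UNIV. M $ i $ P q i) = of_int (sign q) * (\<Prod>i\<in>UNIV. M $ h i $ h (q i))"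
      using P[OF q] by simp
  qed
  finally show ?thesis by (simp add: det_def)
qed

text \<open>Quantified over \<open>b\<close>, the equivalence says that the two functions are
  integrable together, with equal integrals. For nonnegative measurable functions failure of
  integrability means the value infinity on both sides.\<close>

lemma nn_integral_eq_of_absolutely_integrable:
  fixes J :: "'a::euclidean_space \<Rightarrow> real" and J' :: "'b::euclidean_space \<Rightarrow> real"
  assumes J: "(\<lambda>x. indicator T x * J x) \<in> borel_measurable borel" "\<And>x. 0 \<le> J x"
    and J': "(\<lambda>x. indicator T' x * J' x) \<in> borel_measurable borel" "\<And>x. 0 \<le> J' x"
    and iff: "\<And>b. J absolutely_integrable_on T \<and> integral T J = b \<longleftrightarrow>
                    J' absolutely_integrable_on T' \<and> integral T' J' = b"
  shows "(\<integral>\<^sup>+x. ennreal (indicator T x * J x) \<partial>lborel) = (\<integral>\<^sup>+x. ennreal (indicator T' x * J' x) \<partial>lborel)"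
proof -
  have val: "(\<integral>\<^sup>+x. ennreal (indicator T x * J x) \<partial>lborel) =
      (if J absolutely_integrable_on T then ennreal (integral T J) else \<infinity>)"
    if m: "(\<lambda>x. indicator T x * J x) \<in> borel_measurable borel" and pos: "\<And>x. 0 \<le> J x"
    for J :: "'c::euclidean_space \<Rightarrow> real" and T
  proof (cases "J absolutely_integrable_on T")
    case True
    then have int: "integrable lebesgue (\<lambda>x. indicator T x * J x)" by (simp add: set_integrable_def)
    have "(\<integral>\<^sup>+x. ennreal (indicator T x * J x) \<partial>lebesgue) = ennreal (LINT x|lebesgue. indicator T x * J x)"
      using pos by (intro nn_integral_eq_integral[OF int]) (auto simp: indicator_def)
    also have "(LINT x|lebesgue. indicator T x * J x) = integral T J"
      using set_lebesgue_integral_eq_integral(2)[OF True] by (simp add: set_lebesgue_integral_def)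
    finally show ?thesis using True by (simp add: nn_integral_completion)
  next
    case False
    have "(\<integral>\<^sup>+x. ennreal (indicator T x * J x) \<partial>lborel) = \<infinity>"
    proof (rule ccontr)
      assume "\<not> ?thesis"
      then have "integrable lborel (\<lambda>x. indicator T x * J x)"
        using m pos by (intro integrableI_nonneg) (auto simp: indicator_def less_top)
      then have "integrable lebesgue (\<lambda>x. indicator T x * J x)"
        using m by (subst integrable_completion) auto
      then show False using False by (simp add: set_integrable_def)
    qed
    then show ?thesis using False by simp
  qed
  show ?thesis unfolding val[OF J] val[OF J'] using iff[of "integral T J"] iff[of "integral T' J'"] by auto
qed

lemma nn_integral_change_of_variables_wellorder:
  fixes \<phi> :: "real ^ 'm::{finite,wellorder} \<Rightarrow> real ^ 'm::_"
  assumes T: "T \<in> sets borel" and \<phi>: "\<And>x. x \<in> T \<Longrightarrow> (\<phi> has_derivative \<phi>' x) (at x)" and inj: "inj_on \<phi> T"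
    and J: "(\<lambda>x. indicator T x * J x) \<in> borel_measurable borel" "\<And>x. 0 \<le> J x"
    and J': "(\<lambda>x. indicator (\<phi> ` T) x * J' x) \<in> borel_measurable borel" "\<And>x. 0 \<le> J' x"
    and eq: "\<And>x. x \<in> T \<Longrightarrow> J x = \<bar>det (matrix (\<phi>' x))\<bar> * J' (\<phi> x)"
  shows "(\<integral>\<^sup>+x. ennreal (indicator T x * J x) \<partial>lborel) = (\<integral>\<^sup>+x. ennreal (indicator (\<phi> ` T) x * J' x) \<partial>lborel)"
proof (rule nn_integral_eq_of_absolutely_integrable[OF J J'])
  fix b
  \<comment> \<open>\<open>v\<close> identifies the reals with \<open>real ^ 1\<close>, since the
    change of variables theorem takes a vector-valued integrand.\<close>
  define v where "v r = (\<chi> i::1. r)" for r :: real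
  have v: "bounded_linear v"
    unfolding v_def linear_conv_bounded_linear[symmetric] by (rule linearI) (auto simp: vec_eq_iff)
  have vn: "bounded_linear (\<lambda>w :: real ^ 1. w $ 1)" by (rule bounded_linear_vec_nth)
  have abs: "(\<lambda>x. v (K x)) absolutely_integrable_on S \<longleftrightarrow> K absolutely_integrable_on S" for K :: "real ^ 'm::_ \<Rightarrow> real" and S
  proof
    assume "K absolutely_integrable_on S"
    from absolutely_integrable_linear[OF this v] show "(\<lambda>x. v (K x)) absolutely_integrable_on S"
      by (simp add: o_def)
  next
    assume "(\<lambda>x. v (K x)) absolutely_integrable_on S"
    from absolutely_integrable_linear[OF this vn] show "K absolutely_integrable_on S"
      by (simp add: o_def v_def)
  qed
  have int: "integral S (\<lambda>x. v (K x)) = v (integral S K)" if "K absolutely_integrable_on S" for K :: "real ^ 'm::_ \<Rightarrow> real" and S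
    using integral_linear[OF set_lebesgue_integral_eq_integral(1)[OF that] v] by (simp add: o_def)
  have vinj: "v r = v s \<longleftrightarrow> r = s" for r s by (simp add: v_def vec_eq_iff)
  have both: "(\<lambda>x. v (K x)) absolutely_integrable_on S \<and> integral S (\<lambda>x. v (K x)) = v b \<longleftrightarrow>
      K absolutely_integrable_on S \<and> integral S K = b" for K :: "real ^ 'm::_ \<Rightarrow> real" and S
    using abs[of S K] int[of S K] vinj by metis
  have cov: "(\<lambda>x. \<bar>det (matrix (\<phi>' x))\<bar> *\<^sub>R v (J' (\<phi> x))) absolutely_integrable_on T \<and>
           integral T (\<lambda>x. \<bar>det (matrix (\<phi>' x))\<bar> *\<^sub>R v (J' (\<phi> x))) = v b
     \<longleftrightarrow> (\<lambda>x. v (J' x)) absolutely_integrable_on (\<phi> ` T) \<and> integral (\<phi> ` T) (\<lambda>x. v (J' x)) = v b"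
    using T \<phi> inj by (intro has_absolute_integral_change_of_variables) (auto intro: has_derivative_at_withinI)
  have "\<bar>det (matrix (\<phi>' x))\<bar> *\<^sub>R v (J' (\<phi> x)) = v (J x)" if "x \<in> T" for x
    using eq[OF that] by (simp add: v_def vec_eq_iff)
  then have e: "(\<lambda>x. \<bar>det (matrix (\<phi>' x))\<bar> *\<^sub>R v (J' (\<phi> x))) absolutely_integrable_on T \<longleftrightarrow> (\<lambda>x. v (J x)) absolutely_integrable_on T"
    "integral T (\<lambda>x. \<bar>det (matrix (\<phi>' x))\<bar> *\<^sub>R v (J' (\<phi> x))) = integral T (\<lambda>x. v (J x))"
    by (rule set_integrable_cong[OF refl refl], simp, rule Henstock_Kurzweil_Integration.integral_cong, simp)
  show "J absolutely_integrable_on T \<and> integral T J = b \<longleftrightarrow>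
      J' absolutely_integrable_on \<phi> ` T \<and> integral (\<phi> ` T) J' = b"
    unfolding both[of T J, symmetric] both[of "\<phi> ` T" J', symmetric] using cov unfolding e .
qed

definition vec_reindex :: "('m \<Rightarrow> 'n) \<Rightarrow> real ^ 'n \<Rightarrow> real ^ 'm" where
  "vec_reindex h z = (\<chi> i. z $ h i)"

lemma linear_vec_reindex: "linear (vec_reindex h)"
  by (rule linearI) (auto simp: vec_reindex_def vec_eq_iff)

text \<open>Lebesgue measure is determined by its values on boxes, and permuting the coordinates
  merely permutes the sides of a box.\<close>

lemma lborel_vec_reindex:
  fixes h :: "'m::finite \<Rightarrow> 'n::finite"
  assumes h: "bij h"
  shows "distr lborel borel (vec_reindex h) = (lborel :: (real ^ 'm) measure)"
proof (rule lborel_eqI[symmetric])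
  have bl: "bounded_linear (vec_reindex h)" using linear_vec_reindex linear_conv_bounded_linear by blast
  have meas: "vec_reindex h \<in> borel_measurable borel"
    by (rule borel_measurable_continuous_onI[OF bounded_linear.continuous_on[OF bl continuous_on_id]])
  fix l u :: "real ^ 'm" assume lu: "\<And>b. b \<in> Basis \<Longrightarrow> l \<bullet> b \<le> u \<bullet> b"
  define l' u' where "l' = vec_reindex (inv h) l" and "u' = vec_reindex (inv h) u"
  have lu': "l $ i \<le> u $ i" for i
  proof -
    have "axis i (1::real) \<in> Basis" by (auto simp: Basis_vec_def)
    from lu[OF this] show ?thesis by (simp add: inner_axis)
  qed
  have "vec_reindex h -` box l u = box l' u'"
  proof (rule set_eqI)
    fix z
    have "(\<forall>i. l $ i < z $ h i \<and> z $ h i < u $ i) \<longleftrightarrow> (\<forall>j. l $ inv h j < z $ j \<and> z $ j < u $ inv h j)"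
      using h by (metis bij_inv_eq_iff)
    then show "z \<in> vec_reindex h -` box l u \<longleftrightarrow> z \<in> box l' u'"
      by (simp add: mem_box_cart l'_def u'_def vec_reindex_def)
  qed
  then have "emeasure (distr lborel borel (vec_reindex h)) (box l u) = emeasure lborel (box l' u')"
    using meas by (simp add: emeasure_distr)
  also have "\<dots> = ennreal (\<Prod>b\<in>Basis. (u' - l') \<bullet> b)"
    by (rule emeasure_lborel_box) (auto simp: Basis_vec_def inner_axis l'_def u'_def vec_reindex_def lu')
  also have "(\<Prod>b\<in>Basis. (u' - l') \<bullet> b) = (\<Prod>j\<in>UNIV. (u - l) $ inv h j)"
    by (simp add: Basis_vec_def axis_eq_axis inner_axis l'_def u'_def vec_reindex_def
        prod.UNION_disjoint)
  also have "\<dots> = (\<Prod>i\<in>UNIV. (u - l) $ i)"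
    using prod.reindex_bij_betw[OF bij_imp_bij_inv[OF h], of "\<lambda>i. (u - l) $ i"] .
  also have "\<dots> = (\<Prod>b\<in>Basis. (u - l) \<bullet> b)"
    by (simp add: Basis_vec_def axis_eq_axis inner_axis prod.UNION_disjoint)
  finally show "emeasure (distr lborel borel (vec_reindex h)) (box l u) = ennreal (\<Prod>b\<in>Basis. (u - l) \<bullet> b)" .
qed simp

text \<open>The map is conjugated by a renaming of the coordinates, which preserves Lebesgue measure
  and, by \<open>det_reindex\<close>, the Jacobian determinant.\<close>

lemma nn_integral_change_of_variables:
  fixes \<phi> :: "real ^ 'n \<Rightarrow> real ^ 'n"
  assumes T: "T \<in> sets borel" and \<phi>: "\<And>x. x \<in> T \<Longrightarrow> (\<phi> has_derivative \<phi>' x) (at x)" and inj: "inj_on \<phi> T"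
    and J: "(\<lambda>x. indicator T x * J x) \<in> borel_measurable borel" "\<And>x. 0 \<le> J x"
    and J': "(\<lambda>x. indicator (\<phi> ` T) x * J' x) \<in> borel_measurable borel" "\<And>x. 0 \<le> J' x"
    and eq: "\<And>x. x \<in> T \<Longrightarrow> J x = \<bar>det (matrix (\<phi>' x))\<bar> * J' (\<phi> x)"
  shows "(\<integral>\<^sup>+x. ennreal (indicator T x * J x) \<partial>lborel) = (\<integral>\<^sup>+x. ennreal (indicator (\<phi> ` T) x * J' x) \<partial>lborel)"
proof -
  obtain h :: "'n idx \<Rightarrow> 'n" where h: "bij h"
    using finite_same_card_bij[of "UNIV :: 'n idx set" "UNIV :: 'n set"] card_idx[where 'n = 'n] by auto
  define R where "R = vec_reindex (inv h)"
  define R' where "R' = vec_reindex h"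
  have RR [simp]: "R (R' z) = z" "R' (R w) = w" for z w
    using h by (simp_all add: R_def R'_def vec_reindex_def vec_eq_iff bij_is_surj surj_f_inv_f bij_is_inj inv_f_f)
  have bl: "bounded_linear R" "bounded_linear R'"
    unfolding R_def R'_def using linear_vec_reindex linear_conv_bounded_linear by blast+
  have meas: "R \<in> borel_measurable borel" "R' \<in> borel_measurable borel"
    by (rule borel_measurable_continuous_onI, rule bounded_linear.continuous_on[OF bl(1) continuous_on_id],
        rule borel_measurable_continuous_onI, rule bounded_linear.continuous_on[OF bl(2) continuous_on_id])
  have lb: "lborel = distr lborel borel R"
    unfolding R_def using lborel_vec_reindex[OF bij_imp_bij_inv[OF h]] by simp
  have int: "(\<integral>\<^sup>+x. ennreal (indicator S x * K x) \<partial>lborel) =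
      (\<integral>\<^sup>+w. ennreal (indicator (R' ` S) w * K (R w)) \<partial>lborel)"
    if "(\<lambda>x. indicator S x * K x) \<in> borel_measurable borel" for S and K :: "real ^ 'n \<Rightarrow> real"
  proof -
    have "indicator (R' ` S) w = (indicator S (R w) :: real)" for w
      by (auto simp: indicator_def image_iff) (metis RR(2))
    then show ?thesis
      using that meas by (subst lb, subst nn_integral_distr) auto
  qed
  have ind: "(\<lambda>w. indicator (R' ` S) w * K (R w)) \<in> borel_measurable borel"
    if "(\<lambda>x. indicator S x * K x) \<in> borel_measurable borel" for S and K :: "real ^ 'n \<Rightarrow> real"
  proof -
    have "indicator (R' ` S) w = (indicator S (R w) :: real)" for w
      by (auto simp: indicator_def image_iff) (metis RR(2))
    then show ?thesis using measurable_compose[OF meas(1) that] by simp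
  qed
  define \<psi> where "\<psi> w = R' (\<phi> (R w))" for w
  define \<psi>' where "\<psi>' w v = R' (\<phi>' (R w) (R v))" for w v
  have img: "\<psi> ` (R' ` T) = R' ` (\<phi> ` T)" by (auto simp: \<psi>_def image_image)
  have "(\<integral>\<^sup>+w. ennreal (indicator (R' ` T) w * J (R w)) \<partial>lborel) =
     (\<integral>\<^sup>+w. ennreal (indicator (\<psi> ` (R' ` T)) w * J' (R w)) \<partial>lborel)"
  proof (rule nn_integral_change_of_variables_wellorder[where \<phi>' = \<psi>'])
    have "R' ` T = R -` T" by (auto simp: image_iff) (metis RR(2))
    then show "R' ` T \<in> sets borel" using meas(1) T by (metis measurable_sets_borel)
    show "(\<psi> has_derivative \<psi>' w) (at w)" if "w \<in> R' ` T" for w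
    proof -
      have "R w \<in> T" using that by auto
      have "((\<lambda>w. \<phi> (R w)) has_derivative (\<lambda>v. \<phi>' (R w) (R v))) (at w)"
        using diff_chain_at[OF bounded_linear_imp_has_derivative[OF bl(1)] \<phi>[OF \<open>R w \<in> T\<close>]] by (simp add: o_def)
      then show ?thesis unfolding \<psi>_def \<psi>'_def by (rule bounded_linear.has_derivative[OF bl(2)])
    qed
    show "inj_on \<psi> (R' ` T)"
    proof (rule inj_onI)
      fix a b assume *: "a \<in> R' ` T" "b \<in> R' ` T" "\<psi> a = \<psi> b"
      have "R (\<psi> a) = R (\<psi> b)" using * by simp
      then have "\<phi> (R a) = \<phi> (R b)" by (simp add: \<psi>_def)
      moreover have "R a \<in> T" "R b \<in> T" using * by auto
      ultimately have "R a = R b" using inj by (simp add: inj_on_def)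
      then show "a = b" by (metis RR(2))
    qed
    show "(\<lambda>w. indicator (R' ` T) w * J (R w)) \<in> borel_measurable borel" by (rule ind[OF J(1)])
    show "(\<lambda>w. indicator (\<psi> ` R' ` T) w * J' (R w)) \<in> borel_measurable borel"
      unfolding img by (rule ind[OF J'(1)])
    show "J (R w) = \<bar>det (matrix (\<psi>' w))\<bar> * J' (R (\<psi> w))" if "w \<in> R' ` T" for w
    proof -
      have w: "R w \<in> T" using that by auto
      have ax: "R (axis j 1) = axis (h j) 1" for j
      proof -
        have "inv h i = j \<longleftrightarrow> i = h j" for i using bij_inv_eq_iff[OF h, of j i] by auto
        then show ?thesis by (simp add: R_def vec_reindex_def vec_eq_iff axis_def)
      qed
      have "matrix (\<psi>' w) = (\<chi> i j. matrix (\<phi>' (R w)) $ h i $ h j)"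
        unfolding matrix_def \<psi>'_def ax by (simp add: R'_def vec_reindex_def)
      then have "det (matrix (\<psi>' w)) = det (matrix (\<phi>' (R w)))" using det_reindex[OF h] by simp
      then show ?thesis using eq[OF w] by (simp add: \<psi>_def)
    qed
  qed (use J J' in auto)
  then show ?thesis unfolding int[OF J(1)] int[OF J'(1)] img .
qed

section \<open>Riemannian volume of a compact submanifold\<close>

definition gram :: "(real ^ 'n \<Rightarrow> 'e::euclidean_space) \<Rightarrow> real ^ 'n \<Rightarrow> real ^ 'n ^ 'n" where
  "gram F x = (\<chi> i j. dd F x (axis i 1) \<bullet> dd F x (axis j 1))"

definition density_of :: "(real ^ 'n \<Rightarrow> 'e::euclidean_space) \<Rightarrow> real ^ 'n \<Rightarrow> real" where
  "density_of F x = sqrt (det (gram F x))"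

text \<open>\<open>S\<close> may reach beyond the chart: with \<open>S = M\<close> this is the
  volume of the whole chart of \<open>M\<close>, which is how finiteness is expressed below.\<close>

definition chart_volume :: "(real ^ 'n) set \<Rightarrow> (real ^ 'n \<Rightarrow> 'e::euclidean_space) \<Rightarrow> 'e set \<Rightarrow> ennreal" where
  "chart_volume V F S = (\<integral>\<^sup>+x. ennreal (indicator {x \<in> V. F x \<in> S} x * density_of F x) \<partial>lborel)"

context immersed_chart
begin

lemma metric_matrix: 
  assumes x: "x \<in> V"
  shows "metric x (\<Sum>k\<in>UNIV. a k *\<^sub>R axis k 1) (\<Sum>l\<in>UNIV. b l *\<^sub>R axis l 1) =
    (\<Sum>k\<in>UNIV. \<Sum>l\<in>UNIV. a k * b l * gram F x $ k $ l)"
  unfolding metric_def gram_def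
  by (simp add: linear_sum[OF linL[OF x]] linear_scale[OF linL[OF x]] inner_sum_left inner_sum_right
      sum_distrib_left mult_ac) (rule sum.swap)

lemma gram_congruence:
  fixes D :: "real ^ 'n ^ 'n"
  assumes x: "x \<in> V"
  shows "(\<chi> i j. metric x (column i D) (column j D)) = transpose D ** gram F x ** D"
proof -
  have col: "column i D = (\<Sum>k\<in>UNIV. D $ k $ i *\<^sub>R axis k 1)" for i
    using vec_expand[of "column i D"] by (simp add: column_def)
  have "metric x (column i D) (column j D) = (transpose D ** gram F x ** D) $ i $ j" for i j
    unfolding col metric_matrix[OF x]
    by (subst sum.swap)
       (simp add: matrix_matrix_mult_def Finite_Cartesian_Product.transpose_def sum_distrib_right sum_distrib_left mult_ac)
  then show ?thesis by (simp add: vec_eq_iff)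
qed

text \<open>Let the columns of \<open>D\<close> be an orthonormal basis for the metric. Then
  \<open>transpose D ** gram F x ** D\<close> is the identity, so the determinant times the square
  of \<open>det D\<close> is 1.\<close>

lemma det_gram_pos:
  assumes x: "x \<in> V"
  shows "0 < det (gram F x)"
proof -
  let ?e = "onb (metric x)"
  obtain h :: "'n \<Rightarrow> nat" where h: "bij_betw h UNIV {..<CARD('n)}"
    using ex_bij_betw_finite_nat[of "UNIV :: 'n set"] by (auto simp: atLeast0LessThan)
  define D :: "real ^ 'n ^ 'n" where "D = (\<chi> i k. (?e ! h k) $ i)"
  have col: "column k D = ?e ! h k" for k by (simp add: D_def column_def vec_eq_iff)
  have "h i < CARD('n)" for i using h by (auto simp: bij_betw_def)
  moreover have "h i = h j \<longleftrightarrow> i = j" for i j using h by (auto simp: bij_betw_def inj_def)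
  ultimately have "metric x (column i D) (column j D) = (if i = j then 1 else 0)" for i j
    unfolding col using onb_inner[OF metric_inner_product[OF x], of "h i" "h j"] by simp
  then have "transpose D ** gram F x ** D = mat 1"
    unfolding gram_congruence[OF x, symmetric] by (simp add: mat_def vec_eq_iff)
  then have "det (transpose D ** gram F x ** D) = 1" by simp
  then have "det D * det D * det (gram F x) = 1" by (simp add: det_mul mult_ac)
  then show ?thesis
    by (metis mult_eq_0_iff not_square_less_zero linorder_neqE_linordered_idom mult_pos_neg zero_less_one less_asym)
qed

lemma density_pos: "x \<in> V \<Longrightarrow> 0 < density_of F x"
  unfolding density_of_def using det_gram_pos by simp

lemma continuous_density: "continuous_on V (density_of F)"
proof -
  have "(\<lambda>y. det (gram F y)) differentiable (at x)" if "x \<in> V" for x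
    unfolding gram_def by (rule differentiable_det) (simp add: differentiable_inner diffL[OF that])
  then have "continuous_on V (\<lambda>y. det (gram F y))"
    by (intro continuous_at_imp_continuous_on ballI differentiable_imp_continuous_within)
  then show ?thesis unfolding density_of_def[abs_def] by (intro continuous_on_real_sqrt)
qed

lemma chart_preimage_borel:
  assumes "S \<in> sets borel"
  shows "{x \<in> V. F x \<in> S} \<in> sets borel"
proof -
  have "F \<in> borel_measurable (restrict_space borel V)"
    by (rule borel_measurable_continuous_on_restrict[OF smooth_on_continuous[OF smoothF]])
  from measurable_sets[OF this assms] have "F -` S \<inter> V \<in> sets (restrict_space borel V)"
    by (simp add: space_restrict_space)
  moreover have "V \<in> sets borel" using openV by simp
  ultimately have "F -` S \<inter> V \<in> sets borel" by (simp add: sets_restrict_space_iff)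
  then show ?thesis by (simp add: vimage_def Int_def conj_commute)
qed

lemma density_measurable:
  assumes "S \<in> sets borel"
  shows "(\<lambda>x. indicator {x \<in> V. F x \<in> S} x * density_of F x) \<in> borel_measurable borel"
proof -
  have "(\<lambda>x. indicator V x *\<^sub>R density_of F x) \<in> borel_measurable borel"
    using openV continuous_density by (intro borel_measurable_continuous_on_indicator) auto
  then have "(\<lambda>x. indicator {x \<in> V. F x \<in> S} x * (indicator V x *\<^sub>R density_of F x)) \<in> borel_measurable borel"
    using chart_preimage_borel[OF assms] by (intro borel_measurable_times borel_measurable_indicator)
  also have "(\<lambda>x. indicator {x \<in> V. F x \<in> S} x * (indicator V x *\<^sub>R density_of F x)) =
     (\<lambda>x. indicator {x \<in> V. F x \<in> S} x * density_of F x)"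
    by (auto simp: indicator_def)
  finally show ?thesis .
qed

lemma chart_volume_UN:
  assumes "\<And>i. S i \<in> sets borel" "disjoint_family S"
  shows "chart_volume V F (\<Union>i::nat. S i) = (\<Sum>i. chart_volume V F (S i))"
proof -
  have "ennreal (indicator {x \<in> V. F x \<in> (\<Union>i. S i)} x * density_of F x) =
      (\<Sum>i. ennreal (indicator {x \<in> V. F x \<in> S i} x * density_of F x))" for x
  proof (cases "x \<in> V \<and> F x \<in> (\<Union>i. S i)")
    case True
    then obtain i where i: "F x \<in> S i" by blast
    then have "F x \<notin> S j" if "j \<noteq> i" for j
      using assms(2) that unfolding disjoint_family_on_def by blast
    then have "(\<Sum>j. ennreal (indicator {x \<in> V. F x \<in> S j} x * density_of F x)) =
        (\<Sum>j\<in>{i}. ennreal (indicator {x \<in> V. F x \<in> S j} x * density_of F x))"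
      by (intro suminf_finite) (auto simp: indicator_def)
    then show ?thesis using True i by (simp add: indicator_def)
  next
    case False
    then show ?thesis by (auto simp: indicator_def)
  qed
  then show ?thesis unfolding chart_volume_def
    using density_measurable[OF assms(1)] by (subst nn_integral_suminf[symmetric]) auto
qed

lemma chart_volume_mono:
  "S \<subseteq> S' \<Longrightarrow> chart_volume V F S \<le> chart_volume V F S'"
  unfolding chart_volume_def
  using density_pos by (intro nn_integral_mono ennreal_leI) (auto simp: indicator_def less_imp_le)

lemma chart_volume_pos:
  assumes "V \<noteq> {}" "F ` V \<subseteq> S" "S \<in> sets borel"
  shows "0 < chart_volume V F S"
proof (rule ccontr)
  assume "\<not> ?thesis"
  then have "(\<integral>\<^sup>+x. ennreal (indicator {x \<in> V. F x \<in> S} x * density_of F x) \<partial>lborel) = 0"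
    by (simp add: chart_volume_def)
  then have "AE x in lborel. ennreal (indicator {x \<in> V. F x \<in> S} x * density_of F x) = 0"
    using density_measurable[OF assms(3)] by (subst (asm) nn_integral_0_iff_AE) auto
  then have "AE x in lborel. x \<notin> V"
    by (rule AE_mp) (use density_pos assms(2) in \<open>fastforce intro!: AE_I2 simp: indicator_def ennreal_eq_0_iff\<close>)
  then have "V \<in> null_sets lborel" using openV by (subst AE_iff_null_sets) auto
  then have "negligible V" using negligible_iff_null_sets null_sets_completionI by blast
  then show False using open_not_negligible openV assms(1) by blast
qed

end

context chart_change
begin

text \<open>The two Gram matrices are congruent by the Jacobian matrix, whose determinant enters
  squared and leaves the square root as an absolute value.\<close>

lemma density_eq:
  assumes x: "x \<in> U"
  shows "density_of F x = \<bar>det (matrix (dd \<phi> x))\<bar> * density_of K (\<phi> x)"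
proof -
  have "gram F x = (\<chi> i j. C.metric (\<phi> x) (column i (matrix (dd \<phi> x))) (column j (matrix (dd \<phi> x))))"
    unfolding gram_def using metric_eq[OF x] unfolding A.metric_def
    by (simp add: column_def matrix_def vec_lambda_eta)
  also have "\<dots> = transpose (matrix (dd \<phi> x)) ** gram K (\<phi> x) ** matrix (dd \<phi> x)"
    by (rule C.gram_congruence[OF \<phi>W[OF x]])
  finally have "det (gram F x) = (det (matrix (dd \<phi> x)))\<^sup>2 * det (gram K (\<phi> x))"
    by (simp add: det_mul power2_eq_square mult_ac)
  then show ?thesis unfolding density_of_def by (simp add: real_sqrt_mult)
qed

end

section \<open>Charts of a submanifold\<close>

lemma sub_params_chart:
  assumes "(V, \<psi>) \<in> sub_params M"
  shows "immersed_chart V \<psi>"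
  using assms unfolding sub_params_def by unfold_locales auto

lemma sub_paramsD:
  assumes "(V, \<psi>) \<in> sub_params M"
  shows "open V" "openin (top_of_set M) (\<psi> ` V)" "\<psi> ` V \<subseteq> M" "continuous_on V \<psi>" "inj_on \<psi> V"
    "continuous_on (\<psi> ` V) (inv_into V \<psi>)"
proof -
  have o: "openin (top_of_set M) (\<psi> ` V)" and h: "homeomorphic_map (top_of_set V) (top_of_set (\<psi> ` V)) \<psi>"
    using assms by (auto simp: sub_params_def)
  show "open V" "openin (top_of_set M) (\<psi> ` V)" using assms by (auto simp: sub_params_def)
  show "\<psi> ` V \<subseteq> M" using openin_imp_subset[OF o] .
  show "continuous_on V \<psi>" using assms by (auto simp: sub_params_def intro: smooth_on_continuous)
  show inj: "inj_on \<psi> V" using homeomorphic_imp_injective_map[OF h] by simp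
  obtain k where "homeomorphic_maps (top_of_set V) (top_of_set (\<psi> ` V)) \<psi> k"
    using h homeomorphic_map_maps by blast
  then have k: "continuous_on (\<psi> ` V) k" "\<And>x. x \<in> V \<Longrightarrow> k (\<psi> x) = x"
    unfolding homeomorphic_maps_def by auto
  have "k p = inv_into V \<psi> p" if "p \<in> \<psi> ` V" for p
    using that k(2) inj by (auto simp: inv_into_f_f)
  then show "continuous_on (\<psi> ` V) (inv_into V \<psi>)" using k(1) continuous_on_cong by metis
qed

lemma chart_change_sub_params:
  fixes V W :: "(real ^ 'n) set"
  assumes c: "(V, \<psi>) \<in> sub_params M" and d: "(W, \<kappa>) \<in> sub_params M"
  shows "chart_change V \<psi> W \<kappa> {x \<in> V. \<psi> x \<in> \<kappa> ` W} (inv_into W \<kappa> \<circ> \<psi>)"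
proof -
  interpret A: immersed_chart V \<psi> by (rule sub_params_chart[OF c])
  interpret C: immersed_chart W \<kappa> by (rule sub_params_chart[OF d])
  show ?thesis
  proof unfold_locales
    have "openin (top_of_set V) (V \<inter> \<psi> -` (\<kappa> ` W))"
      using sub_paramsD(4)[OF c] sub_paramsD(3)[OF c] sub_paramsD(2)[OF d]
      by (intro continuous_openin_preimage[where T = M]) auto
    then show "open {x \<in> V. \<psi> x \<in> \<kappa> ` W}"
      using sub_paramsD(1)[OF c] openin_open_trans by (auto simp: vimage_def Int_def)
    show "{x \<in> V. \<psi> x \<in> \<kappa> ` W} \<subseteq> V" by auto
    show "(inv_into W \<kappa> \<circ> \<psi>) x \<in> W" "\<kappa> ((inv_into W \<kappa> \<circ> \<psi>) x) = \<psi> x" if "x \<in> {x \<in> V. \<psi> x \<in> \<kappa> ` W}" for x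
      using that by (auto simp: inv_into_into f_inv_into_f)
    show "continuous_on {x \<in> V. \<psi> x \<in> \<kappa> ` W} (inv_into W \<kappa> \<circ> \<psi>)"
    proof (rule continuous_on_compose)
      show "continuous_on {x \<in> V. \<psi> x \<in> \<kappa> ` W} \<psi>"
        using sub_paramsD(4)[OF c] by (rule continuous_on_subset) auto
      show "continuous_on (\<psi> ` {x \<in> V. \<psi> x \<in> \<kappa> ` W}) (inv_into W \<kappa>)"
        using sub_paramsD(6)[OF d] by (rule continuous_on_subset) auto
    qed
  qed
qed

lemma chart_volume_eq:
  fixes V W :: "(real ^ 'n) set"
  assumes c: "(V, \<psi>) \<in> sub_params M" and d: "(W, \<kappa>) \<in> sub_params M"
    and S: "S \<in> sets borel" "S \<subseteq> \<psi> ` V" "S \<subseteq> \<kappa> ` W"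
  shows "chart_volume V \<psi> S = chart_volume W \<kappa> S"
proof -
  interpret chart_change V \<psi> W \<kappa> "{x \<in> V. \<psi> x \<in> \<kappa> ` W}" "inv_into W \<kappa> \<circ> \<psi>"
    by (rule chart_change_sub_params[OF c d])
  let ?\<phi> = "inv_into W \<kappa> \<circ> \<psi>"
  define T where "T = {x \<in> V. \<psi> x \<in> S}"
  have TU: "x \<in> {x \<in> V. \<psi> x \<in> \<kappa> ` W}" if "x \<in> T" for x using that S by (auto simp: T_def)
  have img: "?\<phi> ` T = {y \<in> W. \<kappa> y \<in> S}"
  proof safe
    fix x assume x: "x \<in> T"
    then show "?\<phi> x \<in> W" using \<phi>W TU by blast
    show "\<kappa> (?\<phi> x) \<in> S" using x K\<phi>[OF TU[OF x]] by (simp add: T_def)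
  next
    fix y assume y: "y \<in> W" "\<kappa> y \<in> S"
    then obtain x where x: "x \<in> V" "\<psi> x = \<kappa> y" using S by force
    then have "?\<phi> x = y" using y sub_paramsD(5)[OF d] by simp
    then show "y \<in> ?\<phi> ` T" using x y by (intro image_eqI[of _ _ x]) (auto simp: T_def)
  qed
  \<comment> \<open>Absolute values of the densities are used because the change of variables asks
    for functions nonnegative everywhere, while positivity is known on the domains of the
    charts.\<close>
  have pos: "\<bar>density_of \<psi> x\<bar> = density_of \<psi> x" if "x \<in> V" for x using A.density_pos[OF that] by simp
  have "(\<integral>\<^sup>+x. ennreal (indicator T x * \<bar>density_of \<psi> x\<bar>) \<partial>lborel) =
     (\<integral>\<^sup>+y. ennreal (indicator (?\<phi> ` T) y * \<bar>density_of \<kappa> y\<bar>) \<partial>lborel)"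
  proof (rule nn_integral_change_of_variables)
    show "T \<in> sets borel" unfolding T_def by (rule A.chart_preimage_borel[OF S(1)])
    show "(?\<phi> has_derivative dd ?\<phi> x) (at x)" if "x \<in> T" for x
      by (rule has_derivative_dd[OF differentiableI[OF \<phi>_has_derivative[OF TU[OF that]]]])
    show "inj_on ?\<phi> T"
    proof (rule inj_onI)
      fix a b assume "a \<in> T" "b \<in> T" "?\<phi> a = ?\<phi> b"
      then have "\<psi> a = \<psi> b" using K\<phi> TU by metis
      then show "a = b" using sub_paramsD(5)[OF c] \<open>a \<in> T\<close> \<open>b \<in> T\<close> by (auto simp: T_def inj_on_def)
    qed
    have "(\<lambda>x. \<bar>indicator T x * density_of \<psi> x\<bar>) \<in> borel_measurable borel"
      unfolding T_def using A.density_measurable[OF S(1)] by (rule borel_measurable_abs)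
    then show "(\<lambda>x. indicator T x * \<bar>density_of \<psi> x\<bar>) \<in> borel_measurable borel" by (simp add: abs_mult)
    have "(\<lambda>x. \<bar>indicator (?\<phi> ` T) x * density_of \<kappa> x\<bar>) \<in> borel_measurable borel"
      unfolding img using C.density_measurable[OF S(1)] by (rule borel_measurable_abs)
    then show "(\<lambda>x. indicator (?\<phi> ` T) x * \<bar>density_of \<kappa> x\<bar>) \<in> borel_measurable borel" by (simp add: abs_mult)
    show "\<bar>density_of \<psi> x\<bar> = \<bar>det (matrix (dd ?\<phi> x))\<bar> * \<bar>density_of \<kappa> (?\<phi> x)\<bar>" if "x \<in> T" for x
      using density_eq[OF TU[OF that]] by (simp add: abs_mult)
  qed auto
  moreover have "indicator T x * \<bar>density_of \<psi> x\<bar> = indicator T x * density_of \<psi> x" for x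
    using A.density_pos[of x] by (auto simp: indicator_def T_def)
  moreover have "indicator (?\<phi> ` T) y * \<bar>density_of \<kappa> y\<bar> = indicator (?\<phi> ` T) y * density_of \<kappa> y" for y
    using C.density_pos[of y] unfolding img by (auto simp: indicator_def)
  ultimately show ?thesis unfolding chart_volume_def T_def[symmetric] img by simp
qed

lemma sub_paramsI:
  assumes "open V" "smooth_on V \<psi>" "\<And>x. x \<in> V \<Longrightarrow> inj (dd \<psi> x)" "openin (top_of_set M) (\<psi> ` V)"
    "inj_on \<psi> V" "continuous_on (\<psi> ` V) (inv_into V \<psi>)"
  shows "(V, \<psi>) \<in> sub_params M"
proof -
  have "homeomorphic_maps (top_of_set V) (top_of_set (\<psi> ` V)) \<psi> (inv_into V \<psi>)"
    unfolding homeomorphic_maps_def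
    using smooth_on_continuous[OF assms(2)] assms(5,6)
    by (auto simp: inv_into_f_f f_inv_into_f inv_into_into)
  then show ?thesis using assms unfolding sub_params_def homeomorphic_map_maps by blast
qed

text \<open>This allows a chart to be shrunk to a ball whose closure lies in the domain, on which
  the density is bounded.\<close>

lemma sub_params_restrict:
  assumes c: "(V, \<psi>) \<in> sub_params M" and W: "open W" "W \<subseteq> V"
  shows "(W, \<psi>) \<in> sub_params M"
proof (rule sub_paramsI)
  interpret immersed_chart V \<psi> by (rule sub_params_chart[OF c])
  note D = sub_paramsD[OF c]
  show "open W" by fact
  show "smooth_on W \<psi>" using smoothF W smooth_on_subset by blast
  show "inj (dd \<psi> x)" if "x \<in> W" for x using injF that W by blast
  show "inj_on \<psi> W" using D(5) W inj_on_subset by blast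
  have inv: "inv_into W \<psi> p = inv_into V \<psi> p" if "p \<in> \<psi> ` W" for p
    using that D(5) \<open>inj_on \<psi> W\<close> W by (auto simp: inv_into_f_f subset_iff)
  have "continuous_on (\<psi> ` W) (inv_into V \<psi>)"
    using D(6) by (rule continuous_on_subset) (use W in auto)
  then show "continuous_on (\<psi> ` W) (inv_into W \<psi>)"
    using inv by (simp cong: continuous_on_cong)
  have "\<psi> ` W = \<psi> ` V \<inter> inv_into V \<psi> -` W"
    using W D(5) by (auto simp: inv_into_f_f subset_iff)
  also have "openin (top_of_set (\<psi> ` V)) \<dots>"
    by (rule continuous_openin_preimage_gen[OF D(6) W(1)])
  finally show "openin (top_of_set M) (\<psi> ` W)"
    using D(2) openin_trans by blast
qed

lemma sub_params_scale:
  assumes c: "(V, \<psi>) \<in> sub_params M" and r: "r \<noteq> 0"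
  shows "(V, \<lambda>x. r *\<^sub>R \<psi> x) \<in> sub_params ((\<lambda>p. r *\<^sub>R p) ` M)"
proof (rule sub_paramsI)
  interpret immersed_chart V \<psi> by (rule sub_params_chart[OF c])
  note D = sub_paramsD[OF c]
  have bl: "bounded_linear (\<lambda>p :: 'b. r *\<^sub>R p)" by (rule bounded_linear_scaleR_right)
  show "open V" by (rule D)
  show "smooth_on V (\<lambda>x. r *\<^sub>R \<psi> x)" by (rule smooth_on_bounded_linear[OF D(1) bl smoothF])
  show "inj (dd (\<lambda>x. r *\<^sub>R \<psi> x) x)" if "x \<in> V" for x
    using injF[OF that] r dd_bounded_linear[OF bl diffF[OF that]] by (simp add: inj_def)
  show inj: "inj_on (\<lambda>x. r *\<^sub>R \<psi> x) V" using D(5) r by (simp add: inj_on_def)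
  obtain T where T: "open T" "\<psi> ` V = M \<inter> T" using D(2) by (auto simp: openin_open)
  have "(\<lambda>x. r *\<^sub>R \<psi> x) ` V = (\<lambda>p. r *\<^sub>R p) ` M \<inter> (\<lambda>p. r *\<^sub>R p) ` T"
    using T(2) r by (auto simp: image_iff set_eq_iff)
  then show "openin (top_of_set ((\<lambda>p. r *\<^sub>R p) ` M)) ((\<lambda>x. r *\<^sub>R \<psi> x) ` V)"
    using open_scaling[OF r T(1)] by (auto simp: openin_open)
  have "inv_into V (\<lambda>x. r *\<^sub>R \<psi> x) q = inv_into V \<psi> ((1 / r) *\<^sub>R q)" if "q \<in> (\<lambda>x. r *\<^sub>R \<psi> x) ` V" for q
    using that r D(5) inj by (auto simp: inv_into_f_f) (metis inv_into_f_f)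
  moreover have "continuous_on ((\<lambda>x. r *\<^sub>R \<psi> x) ` V) (\<lambda>q. inv_into V \<psi> ((1 / r) *\<^sub>R q))"
    by (rule continuous_on_compose2[OF D(6)]) (use r in \<open>auto intro!: continuous_intros\<close>)
  ultimately show "continuous_on ((\<lambda>x. r *\<^sub>R \<psi> x) ` V) (inv_into V (\<lambda>x. r *\<^sub>R \<psi> x))"
    by (simp cong: continuous_on_cong)
qed

text \<open>The parameter \<open>d\<close> carries the dimension: it makes the coordinate type
  \<open>'n\<close> part of the data, beside the point set \<open>M\<close>.\<close>

locale compact_submanifold =
  fixes d :: "'n::finite itself" and M :: "'e::euclidean_space set"
  assumes compactM: "compact M" and submanifoldM: "submanifold TYPE('n) M"
begin

section \<open>Finite atlases and the Riemannian volume of a compact submanifold\<close>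

definition params :: "('n, 'e) param set" where
  "params = sub_params M"

lemma M_nonempty: "M \<noteq> {}"
  using submanifoldM by (simp add: submanifold_def)

lemma params_cover: "(\<Union>c\<in>params. snd c ` fst c) = M"
  using submanifoldM by (simp add: submanifold_def params_def case_prod_unfold)

lemma chart: "c \<in> params \<Longrightarrow> immersed_chart (fst c) (snd c)"
  using sub_params_chart[of "fst c" "snd c" M] by (simp add: params_def)

lemma borelM: "M \<in> sets borel"
  using compactM by (simp add: compact_imp_closed)

lemma image_borel: "c \<in> params \<Longrightarrow> snd c ` fst c \<in> sets borel"
proof -
  assume "c \<in> params"
  then have "openin (top_of_set M) (snd c ` fst c)"
    using sub_paramsD(2)[of "fst c" "snd c" M] by (simp add: params_def)
  then obtain T where "open T" "snd c ` fst c = M \<inter> T" by (auto simp: openin_open)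
  then show ?thesis using borelM by auto
qed

text \<open>The density of a chart can be unbounded towards the boundary of its domain. On a ball
  whose closed ball lies in the domain it is bounded by compactness.\<close>

lemma chart_finite_volume:
  assumes p: "p \<in> M"
  obtains c where "c \<in> params" "p \<in> snd c ` fst c" "chart_volume (fst c) (snd c) M < \<infinity>"
proof -
  have "p \<in> (\<Union>c\<in>params. snd c ` fst c)" using p params_cover by simp
  then obtain c\<^sub>0 x where c0: "c\<^sub>0 \<in> params" "x \<in> fst c\<^sub>0" "p = snd c\<^sub>0 x" by blast
  obtain V \<psi> where "c\<^sub>0 = (V, \<psi>)" by (cases c\<^sub>0)
  with c0 have c: "(V, \<psi>) \<in> sub_params M" "x \<in> V" "p = \<psi> x" by (simp_all add: params_def)
  interpret immersed_chart V \<psi> by (rule sub_params_chart[OF c(1)])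
  obtain r where r: "0 < r" "cball x r \<subseteq> V"
    using bspec[OF iffD1[OF open_contains_cball openV] c(2)] by (elim exE conjE)
  have W: "ball x r \<subseteq> V" using r ball_subset_cball by blast
  have in_params: "(ball x r, \<psi>) \<in> sub_params M" by (rule sub_params_restrict[OF c(1) open_ball W])
  have "compact (density_of \<psi> ` cball x r)"
    by (rule compact_continuous_image[OF continuous_on_subset[OF continuous_density r(2)] compact_cball])
  then have "bdd_above (density_of \<psi> ` cball x r)"
    by (intro bounded_imp_bdd_above compact_imp_bounded)
  then obtain C where "\<forall>z\<in>density_of \<psi> ` cball x r. z \<le> C"
    unfolding bdd_above_def by (elim exE)
  then have C: "density_of \<psi> y \<le> C" if "y \<in> cball x r" for y using that by simp
  have "chart_volume (ball x r) \<psi> M \<le> (\<integral>\<^sup>+y. ennreal C * indicator (cball x r) y \<partial>lborel)"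
    unfolding chart_volume_def using C
    by (intro nn_integral_mono) (simp add: indicator_def ennreal_leI)
  also have "\<dots> = ennreal C * emeasure lborel (cball x r)" by (simp add: nn_integral_cmult_indicator)
  also have "\<dots> < \<infinity>"
    using emeasure_bounded_finite[of "cball x r"] by (simp add: ennreal_mult_less_top)
  finally have finite: "chart_volume (ball x r) \<psi> M < \<infinity>" .
  show ?thesis
  proof (rule that)
    show "(ball x r, \<psi>) \<in> params" using in_params by (simp add: params_def)
    show "p \<in> snd (ball x r, \<psi>) ` fst (ball x r, \<psi>)" using c(3) r(1) by simp
    show "chart_volume (fst (ball x r, \<psi>)) (snd (ball x r, \<psi>)) M < \<infinity>" using finite by simp
  qed
qed

lemma finite_atlas:
  "\<exists>(cs :: nat \<Rightarrow> ('n, 'e) param) m.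
     (\<forall>i<m. cs i \<in> params \<and> chart_volume (fst (cs i)) (snd (cs i)) M < \<infinity>) \<and>
     (\<Union>i<m. snd (cs i) ` fst (cs i)) = M"
proof -
  define K where "K = {c \<in> params. chart_volume (fst c) (snd c) M < \<infinity>}"
  have op: "\<forall>U\<in>(\<lambda>c. snd c ` fst c) ` K. openin (top_of_set M) U"
  proof
    fix U assume "U \<in> (\<lambda>c. snd c ` fst c) ` K"
    then obtain c where "c \<in> K" "U = snd c ` fst c" by (elim imageE)
    then show "openin (top_of_set M) U"
      using sub_paramsD(2)[of "fst c" "snd c" M] by (simp add: K_def params_def)
  qed
  have cov: "M \<subseteq> \<Union>((\<lambda>c. snd c ` fst c) ` K)"
  proof
    fix p assume "p \<in> M"
    then obtain c where "c \<in> params" "p \<in> snd c ` fst c" "chart_volume (fst c) (snd c) M < \<infinity>"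
      by (rule chart_finite_volume)
    then show "p \<in> \<Union>((\<lambda>c. snd c ` fst c) ` K)" by (intro UN_I[of c]) (simp_all add: K_def)
  qed
  have "\<exists>D\<subseteq>(\<lambda>c. snd c ` fst c) ` K. finite D \<and> M \<subseteq> \<Union>D"
    using compactM[unfolded compact_eq_openin_cover, rule_format, OF conjI[OF op cov]] .
  then obtain D where D: "D \<subseteq> (\<lambda>c. snd c ` fst c) ` K" "finite D" "M \<subseteq> \<Union>D"
    by (elim exE conjE)
  then obtain K' where "K' \<subseteq> K" "finite K'" "D = (\<lambda>c. snd c ` fst c) ` K'"
    using finite_subset_image[OF D(2,1)] by (elim exE conjE)
  then have K': "K' \<subseteq> K" "finite K'" "M \<subseteq> (\<Union>c\<in>K'. snd c ` fst c)" using D(3) by simp_all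
  obtain m and cs :: "nat \<Rightarrow> ('n, 'e) param" where cs: "K' = cs ` {i. i < m}"
    using finite_imp_nat_seg_image_inj_on[OF K'(2)] by (elim exE conjE)
  have csK: "cs i \<in> K" if "i < m" for i
    using K'(1) that unfolding cs by (simp add: image_subset_iff)
  have sub: "snd c ` fst c \<subseteq> M" if "c \<in> K" for c
    using that params_cover by (simp add: K_def) blast
  have "(\<Union>i<m. snd (cs i) ` fst (cs i)) = M"
  proof
    show "(\<Union>i<m. snd (cs i) ` fst (cs i)) \<subseteq> M"
      using csK by (intro UN_least sub) simp
    show "M \<subseteq> (\<Union>i<m. snd (cs i) ` fst (cs i))"
      using K'(3) unfolding cs by (simp add: lessThan_def)
  qed
  then show ?thesis
    using csK by (intro exI[of _ cs] exI[of _ m]) (simp add: K_def)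
qed

text \<open>The condition under the definite description in \<open>riemannian_volume\<close>, with
  its sigma-algebra identified as the Borel subsets of \<open>M\<close>. Existence and uniqueness
  are proved for this predicate.\<close>

definition is_volume :: "'e measure \<Rightarrow> bool" where
  "is_volume \<mu> \<longleftrightarrow> space \<mu> = M \<and> sets \<mu> = sets (restrict_space borel M) \<and>
     (\<forall>c\<in>params. \<forall>S\<in>sets \<mu>. S \<subseteq> snd c ` fst c \<longrightarrow> emeasure \<mu> S = chart_volume (fst c) (snd c) S)"

lemma sets_restrict: "S \<in> sets (restrict_space borel M) \<longleftrightarrow> S \<subseteq> M \<and> S \<in> sets borel"
  using borelM by (subst sets_restrict_space_iff) auto

lemma is_volumeD:
  "is_volume \<mu> \<Longrightarrow> c \<in> params \<Longrightarrow> S \<in> sets \<mu> \<Longrightarrow> S \<subseteq> snd c ` fst c \<Longrightarrow>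
    emeasure \<mu> S = chart_volume (fst c) (snd c) S"
  by (simp add: is_volume_def)

text \<open>Charts overlap, so volumes are added over disjoint Borel pieces, each contained in one
  chart. \<open>D\<close> is an infinite sequence because it comes from \<open>disjointed\<close>;
  its first \<open>m\<close> members cover \<open>M\<close>.\<close>

definition chart_partition :: "nat \<Rightarrow> (nat \<Rightarrow> ('n, 'e) param) \<Rightarrow> (nat \<Rightarrow> 'e set) \<Rightarrow> bool" where
  "chart_partition m cs D \<longleftrightarrow>
     (\<forall>i<m. cs i \<in> params \<and> chart_volume (fst (cs i)) (snd (cs i)) M < \<infinity> \<and> D i \<subseteq> snd (cs i) ` fst (cs i)) \<and>
     (\<forall>i. D i \<in> sets borel) \<and> disjoint_family D \<and> (\<Union>i<m. D i) = M"

lemma chart_partitionD: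
  assumes "chart_partition m cs D"
  shows "i < m \<Longrightarrow> cs i \<in> params" "i < m \<Longrightarrow> chart_volume (fst (cs i)) (snd (cs i)) M < \<infinity>"
    "i < m \<Longrightarrow> D i \<subseteq> snd (cs i) ` fst (cs i)" "D i \<in> sets borel" "disjoint_family D" "(\<Union>i<m. D i) = M"
  using assms by (simp_all add: chart_partition_def)

lemma ex_chart_partition: "\<exists>m cs D. chart_partition m cs D"
proof -
  obtain cs :: "nat \<Rightarrow> ('n, 'e) param" and m
    where cs: "\<forall>i<m. cs i \<in> params \<and> chart_volume (fst (cs i)) (snd (cs i)) M < \<infinity>"
      and cov: "(\<Union>i<m. snd (cs i) ` fst (cs i)) = M"
    using finite_atlas by (elim exE conjE)
  define E where "E i = (if i < m then snd (cs i) ` fst (cs i) else {})" for i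
  have E: "E i \<in> sets borel" for i using cs image_borel by (simp add: E_def)
  have sub: "disjointed E i \<subseteq> E i" for i by (rule disjointed_subset)
  have "range (disjointed E) \<subseteq> sets borel"
    by (rule sets.range_disjointed_sets) (use E in \<open>simp add: image_subset_iff\<close>)
  moreover have "(\<Union>i<m. disjointed E i) = M"
  proof -
    have "i < m" if "p \<in> disjointed E i" for i p
      using subsetD[OF sub that] by (simp add: E_def split: if_splits)
    then have "(\<Union>i<m. disjointed E i) = (\<Union>i. disjointed E i)" by blast
    also have "\<dots> = (\<Union>i. E i)" by (rule UN_disjointed_eq)
    also have "\<dots> = M" unfolding cov[symmetric] by (auto simp: E_def split: if_splits)
    finally show ?thesis .
  qed
  ultimately have "chart_partition m cs (disjointed E)"
    unfolding chart_partition_def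
  proof (intro conjI allI impI)
    show "disjointed E i \<subseteq> snd (cs i) ` fst (cs i)" if "i < m" for i
      using sub[of i] that by (simp add: E_def)
    show "disjointed E i \<in> sets borel" for i
      using \<open>range (disjointed E) \<subseteq> sets borel\<close> by (simp add: image_subset_iff)
    show "disjoint_family (disjointed E)" by (rule disjoint_family_disjointed)
  qed (use cs in simp_all)
  then show ?thesis by (intro exI)
qed

text \<open>The values of such a measure are forced by those in the charts. This yields uniqueness,
  and the right-hand side serves as the definition of the measure in the existence proof.\<close>

lemma is_volume_sum:
  assumes \<mu>: "is_volume \<mu>" and S: "S \<in> sets \<mu>" and part: "chart_partition m cs D"
  shows "emeasure \<mu> S = (\<Sum>i<m. chart_volume (fst (cs i)) (snd (cs i)) (S \<inter> D i))"
proof -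
  note cs = chart_partitionD[OF part]
  have sets: "sets \<mu> = sets (restrict_space borel M)" using \<mu> by (simp add: is_volume_def)
  have SM: "S \<subseteq> M" "S \<in> sets borel" using S unfolding sets sets_restrict by simp_all
  have SD: "S \<inter> D i \<in> sets \<mu>" for i
    unfolding sets sets_restrict using SM cs(4)[of i] by auto
  have "S = (\<Union>i<m. S \<inter> D i)" using SM(1) unfolding cs(6)[symmetric] by blast
  then have "emeasure \<mu> S = emeasure \<mu> (\<Union>i<m. S \<inter> D i)" by simp
  also have "\<dots> = (\<Sum>i<m. emeasure \<mu> (S \<inter> D i))"
  proof (rule sum_emeasure[symmetric])
    show "(\<lambda>i. S \<inter> D i) ` {..<m} \<subseteq> sets \<mu>" using SD by (simp add: image_subset_iff)
    show "disjoint_family_on (\<lambda>i. S \<inter> D i) {..<m}"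
      using cs(5) unfolding disjoint_family_on_def by blast
  qed simp
  also have "\<dots> = (\<Sum>i<m. chart_volume (fst (cs i)) (snd (cs i)) (S \<inter> D i))"
  proof (rule sum.cong[OF refl])
    fix i assume "i \<in> {..<m}"
    then have i: "i < m" by simp
    have "S \<inter> D i \<subseteq> snd (cs i) ` fst (cs i)" using cs(3)[OF i] by blast
    then show "emeasure \<mu> (S \<inter> D i) = chart_volume (fst (cs i)) (snd (cs i)) (S \<inter> D i)"
      using \<mu> cs(1)[OF i] SD[of i] unfolding is_volume_def by simp
  qed
  finally show ?thesis .
qed

text \<open>The sum over a chart partition is countably additive because each chart volume is. That
  it gives the prescribed value in a chart outside the chosen finite family is the invariance
  \<open>chart_volume_eq\<close>.\<close>

lemma is_volume_exists: "\<exists>\<mu>. is_volume \<mu>"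
proof -
  obtain m cs D where part: "chart_partition m cs D" using ex_chart_partition by (elim exE)
  note cs = chart_partitionD[OF part]
  define f where "f S = (\<Sum>i<m. chart_volume (fst (cs i)) (snd (cs i)) (S \<inter> D i))" for S
  define \<mu> where "\<mu> = measure_of M (sets (restrict_space borel M)) f"
  have Pow: "sets (restrict_space borel M) \<subseteq> Pow M" using sets_restrict by auto
  have space: "space \<mu> = M" unfolding \<mu>_def using Pow by (simp add: space_measure_of)
  have "sigma_sets M (sets (restrict_space borel M)) = sets (restrict_space borel M)"
    using sets.sigma_sets_eq[of "restrict_space borel M"] by (simp add: space_restrict_space)
  then have sets: "sets \<mu> = sets (restrict_space borel M)"
    unfolding \<mu>_def using Pow by simp
  have em: "emeasure \<mu> S = f S" if "S \<in> sets \<mu>" for S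
  proof (rule emeasure_measure_of[OF \<mu>_def Pow _ _ that])
    show "positive (sets \<mu>) f" unfolding positive_def f_def chart_volume_def by simp
    show "countably_additive (sets \<mu>) f"
      unfolding countably_additive_def
    proof (intro allI impI)
      fix S :: "nat \<Rightarrow> 'e set" assume S: "range S \<subseteq> sets \<mu>" "disjoint_family S"
      have SB: "S i \<in> sets borel" for i
      proof -
        have "S i \<in> sets \<mu>" using S(1) by blast
        then show ?thesis unfolding sets sets_restrict by blast
      qed
      have "(\<Sum>j. f (S j)) = (\<Sum>i<m. \<Sum>j. chart_volume (fst (cs i)) (snd (cs i)) (S j \<inter> D i))"
        unfolding f_def by (rule suminf_sum) auto
      also have "\<dots> = (\<Sum>i<m. chart_volume (fst (cs i)) (snd (cs i)) (\<Union>j. S j \<inter> D i))"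
      proof (rule sum.cong[OF refl])
        fix i assume "i \<in> {..<m}"
        then interpret immersed_chart "fst (cs i)" "snd (cs i)" using chart[OF cs(1)] by simp
        have "disjoint_family (\<lambda>j. S j \<inter> D i)" using S(2) unfolding disjoint_family_on_def by blast
        then show "(\<Sum>j. chart_volume (fst (cs i)) (snd (cs i)) (S j \<inter> D i)) =
            chart_volume (fst (cs i)) (snd (cs i)) (\<Union>j. S j \<inter> D i)"
          using SB cs(4) by (intro chart_volume_UN[symmetric]) auto
      qed
      finally show "(\<Sum>j. f (S j)) = f (\<Union>j. S j)" unfolding f_def by simp
    qed
  qed
  have "emeasure \<mu> S = chart_volume (fst c) (snd c) S"
    if c: "c \<in> params" and S: "S \<in> sets \<mu>" "S \<subseteq> snd c ` fst c" for c S
  proof -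
    interpret immersed_chart "fst c" "snd c" by (rule chart[OF c])
    have SM: "S \<subseteq> M" "S \<in> sets borel" using S sets_restrict by (auto simp: sets)
    have SD: "S \<inter> D i \<in> sets borel" for i using SM(2) cs(4) by blast
    \<comment> \<open>The piece \<open>S \<inter> D i\<close> lies both in the chart
      \<open>cs i\<close> and in \<open>c\<close>, and has the same volume in either.\<close>
    have "f S = (\<Sum>i<m. chart_volume (fst c) (snd c) (S \<inter> D i))"
      unfolding f_def
    proof (rule sum.cong[OF refl])
      fix i assume "i \<in> {..<m}"
      then have i: "i < m" by simp
      show "chart_volume (fst (cs i)) (snd (cs i)) (S \<inter> D i) = chart_volume (fst c) (snd c) (S \<inter> D i)"
        using cs(1)[OF i] cs(3)[OF i] c S(2) SD
        by (intro chart_volume_eq[of _ _ M]) (auto simp: params_def)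
    qed
    \<comment> \<open>The finite partition is padded with empty sets to fit the countable form of
      \<open>chart_volume_UN\<close>.\<close>
    also have "\<dots> = (\<Sum>i. chart_volume (fst c) (snd c) (if i < m then S \<inter> D i else {}))"
      by (subst suminf_finite[of "{..<m}"]) (auto simp: chart_volume_def)
    also have "\<dots> = chart_volume (fst c) (snd c) (\<Union>i. if i < m then S \<inter> D i else {})"
      using SD cs(5) by (intro chart_volume_UN[symmetric]) (auto simp: disjoint_family_on_def)
    also have "(\<Union>i. if i < m then S \<inter> D i else {}) = S"
      using SM(1) unfolding cs(6)[symmetric] by (auto split: if_splits)
    finally show ?thesis using em[OF S(1)] by simp
  qed
  then show ?thesis using space sets unfolding is_volume_def by blast
qed

lemma is_volume_unique:
  assumes "is_volume \<mu>" "is_volume \<nu>"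
  shows "\<mu> = \<nu>"
proof (rule measure_eqI)
  show sets: "sets \<mu> = sets \<nu>" using assms by (simp add: is_volume_def)
  fix S assume S: "S \<in> sets \<mu>"
  obtain m cs D where part: "chart_partition m cs D" using ex_chart_partition by (elim exE)
  note cs = chart_partitionD[OF part]
  show "emeasure \<mu> S = emeasure \<nu> S"
    using is_volume_sum[OF assms(1) S part] is_volume_sum[OF assms(2) S[unfolded sets] part] by simp
qed

lemma sigma_sets_openin: "sigma_sets M {U. openin (top_of_set M) U} = sets (restrict_space borel M)"
proof -
  have "{U. openin (top_of_set M) U} = (\<inter>) M ` {T. open T}" by (auto simp: openin_open)
  moreover have "sigma_sets M ((\<inter>) M ` {T. open T}) = (\<inter>) M ` sigma_sets UNIV {T :: 'e set. open T}"
    using borelM by (intro sigma_sets_Int[symmetric]) (auto simp: borel_def)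
  moreover have "sigma_sets UNIV {T :: 'e set. open T} = sets borel" by (simp add: borel_def)
  ultimately show ?thesis by (simp add: sets_restrict_space)
qed

lemma riemannian_volume_is_volume:
  "is_volume (riemannian_volume (top_of_set M) params (induced_metric (\<lambda>p. p)))"
proof -
  have int: "(\<integral>\<^sup>+x. ennreal (sqrt (det (\<chi> i j. induced_metric (\<lambda>p. p) (V, \<psi>) x (axis i 1) (axis j 1))))
                      * indicator {x \<in> V. \<psi> x \<in> S} x \<partial>lborel) = chart_volume V \<psi> S" for V \<psi> S
  proof -
    have "(\<lambda>p. p) \<circ> \<psi> = \<psi>" by (simp add: o_def)
    then show ?thesis
      unfolding chart_volume_def density_of_def gram_def induced_metric_def
      by (intro nn_integral_cong) (auto simp: indicator_def)
  qed
  have "riemannian_volume (top_of_set M) params (induced_metric (\<lambda>p. p)) = (THE \<mu>. is_volume \<mu>)"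
    unfolding riemannian_volume_def is_volume_def int by (simp add: sigma_sets_openin case_prod_unfold)
  also have "is_volume \<dots>"
    by (rule theI'[OF ex_ex1I[OF is_volume_exists is_volume_unique]])
  finally show ?thesis .
qed

definition vol :: "'e measure" where
  "vol = riemannian_volume (top_of_set M) params (induced_metric (\<lambda>p. p))"

lemma is_volume_vol: "is_volume vol"
  unfolding vol_def by (rule riemannian_volume_is_volume)

lemma space_vol: "space vol = M" and sets_vol: "sets vol = sets (restrict_space borel M)"
  using is_volume_vol by (auto simp: is_volume_def)

lemma finite_vol: "emeasure vol M < \<infinity>"
proof -
  obtain m cs D where part: "chart_partition m cs D" using ex_chart_partition by (elim exE)
  note cs = chart_partitionD[OF part]
  have "M \<in> sets vol" using sets.top[of vol] by (simp add: space_vol)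
  then have "emeasure vol M = (\<Sum>i<m. chart_volume (fst (cs i)) (snd (cs i)) (M \<inter> D i))"
    by (rule is_volume_sum[OF is_volume_vol _ part])
  also have "\<dots> < \<infinity>"
  proof -
    have "chart_volume (fst (cs i)) (snd (cs i)) (M \<inter> D i) < \<infinity>" if "i < m" for i
    proof -
      interpret immersed_chart "fst (cs i)" "snd (cs i)" by (rule chart[OF cs(1)[OF that]])
      show ?thesis using chart_volume_mono[of "M \<inter> D i" M] cs(2)[OF that] by (auto intro: le_less_trans)
    qed
    then show ?thesis by simp
  qed
  finally show ?thesis .
qed

text \<open>A nonempty chart domain is open and not negligible, and the density is positive on it.
  With total volume zero, a curvature of one sign would still integrate to zero.\<close>

lemma vol_pos: "0 < emeasure vol M"
proof -
  obtain p where "p \<in> M" using M_nonempty by blast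
  then have "p \<in> (\<Union>c\<in>params. snd c ` fst c)" unfolding params_cover .
  then obtain c where c: "c \<in> params" "p \<in> snd c ` fst c" by (elim UN_E)
  interpret immersed_chart "fst c" "snd c" by (rule chart[OF c(1)])
  let ?S = "snd c ` fst c"
  have SM: "?S \<subseteq> M" using UN_upper[OF c(1), of "\<lambda>c. snd c ` fst c"] by (simp only: params_cover)
  then have S: "?S \<in> sets vol" unfolding sets_vol sets_restrict using image_borel[OF c(1)] by simp
  have "0 < chart_volume (fst c) (snd c) ?S"
  proof (rule chart_volume_pos)
    show "fst c \<noteq> {}" using c(2) by (cases "fst c = {}") simp_all
  qed (use image_borel[OF c(1)] in simp_all)
  also have "\<dots> = emeasure vol ?S" by (rule is_volumeD[OF is_volume_vol c(1) S order_refl, symmetric])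
  also have "\<dots> \<le> emeasure vol M"
    by (rule emeasure_mono) (use sets.top[of vol] SM in \<open>simp_all add: space_vol\<close>)
  finally show ?thesis .
qed

section \<open>Scalar curvature as a continuous function and the sign of its integral\<close>

definition curv :: "'e \<Rightarrow> real" where
  "curv = scalar_curvature params (induced_metric (\<lambda>p. p))"

lemma induced_metric_id:
  "c \<in> params \<Longrightarrow> induced_metric (\<lambda>p. p) c = immersed_chart.metric (snd c)"
  using induced_metric_eq[of "fst c" "\<lambda>p. p" c] chart[of c] by (simp add: o_def)

text \<open>\<open>scalar_curvature\<close> selects a value from some chart around the point. By
  \<open>sc_eq\<close> all charts give the same number, so the selection can be evaluated in any
  given chart.\<close>

lemma curv_eq:
  assumes c: "c \<in> params" and x: "x \<in> fst c"
  shows "curv (snd c x) = immersed_chart.sc (snd c) x"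
proof -
  have sc: "scal (induced_metric (\<lambda>p. p) c) x = immersed_chart.sc (snd c) x" if "c \<in> params" "x \<in> fst c" for c x
    unfolding induced_metric_id[OF that(1)]
    by (rule immersed_chart.scal_metric[OF chart[OF that(1)] that(2)])
  have unique: "immersed_chart.sc (snd d) y = immersed_chart.sc (snd c) x"
    if d: "d \<in> params" "y \<in> fst d" "snd d y = snd c x" for d y
  proof -
    interpret chart_change "fst d" "snd d" "fst c" "snd c" "{x \<in> fst d. snd d x \<in> snd c ` fst c}" "inv_into (fst c) (snd c) \<circ> snd d"
      using d(1) c by (intro chart_change_sub_params[of _ _ M]) (auto simp: params_def)
    have "inj_on (snd c) (fst c)" using sub_paramsD(5)[of "fst c" "snd c" M] c by (simp add: params_def)
    then have "(inv_into (fst c) (snd c) \<circ> snd d) y = x" using d x by (simp add: inv_into_f_f)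
    then show ?thesis using sc_eq[of y] d x by auto
  qed
  have "\<exists>s. \<exists>d\<in>params. \<exists>y\<in>fst d. snd d y = snd c x \<and> s = scal (induced_metric (\<lambda>p. p) d) y"
    using c x by blast
  from someI_ex[OF this] obtain d y where "d \<in> params" "y \<in> fst d" "snd d y = snd c x"
    "curv (snd c x) = scal (induced_metric (\<lambda>p. p) d) y"
    unfolding curv_def scalar_curvature_def by blast
  then show ?thesis using sc unique by simp
qed

lemma params_atlas: "topological_atlas (top_of_set M) params"
  unfolding topological_atlas_def
proof (intro conjI ballI)
  fix c assume c: "c \<in> params"
  obtain V \<psi> where Pair: "c = (V, \<psi>)" by (cases c)
  have "\<psi> ` V \<subseteq> M" using c sub_paramsD(3)[of V \<psi> M] by (simp add: Pair params_def)
  then show "open (fst c)" "openin (top_of_set M) (snd c ` fst c)"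
    "homeomorphic_map (top_of_set (fst c)) (subtopology (top_of_set M) (snd c ` fst c)) (snd c)"
    using c unfolding Pair params_def by (simp_all add: sub_params_def subtopology_subtopology Int_absorb1)
qed (simp add: params_cover)

lemma continuous_curv: "continuous_on M curv"
proof -
  have "continuous_map (top_of_set M) euclidean curv"
  proof (rule continuous_map_atlas[OF params_atlas])
    fix c assume c: "c \<in> params"
    show "continuous_on (fst c) (curv \<circ> snd c)"
      using immersed_chart.continuous_sc[OF chart[OF c]] curv_eq[OF c] by (simp cong: continuous_on_cong)
  qed
  then show ?thesis by simp
qed

text \<open>The curvature is bounded, being continuous on a compact set, and the volume is finite.
  Without integrability the integral would take the default value 0 and carry no sign.\<close>

lemma integrable_curv: "integrable vol curv"
proof -
  have "curv \<in> borel_measurable (restrict_space borel M)"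
    by (rule borel_measurable_continuous_on_restrict[OF continuous_curv])
  then have meas: "curv \<in> borel_measurable vol"
    using measurable_cong_sets[OF sets_vol refl] by blast
  have "bounded (curv ` M)"
    using compact_continuous_image[OF continuous_curv compactM] compact_imp_bounded by blast
  then obtain C where C: "\<And>p. p \<in> M \<Longrightarrow> norm (curv p) \<le> C" unfolding bounded_iff by blast
  interpret finite_measure vol by standard (use finite_vol in \<open>simp add: space_vol less_top[symmetric]\<close>)
  show ?thesis
    by (rule integrable_const_bound[of _ C]) (use C meas in \<open>auto intro!: AE_I2 simp: space_vol\<close>)
qed

lemma total_curv: "sub_total_scalar_curvature TYPE('n) M = (LINT p|vol. curv p)"
  unfolding sub_total_scalar_curvature_def total_scalar_curvature_def vol_def curv_def params_def ..

lemma integral_pos: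
  fixes f :: "'e \<Rightarrow> real"
  assumes f: "integrable vol f" and pos: "\<And>p. p \<in> M \<Longrightarrow> 0 < f p"
  shows "0 < (LINT p|vol. f p)"
proof -
  have nonneg: "0 \<le> f p" if "p \<in> M" for p using pos[OF that] by simp
  have "(LINT p|vol. f p) \<noteq> 0"
  proof
    assume "(LINT p|vol. f p) = 0"
    moreover have "AE p in vol. 0 \<le> f p" using nonneg by (intro AE_I2) (simp add: space_vol)
    ultimately have "AE p in vol. f p = 0" using integral_nonneg_eq_0_iff_AE[OF f] by blast
    then have "AE p in vol. False" by (rule AE_mp) (rule AE_I2, use pos in \<open>simp add: space_vol less_imp_neq[symmetric]\<close>)
    then have "emeasure vol (space vol) = 0" using AE_iff_measurable[OF sets.top, of vol "\<lambda>_. False"] by simp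
    then show False using vol_pos by (simp add: space_vol)
  qed
  moreover have "0 \<le> (LINT p|vol. f p)"
    using nonneg by (intro integral_nonneg_AE AE_I2) (simp add: space_vol)
  ultimately show ?thesis by simp
qed

lemma total_sign:
  shows "(\<And>p. p \<in> M \<Longrightarrow> 0 < curv p) \<Longrightarrow> 0 < sub_total_scalar_curvature TYPE('n) M"
    and "(\<And>p. p \<in> M \<Longrightarrow> curv p < 0) \<Longrightarrow> sub_total_scalar_curvature TYPE('n) M < 0"
proof -
  show "0 < sub_total_scalar_curvature TYPE('n) M" if "\<And>p. p \<in> M \<Longrightarrow> 0 < curv p"
    unfolding total_curv by (rule integral_pos[OF integrable_curv that])
  show "sub_total_scalar_curvature TYPE('n) M < 0" if "\<And>p. p \<in> M \<Longrightarrow> curv p < 0"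
    using integral_pos[of "\<lambda>p. - curv p"] integrable_curv that unfolding total_curv by simp
qed

end

section \<open>Homotheties\<close>

lemma det_scaleR_rows:
  fixes A :: "real ^ 'n ^ 'n"
  shows "det (\<chi> i j. r * A $ i $ j) = r ^ CARD('n) * det A"
proof -
  have "(\<chi> i j. r * A $ i $ j) = (\<chi> i. r *s A $ i)" by (simp add: vec_eq_iff)
  then show ?thesis using det_rows_mul[of "\<lambda>_. r" "\<lambda>i. A $ i"] by simp
qed

locale scaled_chart = immersed_chart V F for V :: "(real ^ 'n) set" and F :: "real ^ 'n \<Rightarrow> 'e::euclidean_space" +
  fixes r :: real
  assumes r: "0 < r"
begin

lemma dd_scaled: "x \<in> V \<Longrightarrow> dd (\<lambda>x. r *\<^sub>R F x) x u = r *\<^sub>R dd F x u"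
  using dd_bounded_linear[OF bounded_linear_scaleR_right diffF] .

sublocale s: immersed_chart V "\<lambda>x. r *\<^sub>R F x"
proof
  show "open V" by (rule openV)
  show "smooth_on V (\<lambda>x. r *\<^sub>R F x)"
    by (rule smooth_on_bounded_linear[OF openV bounded_linear_scaleR_right smoothF])
  show "inj (dd (\<lambda>x. r *\<^sub>R F x) x)" if "x \<in> V" for x
    using injF[OF that] r by (simp add: inj_def dd_scaled[OF that])
qed

lemma H_scaled:
  assumes x: "x \<in> V"
  shows "s.H x u v = r *\<^sub>R H x u v"
proof -
  have "dd (\<lambda>y. dd (\<lambda>x. r *\<^sub>R F x) y v) x = dd (\<lambda>y. r *\<^sub>R dd F y v) x"
    by (rule dd_cong(1)[OF openV x]) (rule dd_scaled)
  then show ?thesis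
    unfolding s.H_def H_def using dd_bounded_linear[OF bounded_linear_scaleR_right diffL[OF x]] by simp
qed

lemma Q_scaled: "x \<in> V \<Longrightarrow> s.Q x w = (1 / r) *\<^sub>R Q x w"
  by (rule s.Q_unique) (use r in \<open>simp_all add: dd_scaled Q_inner linear_scale[OF linL]\<close>)

lemma B_scaled:
  assumes x: "x \<in> V"
  shows "s.B x u v = r *\<^sub>R B x u v"
  unfolding s.B_def B_def using r
  by (simp add: H_scaled[OF x] Q_scaled[OF x] dd_scaled[OF x] linear_scale[OF linL[OF x]]
      linear_scale[OF linear_Q[OF x]] scaleR_diff_right)

text \<open>Each value \<open>B x (Q x a) (Q x b)\<close> is multiplied by \<open>r\<close> through
  \<open>B\<close> and by \<open>1 / r\<close> through each \<open>Q\<close>, hence by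
  \<open>1 / r\<close> in all; \<open>sc\<close> consists of products of two such values.\<close>

lemma sc_scaled:
  assumes x: "x \<in> V"
  shows "s.sc x = sc x / r\<^sup>2"
proof -
  have "s.B x (s.Q x a) (s.Q x b) \<bullet> s.B x (s.Q x c) (s.Q x d) = (B x (Q x a) (Q x b) \<bullet> B x (Q x c) (Q x d)) / r\<^sup>2" for a b c d
    unfolding B_scaled[OF x] Q_scaled[OF x] linear_scale[OF B_linear_left[OF x]] linear_scale[OF B_linear_right[OF x]]
    using r by (simp add: power2_eq_square field_simps)
  then show ?thesis unfolding s.sc_def sc_def by (simp add: sum_divide_distrib diff_divide_distrib)
qed

lemma density_scaled:
  assumes x: "x \<in> V"
  shows "density_of (\<lambda>x. r *\<^sub>R F x) x = r ^ CARD('n) * density_of F x"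
proof -
  have "gram (\<lambda>x. r *\<^sub>R F x) x = (\<chi> i j. r\<^sup>2 * gram F x $ i $ j)"
    by (simp add: gram_def dd_scaled[OF x] power2_eq_square vec_eq_iff mult_ac)
  then have "det (gram (\<lambda>x. r *\<^sub>R F x) x) = (r ^ CARD('n))\<^sup>2 * det (gram F x)"
    by (simp add: det_scaleR_rows flip: power_mult mult.commute[of 2])
  then show ?thesis unfolding density_of_def using r by (simp add: real_sqrt_mult)
qed

lemma chart_volume_scaled:
  assumes "S' \<in> sets borel" "{x \<in> V. r *\<^sub>R F x \<in> S} = {x \<in> V. F x \<in> S'}"
  shows "chart_volume V (\<lambda>x. r *\<^sub>R F x) S = ennreal (r ^ CARD('n)) * chart_volume V F S'"
proof -
  have "ennreal (indicator {x \<in> V. r *\<^sub>R F x \<in> S} x * density_of (\<lambda>x. r *\<^sub>R F x) x) =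
     ennreal (r ^ CARD('n)) * ennreal (indicator {x \<in> V. F x \<in> S'} x * density_of F x)" for x
    unfolding assms(2) using r density_pos[of x]
    by (auto simp: indicator_def density_scaled ennreal_mult' less_imp_le)
  then show ?thesis
    unfolding chart_volume_def using density_measurable[OF assms(1)] by (simp add: nn_integral_cmult)
qed

end

section \<open>Homotheties as variations and their effect on the total scalar curvature\<close>

lemma submanifold_scale:
  fixes M :: "'e::euclidean_space set"
  assumes M: "submanifold TYPE('n::finite) M" and r: "r \<noteq> 0"
  shows "submanifold TYPE('n) ((\<lambda>p. r *\<^sub>R p) ` M)"
proof -
  let ?M' = "(\<lambda>p. r *\<^sub>R p) ` M"
  have cov: "(\<Union>c\<in>(sub_params M :: ('n, 'e) param set). snd c ` fst c) = M" and ne: "M \<noteq> {}"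
    using M by (auto simp: submanifold_def case_prod_unfold)
  have "(\<Union>c\<in>(sub_params ?M' :: ('n, 'e) param set). snd c ` fst c) = ?M'"
  proof
    show "(\<Union>c\<in>(sub_params ?M' :: ('n, 'e) param set). snd c ` fst c) \<subseteq> ?M'"
    proof (rule UN_least)
      fix c :: "('n, 'e) param" assume "c \<in> sub_params ?M'"
      then show "snd c ` fst c \<subseteq> ?M'" using sub_paramsD(3)[of "fst c" "snd c" ?M'] by simp
    qed
    show "?M' \<subseteq> (\<Union>c\<in>(sub_params ?M' :: ('n, 'e) param set). snd c ` fst c)"
    proof
      fix q assume "q \<in> ?M'"
      then obtain p where p: "p \<in> M" "q = r *\<^sub>R p" by (elim imageE)
      have "p \<in> (\<Union>c\<in>(sub_params M :: ('n, 'e) param set). snd c ` fst c)" using p(1) by (simp only: cov)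
      then obtain c :: "('n, 'e) param" where c: "c \<in> sub_params M" "p \<in> snd c ` fst c" by (elim UN_E)
      have "(fst c, \<lambda>x. r *\<^sub>R snd c x) \<in> sub_params ?M'" using sub_params_scale[of "fst c" "snd c" M r] c(1) r by simp
      moreover have "q \<in> (\<lambda>x. r *\<^sub>R snd c x) ` fst c" using c(2) p(2) by auto
      ultimately show "q \<in> (\<Union>c\<in>(sub_params ?M' :: ('n, 'e) param set). snd c ` fst c)"
        by (intro UN_I[of "(fst c, \<lambda>x. r *\<^sub>R snd c x)"]) simp_all
    qed
  qed
  then show ?thesis using ne by (simp add: submanifold_def case_prod_unfold)
qed

text \<open>The volume contributes \<open>r ^ n\<close> and the curvature
  \<open>1 / r\<^sup>2\<close>. For the volume, the pushforward of the volume of \<open>M\<close>,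
  multiplied by \<open>r ^ n\<close>, is checked to satisfy the description of the volume of
  \<open>M'\<close>; uniqueness identifies the two measures.\<close>

lemma total_scalar_curvature_scale:
  fixes M :: "'e::euclidean_space set"
  assumes "compact M" "submanifold TYPE('n::finite) M" and r: "0 < r"
  shows "sub_total_scalar_curvature TYPE('n) ((\<lambda>p. r *\<^sub>R p) ` M)
       = r ^ CARD('n) / r\<^sup>2 * sub_total_scalar_curvature TYPE('n) M"
proof -
  define M' where "M' = (\<lambda>p. r *\<^sub>R p) ` M"
  interpret A: compact_submanifold "TYPE('n)" M by standard fact+
  interpret C: compact_submanifold "TYPE('n)" M'
    unfolding M'_def using assms by unfold_locales (auto intro!: compact_scaling submanifold_scale)
  \<comment> \<open>Scaling back by \<open>1 / r\<close> shows that every parametrization of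
    \<open>M'\<close> is a scaled parametrization of \<open>M\<close>, so the comparison can be made
    in all charts of \<open>M'\<close>.\<close>
  have chart: "\<exists>F. (fst c, F) \<in> A.params \<and> snd c = (\<lambda>x. r *\<^sub>R F x)" if c: "c \<in> C.params" for c
  proof -
    have "(fst c, \<lambda>x. (1 / r) *\<^sub>R snd c x) \<in> sub_params ((\<lambda>p. (1 / r) *\<^sub>R p) ` M')"
      using c r by (intro sub_params_scale) (simp_all add: C.params_def)
    moreover have "(\<lambda>p. (1 / r) *\<^sub>R p) ` M' = M" using r by (simp add: M'_def image_image)
    ultimately show ?thesis using r by (intro exI[of _ "\<lambda>x. (1 / r) *\<^sub>R snd c x"]) (simp add: A.params_def)
  qed
  let ?g = "\<lambda>p :: 'e. r *\<^sub>R p"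
  have g: "?g \<in> measurable A.vol (restrict_space borel M')"
  proof (rule measurable_restrict_space2)
    show "?g \<in> space A.vol \<rightarrow> M'" by (auto simp: A.space_vol M'_def)
    have "?g \<in> borel_measurable (restrict_space borel M)"
      by (intro measurable_restrict_space1 borel_measurable_continuous_onI continuous_intros)
    then show "?g \<in> borel_measurable A.vol" using measurable_cong_sets[OF A.sets_vol refl] by blast
  qed
  define \<nu> where "\<nu> = density (distr A.vol (restrict_space borel M') ?g) (\<lambda>_. ennreal (r ^ CARD('n)))"
  have sets: "sets \<nu> = sets (restrict_space borel M')" by (simp add: \<nu>_def)
  have "C.is_volume \<nu>"
    unfolding C.is_volume_def
  proof (intro conjI ballI impI)
    show "space \<nu> = M'" by (simp add: \<nu>_def space_restrict_space)
    show "sets \<nu> = sets (restrict_space borel M')" by (rule sets)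
    fix c S assume c: "c \<in> C.params" and S: "S \<in> sets \<nu>" "S \<subseteq> snd c ` fst c"
    obtain F where F: "(fst c, F) \<in> A.params" "snd c = (\<lambda>x. r *\<^sub>R F x)" using chart[OF c] by blast
    interpret immersed_chart "fst c" F using A.chart[OF F(1)] by simp
    interpret scaled_chart "fst c" F r by standard (rule r)
    define S' where "S' = ?g -` S \<inter> M"
    have S': "S' \<in> sets A.vol"
      using measurable_sets[OF g, of S] S(1) by (simp add: S'_def sets A.space_vol)
    have S'b: "S' \<in> sets borel" using S' by (simp add: A.sets_vol A.sets_restrict)
    have sub: "S' \<subseteq> F ` fst c"
    proof
      fix p assume "p \<in> S'"
      then have "r *\<^sub>R p \<in> (\<lambda>x. r *\<^sub>R F x) ` fst c" using S(2) F(2) by (auto simp: S'_def)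
      then show "p \<in> F ` fst c" using r by auto
    qed
    have FM: "F ` fst c \<subseteq> M" using sub_paramsD(3)[of "fst c" F M] F(1) by (simp add: A.params_def)
    have "emeasure \<nu> S = ennreal (r ^ CARD('n)) * emeasure (distr A.vol (restrict_space borel M') ?g) S"
      unfolding \<nu>_def using S(1) by (intro emeasure_density_const) (simp add: sets)
    also have "emeasure (distr A.vol (restrict_space borel M') ?g) S = emeasure A.vol S'"
      using S(1) g by (subst emeasure_distr) (simp_all add: sets S'_def A.space_vol)
    also have "\<dots> = chart_volume (fst c) F S'"
      using A.is_volumeD[OF A.is_volume_vol F(1) S'] sub by simp
    also have "ennreal (r ^ CARD('n)) * chart_volume (fst c) F S' = chart_volume (fst c) (\<lambda>x. r *\<^sub>R F x) S"
      using FM by (intro chart_volume_scaled[symmetric] S'b) (auto simp: S'_def)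
    finally show "emeasure \<nu> S = chart_volume (fst c) (snd c) S" by (simp add: F(2))
  qed
  then have vol: "C.vol = \<nu>" by (rule C.is_volume_unique[OF C.is_volume_vol])
  have curv: "C.curv (r *\<^sub>R p) = A.curv p / r\<^sup>2" if p: "p \<in> M" for p
  proof -
    have "r *\<^sub>R p \<in> M'" unfolding M'_def using p by (rule imageI)
    then have "r *\<^sub>R p \<in> (\<Union>c\<in>C.params. snd c ` fst c)" by (simp only: C.params_cover)
    then obtain c x where c: "c \<in> C.params" "x \<in> fst c" "r *\<^sub>R p = snd c x" by (elim UN_E imageE)
    obtain F where F: "(fst c, F) \<in> A.params" "snd c = (\<lambda>x. r *\<^sub>R F x)" using chart[OF c(1)] by blast
    interpret immersed_chart "fst c" F using A.chart[OF F(1)] by simp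
    interpret scaled_chart "fst c" F r by standard (rule r)
    have "p = F x" using c(3) F(2) r by simp
    then have "A.curv p = sc x" using A.curv_eq[OF F(1)] c(2) by simp
    moreover have "C.curv (r *\<^sub>R p) = s.sc x"
      using C.curv_eq[OF c(1,2)] by (simp only: c(3) F(2))
    ultimately show ?thesis using sc_scaled[OF c(2)] by simp
  qed
  have meas: "C.curv \<in> borel_measurable (restrict_space borel M')"
    by (rule borel_measurable_continuous_on_restrict[OF C.continuous_curv])
  have "(LINT q|C.vol. C.curv q) = (LINT q|distr A.vol (restrict_space borel M') ?g. r ^ CARD('n) * C.curv q)"
    unfolding vol \<nu>_def using meas r by (subst integral_density) simp_all
  also have "\<dots> = (LINT p|A.vol. r ^ CARD('n) * C.curv (r *\<^sub>R p))"
    using meas g by (subst integral_distr) simp_all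
  also have "\<dots> = (LINT p|A.vol. r ^ CARD('n) / r\<^sup>2 * A.curv p)"
    by (rule Bochner_Integration.integral_cong) (simp_all add: A.space_vol curv)
  also have "\<dots> = r ^ CARD('n) / r\<^sup>2 * (LINT p|A.vol. A.curv p)" by simp
  finally show ?thesis using C.total_curv A.total_curv by (simp add: M'_def)
qed

text \<open>A derivative of \<open>(a + b * t) *\<^sub>R f x\<close> is a sum of two functions of
  the same kind. The induction on \<open>k\<close> therefore has to run over all \<open>a\<close>,
  \<open>b\<close> and \<open>f\<close>.\<close>

lemma Ck_on_affine_scaleR:
  fixes f :: "'a::euclidean_space \<Rightarrow> 'b::real_normed_vector"
  assumes V: "open V" and I: "open I"
  shows "smooth_on V f \<Longrightarrow> Ck_on k (V \<times> I) (\<lambda>z. (a + b * snd z) *\<^sub>R f (fst z))"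
proof (induction k arbitrary: a b f)
  case 0
  have "continuous_on (V \<times> I) (\<lambda>z. f (fst z))"
    by (rule continuous_on_compose2[OF smooth_on_continuous[OF 0]]) (auto intro: continuous_intros)
  then show ?case by (simp only: Ck_on.simps) (intro continuous_intros)
next
  case (Suc k)
  have D: "((\<lambda>z. (a + b * snd z) *\<^sub>R f (fst z)) has_derivative
      (\<lambda>w. (a + b * snd z) *\<^sub>R dd f (fst z) (fst w) + (b * snd w) *\<^sub>R f (fst z))) (at z)"
    if "z \<in> V \<times> I" for z
  proof -
    have "f differentiable (at (fst z))" using that smooth_on_differentiable[OF Suc.prems] by auto
    from diff_chain_at[OF has_derivative_fst[OF has_derivative_ident] has_derivative_dd[OF this]]
    have "((\<lambda>z. f (fst z)) has_derivative (\<lambda>w. dd f (fst z) (fst w))) (at z)" by (simp add: o_def)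
    then show ?thesis
      by (intro has_derivative_scaleR) (auto intro!: derivative_eq_intros)
  qed
  have VI: "open (V \<times> I)" using V I by (rule open_Times)
  have "Ck_on k (V \<times> I) (\<lambda>z. dd (\<lambda>z. (a + b * snd z) *\<^sub>R f (fst z)) z w)" for w
  proof (rule Ck_on_cong[OF VI])
    \<comment> \<open>The summand \<open>0 * snd z\<close> puts the coefficient of the second term
      into affine form, so that the induction hypothesis matches it.\<close>
    show "(a + b * snd z) *\<^sub>R dd f (fst z) (fst w) + (b * snd w + 0 * snd z) *\<^sub>R f (fst z)
        = dd (\<lambda>z. (a + b * snd z) *\<^sub>R f (fst z)) z w" if "z \<in> V \<times> I" for z
      using dd_eqI[OF D[OF that]] by simp
    show "Ck_on k (V \<times> I) (\<lambda>z. (a + b * snd z) *\<^sub>R dd f (fst z) (fst w) + (b * snd w + 0 * snd z) *\<^sub>R f (fst z))"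
      by (intro Ck_on_add[OF VI] Suc.IH smooth_on_dd Suc.prems)
  qed
  moreover have "\<forall>z\<in>V \<times> I. (\<lambda>z. (a + b * snd z) *\<^sub>R f (fst z)) differentiable (at z)"
    using D differentiableI by blast
  ultimately show ?case by (simp only: Ck_on.simps dd_def simp_thms)
qed

text \<open>For times of absolute value below \<open>1/2\<close> the factor \<open>1 + s * t\<close>
  stays positive, so every stage is a homothety with inverse factor \<open>1 / r\<close>.\<close>

lemma homothety_variation:
  fixes M :: "'e::euclidean_space set"
  assumes M: "submanifold TYPE('n::finite) M" and s: "\<bar>s\<bar> = 1"
  shows "variation TYPE('n) M (1/2) (\<lambda>(p, t). (1 + s * t) *\<^sub>R p)"
  unfolding variation_def
proof (intro conjI ballI)
  show "0 < (1/2 :: real)" by simp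
  show "case c of (V, \<psi>) \<Rightarrow> smooth_on (V \<times> {-(1/2)<..<1/2}) (\<lambda>(x, t). case (\<psi> x, t) of (p, t) \<Rightarrow> (1 + s * t) *\<^sub>R p)"
    if "c \<in> (sub_params M :: ('n, 'e) param set)" for c
  proof (cases c)
    case (Pair V \<psi>)
    then interpret immersed_chart V \<psi> using that sub_params_chart[of V \<psi> M] by simp
    have "smooth_on (V \<times> {-(1/2)<..<1/2}) (\<lambda>z. (1 + s * snd z) *\<^sub>R \<psi> (fst z))"
      unfolding smooth_on_def by (intro allI Ck_on_affine_scaleR openV smoothF open_greaterThanLessThan)
    then show ?thesis unfolding Pair by (simp add: case_prod_unfold)
  qed
  show "(case (p, 0) of (p, t) \<Rightarrow> (1 + s * t) *\<^sub>R p) = p" for p :: 'e by simp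
  fix t :: real assume t: "t \<in> {-(1/2)<..<1/2}"
  define r where "r = 1 + s * t"
  have r: "0 < r" using s t by (auto simp: r_def abs_if split: if_splits)
  have eq: "(\<lambda>p. case (p, t) of (p, t) \<Rightarrow> (1 + s * t) *\<^sub>R p) = (\<lambda>p :: 'e. r *\<^sub>R p)" by (simp add: r_def)
  show "submanifold TYPE('n) ((\<lambda>p. case (p, t) of (p, t) \<Rightarrow> (1 + s * t) *\<^sub>R p) ` M)"
    unfolding eq using r by (intro submanifold_scale M) simp
  show "sub_diffeomorphism TYPE('n) M ((\<lambda>p. case (p, t) of (p, t) \<Rightarrow> (1 + s * t) *\<^sub>R p) ` M)
      (\<lambda>p. case (p, t) of (p, t) \<Rightarrow> (1 + s * t) *\<^sub>R p)"
    unfolding eq sub_diffeomorphism_def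
  proof (intro conjI ballI)
    have inj: "inj_on (\<lambda>p :: 'e. r *\<^sub>R p) M" using r by (simp add: inj_on_def)
    then show "bij_betw (\<lambda>p. r *\<^sub>R p) M ((\<lambda>p. r *\<^sub>R p) ` M)" by (simp add: bij_betw_def)
    show "case c of (V, \<psi>) \<Rightarrow> smooth_on V ((\<lambda>p. r *\<^sub>R p) \<circ> \<psi>)"
      if "c \<in> (sub_params M :: ('n, 'e) param set)" for c
    proof (cases c)
      case (Pair V \<psi>)
      then interpret immersed_chart V \<psi> using that sub_params_chart[of V \<psi> M] by simp
      show ?thesis
        using smooth_on_bounded_linear[OF openV bounded_linear_scaleR_right smoothF] by (simp add: Pair o_def)
    qed
    show "case c of (V, \<psi>) \<Rightarrow> smooth_on V (inv_into M (\<lambda>p. r *\<^sub>R p) \<circ> \<psi>)"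
      if "c \<in> (sub_params ((\<lambda>p. r *\<^sub>R p) ` M) :: ('n, 'e) param set)" for c
    proof (cases c)
      case (Pair V \<psi>)
      then have c: "(V, \<psi>) \<in> sub_params ((\<lambda>p. r *\<^sub>R p) ` M)" using that by simp
      interpret immersed_chart V \<psi> by (rule sub_params_chart[OF c])
      have "(1 / r) *\<^sub>R \<psi> x = (inv_into M (\<lambda>p. r *\<^sub>R p) \<circ> \<psi>) x" if "x \<in> V" for x
      proof -
        obtain p where p: "p \<in> M" "\<psi> x = r *\<^sub>R p" using sub_paramsD(3)[OF c] \<open>x \<in> V\<close> by blast
        then show ?thesis using r inv_into_f_f[OF inj p(1)] by simp
      qed
      then show ?thesis unfolding Pair prod.case
        by (rule smooth_on_cong[OF openV _ smooth_on_bounded_linear[OF openV bounded_linear_scaleR_right smoothF]])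
    qed
  qed
qed

lemma homothety_changes_total_scal:
  fixes M :: "'e::euclidean_space set"
  assumes M: "compact M" "submanifold TYPE('n::finite) M" and n: "2 < CARD('n)"
  shows "0 < s * sub_total_scalar_curvature TYPE('n) M \<Longrightarrow> \<bar>s\<bar> = 1 \<Longrightarrow>
      increases_total_scal TYPE('n) M (\<lambda>(p, t). (1 + s * t) *\<^sub>R p)"
    and "s * sub_total_scalar_curvature TYPE('n) M < 0 \<Longrightarrow> \<bar>s\<bar> = 1 \<Longrightarrow>
      decreases_total_scal TYPE('n) M (\<lambda>(p, t). (1 + s * t) *\<^sub>R p)"
proof -
  let ?T = "sub_total_scalar_curvature TYPE('n) M"
  \<comment> \<open>\<open>Suc m\<close> is the exponent \<open>n - 2\<close>. Its positivity is
    what makes a homothety change the total scalar curvature.\<close>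
  obtain m where m: "CARD('n) = Suc m + 2"
    using n by (metis Suc_leI less_iff_Suc_add add.commute add_2_eq_Suc' add_Suc_shift)
  have diff: "sub_total_scalar_curvature TYPE('n) ((\<lambda>p. case (p, t) of (p, t) \<Rightarrow> (1 + s * t) *\<^sub>R p) ` M) - ?T
      = \<bar>(1 + s * t) ^ Suc m - 1\<bar> * (s * ?T) \<and> (1 + s * t) ^ Suc m \<noteq> 1"
    if s: "\<bar>s\<bar> = 1" and t: "t \<in> {0<..<1/2}" for s t :: real
  proof -
    have s1: "s = 1 \<or> s = - 1" using s by (auto simp: abs_if split: if_splits)
    have r: "0 < 1 + s * t" using s1 t by auto
    \<comment> \<open>The number \<open>(1 + s * t) ^ Suc m - 1\<close> is nonzero and has the sign
      of \<open>s\<close>, so the change of the total has the sign of \<open>s\<close> times the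
      total.\<close>
    have "1 < (1 + t) ^ Suc m" "(1 - t) ^ Suc m < 1"
      using t power_Suc_less_one[of "1 - t" m] by (auto intro!: one_less_power simp del: power_Suc)
    then have abs: "(1 + s * t) ^ Suc m - 1 = \<bar>(1 + s * t) ^ Suc m - 1\<bar> * s" and ne: "(1 + s * t) ^ Suc m \<noteq> 1"
      using s1 by (auto simp del: power_Suc)
    have "(1 + s * t) ^ CARD('n) / (1 + s * t)\<^sup>2 = (1 + s * t) ^ Suc m"
      unfolding m power_add using r by simp
    then have "sub_total_scalar_curvature TYPE('n) ((\<lambda>p. case (p, t) of (p, t) \<Rightarrow> (1 + s * t) *\<^sub>R p) ` M)
        = (1 + s * t) ^ Suc m * ?T"
      using total_scalar_curvature_scale[OF M r] by simp
    then have "sub_total_scalar_curvature TYPE('n) ((\<lambda>p. case (p, t) of (p, t) \<Rightarrow> (1 + s * t) *\<^sub>R p) ` M) - ?T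
        = ((1 + s * t) ^ Suc m - 1) * ?T" by (simp add: left_diff_distrib del: power_Suc)
    then show ?thesis using ne by (subst (asm) abs) (simp only: mult.assoc simp_thms)
  qed
  show "increases_total_scal TYPE('n) M (\<lambda>(p, t). (1 + s * t) *\<^sub>R p)" if "0 < s * ?T" "\<bar>s\<bar> = 1"
    unfolding increases_total_scal_def
  proof (rule eventually_at_rightI[of 0 "1/2"])
    fix t :: real assume t: "t \<in> {0<..<1/2}"
    show "?T < sub_total_scalar_curvature TYPE('n) ((\<lambda>p. case (p, t) of (p, t) \<Rightarrow> (1 + s * t) *\<^sub>R p) ` M)"
      using diff[OF that(2) t] mult_pos_pos[OF _ that(1), of "\<bar>(1 + s * t) ^ Suc m - 1\<bar>"] by auto
  qed simp
  show "decreases_total_scal TYPE('n) M (\<lambda>(p, t). (1 + s * t) *\<^sub>R p)" if "s * ?T < 0" "\<bar>s\<bar> = 1"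
    unfolding decreases_total_scal_def
  proof (rule eventually_at_rightI[of 0 "1/2"])
    fix t :: real assume t: "t \<in> {0<..<1/2}"
    show "sub_total_scalar_curvature TYPE('n) ((\<lambda>p. case (p, t) of (p, t) \<Rightarrow> (1 + s * t) *\<^sub>R p) ` M) < ?T"
      using diff[OF that(2) t] mult_pos_neg[OF _ that(1), of "\<bar>(1 + s * t) ^ Suc m - 1\<bar>"] by auto
  qed simp
qed

text \<open>Outside this range the tensor is zero by convention. For \<open>k = 1\<close> this is
  the source of the bound \<open>n \<ge> 3\<close>.\<close>

lemma definite_lovelock_dimension:
  fixes T :: "real ^ 'n \<Rightarrow> real ^ 'n \<Rightarrow> real"
  assumes "positive_definite (lovelock_form k g R :: real ^ 'n \<Rightarrow> _) \<or> negative_definite (lovelock_form k g R)"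
  shows "2 * k < CARD('n)"
proof (rule ccontr)
  assume "\<not> ?thesis"
  then have "lovelock_form k g R u u = 0" for u :: "real ^ 'n" by (simp add: lovelock_form_def)
  moreover have "axis undefined 1 \<noteq> (0 :: real ^ 'n)" by (simp add: axis_eq_0_iff)
  ultimately show False using assms unfolding positive_definite_def negative_definite_def by force
qed

text \<open>One of the two signs holds on all of \<open>M\<close>, so the scalar curvature has a
  constant strict sign and its integral inherits it.\<close>

lemma definite_total_scalar_curvature:
  fixes M :: "'e::euclidean_space set"
  assumes M: "compact M" "submanifold TYPE('n::finite) M"
    and T: "positive_lovelock 1 (sub_params M :: ('n, 'e) param set) (induced_metric (\<lambda>p. p)) \<or>
         negative_lovelock 1 (sub_params M :: ('n, 'e) param set) (induced_metric (\<lambda>p. p))"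
  shows "2 < CARD('n) \<and> sub_total_scalar_curvature TYPE('n) M \<noteq> 0"
proof -
  interpret compact_submanifold "TYPE('n)" M by standard fact+
  have T': "positive_lovelock 1 params (induced_metric (\<lambda>p. p)) \<or> negative_lovelock 1 params (induced_metric (\<lambda>p. p))"
    using T by (simp add: params_def)
  have point: "\<exists>c\<in>params. \<exists>x\<in>fst c. p = snd c x" if "p \<in> M" for p
  proof -
    have "p \<in> (\<Union>c\<in>params. snd c ` fst c)" using that by (simp only: params_cover)
    then show ?thesis by blast
  qed
  have pos: "positive_definite (lovelock 1 (immersed_chart.metric (snd c)) x)"
    if "positive_lovelock 1 params (induced_metric (\<lambda>p. p))" "c \<in> params" "x \<in> fst c" for c x
    using that induced_metric_id[OF that(2)] unfolding positive_lovelock_def by metis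
  have neg: "negative_definite (lovelock 1 (immersed_chart.metric (snd c)) x)"
    if "negative_lovelock 1 params (induced_metric (\<lambda>p. p))" "c \<in> params" "x \<in> fst c" for c x
    using that induced_metric_id[OF that(2)] unfolding negative_lovelock_def by metis
  obtain p where "p \<in> M" using M_nonempty by blast
  then obtain c x where "c \<in> params" "x \<in> fst c" using point by blast
  then have n: "2 < CARD('n)"
    using T' pos neg definite_lovelock_dimension[of 1] unfolding lovelock_def by (metis mult.right_neutral)
  show ?thesis
  proof (cases "positive_lovelock 1 params (induced_metric (\<lambda>p. p))")
    case True
    have "0 < curv p" if p: "p \<in> M" for p
    proof -
      obtain c x where c: "c \<in> params" "x \<in> fst c" "p = snd c x" using point[OF p] by blast
      then show ?thesis
        using immersed_chart.sc_sign(1)[OF chart[OF c(1)] c(2) n pos[OF True c(1,2)]] curv_eq[OF c(1,2)] by simp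
    qed
    then show ?thesis using total_sign(1) n by force
  next
    case False
    then have N: "negative_lovelock 1 params (induced_metric (\<lambda>p. p))" using T' by blast
    have "curv p < 0" if p: "p \<in> M" for p
    proof -
      obtain c x where c: "c \<in> params" "x \<in> fst c" "p = snd c x" using point[OF p] by blast
      then show ?thesis
        using immersed_chart.sc_sign(2)[OF chart[OF c(1)] c(2) n neg[OF N c(1,2)]] curv_eq[OF c(1,2)] by simp
    qed
    then show ?thesis using total_sign(2) n by force
  qed
qed

lemma submanifold_not_minimal:
  fixes M :: "'e::euclidean_space set"
  assumes M: "compact M" "submanifold TYPE('n::finite) M"
    and T: "positive_lovelock k (sub_params M :: ('n, 'e) param set) (induced_metric (\<lambda>p. p)) \<or>
         negative_lovelock k (sub_params M :: ('n, 'e) param set) (induced_metric (\<lambda>p. p))"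
  shows "\<not> minimal_immersion k (sub_params M :: ('n, 'e) param set) (\<lambda>p. p)"
proof -
  interpret compact_submanifold "TYPE('n)" M by standard fact+
  show ?thesis
  proof (rule no_minimal_immersion[OF _ _ _ _ T, of "top_of_set M"])
    show "topological_atlas (top_of_set M) (sub_params M :: ('n, 'e) param set)"
      using params_atlas by (simp add: params_def)
    show "topspace (top_of_set M) \<noteq> {}" using M_nonempty by simp
    show "compact_space (top_of_set M)" using compactM by (simp add: compact_space_subtopology)
    show "immersion (sub_params M :: ('n, 'e) param set) (\<lambda>p. p)"
      by (auto simp: immersion_def sub_params_def o_def)
  qed
qed

text \<open>Compact submanifolds occur in two forms: as immersed manifolds with the induced metric
  in the second clause, and as subsets of the Euclidean space in the third, where variations are
  defined.\<close>

theorem corollary3p13: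
  shows
    "(\<forall>k (X :: 'm topology) (A :: ('n::finite, 'm) param set) G.
        2 * k < CARD('n) \<and> riemannian_manifold X A G \<and> compact_space X \<and>
        (positive_lovelock k A G \<or> negative_lovelock k A G) \<longrightarrow>
        \<not> (\<exists>f :: 'm \<Rightarrow> 'e::euclidean_space.
              isometric_immersion A G f \<and> minimal_immersion k A f)) \<and>
     (\<forall>(X :: 'm topology) (A :: ('n, 'm) param set) (f :: 'm \<Rightarrow> 'e).
        smooth_manifold X A \<and> compact_space X \<and> immersion A f \<and>
        (positive_lovelock 1 A (induced_metric f) \<or> negative_lovelock 1 A (induced_metric f)) \<longrightarrow>
        \<not> minimal_immersion 1 A f) \<and>
     (\<forall>M :: 'e set.
        submanifold TYPE('n) M \<and> compact M \<and>
        (positive_lovelock 1 (sub_params M :: ('n, 'e) param set) (induced_metric (\<lambda>p. p)) \<or>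
         negative_lovelock 1 (sub_params M :: ('n, 'e) param set) (induced_metric (\<lambda>p. p))) \<longrightarrow>
        \<not> minimal_immersion 1 (sub_params M :: ('n, 'e) param set) (\<lambda>p. p) \<and>
        (\<exists>\<epsilon> F. variation TYPE('n) M \<epsilon> F \<and> increases_total_scal TYPE('n) M F) \<and>
        (\<exists>\<epsilon> F. variation TYPE('n) M \<epsilon> F \<and> decreases_total_scal TYPE('n) M F))"
proof (intro conjI allI impI)
  have not_minimal: "\<not> minimal_immersion k A f"
    if "smooth_manifold X A" "compact_space X" "immersion A f"
      "positive_lovelock k A (induced_metric f) \<or> negative_lovelock k A (induced_metric f)"
    for k and X :: "'m topology" and A :: "('n, 'm) param set" and f :: "'m \<Rightarrow> 'e"
    using that by (intro no_minimal_immersion[OF smooth_manifold_atlas]) (simp_all add: smooth_manifold_def)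
  show "\<not> minimal_immersion 1 A f"
    if "smooth_manifold X A \<and> compact_space X \<and> immersion A f \<and>
        (positive_lovelock 1 A (induced_metric f) \<or> negative_lovelock 1 A (induced_metric f))"
    for X :: "'m topology" and A :: "('n, 'm) param set" and f :: "'m \<Rightarrow> 'e"
    using that by (intro not_minimal) auto
  show "\<not> (\<exists>f :: 'm \<Rightarrow> 'e. isometric_immersion A G f \<and> minimal_immersion k A f)"
    if *: "2 * k < CARD('n) \<and> riemannian_manifold X A G \<and> compact_space X \<and>
        (positive_lovelock k A G \<or> negative_lovelock k A G)"
    for k and X :: "'m topology" and A :: "('n, 'm) param set" and G
  proof
    assume "\<exists>f :: 'm \<Rightarrow> 'e. isometric_immersion A G f \<and> minimal_immersion k A f"
    then obtain f :: "'m \<Rightarrow> 'e" where f: "isometric_immersion A G f" "minimal_immersion k A f" by blast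
    have X: "smooth_manifold X A" using * by (simp add: riemannian_manifold_def)
    \<comment> \<open>The given metric and the induced one agree on the whole domain of the chart,
      so definiteness passes to the metric for which \<open>h_odd\<close> is computed.\<close>
    have "lovelock k (G c) x = lovelock k (induced_metric f c) x" if "c \<in> A" "x \<in> fst c" for c x
    proof (rule lovelock_cong[of "fst c"])
      show "open (fst c)" by (rule topological_atlasD(1)[OF smooth_manifold_atlas[OF X] that(1)])
      show "G c y = induced_metric f c y" if "y \<in> fst c" for y
        using f(1) \<open>c \<in> A\<close> that unfolding isometric_immersion_def by (intro ext) simp
    qed fact
    then have "positive_lovelock k A (induced_metric f) \<or> negative_lovelock k A (induced_metric f)"
      using * unfolding positive_lovelock_def negative_lovelock_def by simp
    moreover have "immersion A f" using f(1) by (simp add: isometric_immersion_def)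
    ultimately show False using not_minimal[OF X] * f(2) by blast
  qed
  fix M :: "'e set"
  assume *: "submanifold TYPE('n) M \<and> compact M \<and>
        (positive_lovelock 1 (sub_params M :: ('n, 'e) param set) (induced_metric (\<lambda>p. p)) \<or>
         negative_lovelock 1 (sub_params M :: ('n, 'e) param set) (induced_metric (\<lambda>p. p)))"
  then have M: "compact M" "submanifold TYPE('n) M" by auto
  show "\<not> minimal_immersion 1 (sub_params M :: ('n, 'e) param set) (\<lambda>p. p)"
    using submanifold_not_minimal[OF M] * by blast
  let ?T = "sub_total_scalar_curvature TYPE('n) M"
  have n: "2 < CARD('n)" and T: "?T \<noteq> 0"
    using definite_total_scalar_curvature[OF M] * by auto
  \<comment> \<open>Expansion increases a positive total and decreases a negative one. The direction
    \<open>sgn ?T\<close> therefore always increases the total, and the opposite direction decreases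
    it.\<close>
  have s: "\<bar>sgn ?T\<bar> = 1" "\<bar>- sgn ?T\<bar> = 1" "0 < sgn ?T * ?T" "- sgn ?T * ?T < 0"
    using T by (auto simp: sgn_if)
  show "\<exists>\<epsilon> F. variation TYPE('n) M \<epsilon> F \<and> increases_total_scal TYPE('n) M F"
    using homothety_variation[OF M(2) s(1)] homothety_changes_total_scal(1)[OF M n s(3,1)] by blast
  show "\<exists>\<epsilon> F. variation TYPE('n) M \<epsilon> F \<and> decreases_total_scal TYPE('n) M F"
    using homothety_variation[OF M(2) s(2)] homothety_changes_total_scal(2)[OF M n s(4,2)] by blast
qed

end
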